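(* Let $A$ be an artin algebra. For a (finitely generated) left or right $A$-module $M$ consider the conditions: (G1) $M$ is semi-Gorenstein-projective; (G2) the $A$-dual $M^*=\operatorname{Hom}(M,A)$ is semi-Gorenstein-projective; (G3) $M$ is reflexive. If a left $A$-module $M$ is semi-Gorenstein-projective and not Gorenstein-projective, then $\Omega^2M$ satisfies (G1) and (G3), but not (G2). If a left $A$-module $M'$ satisfies (G1) and (G3), but not (G2), then $N=(M')^*$ is a right $A$-module satisfying (G2) and (G3), but not (G1).
   Context: A left (right) module $M$ is semi-Gorenstein-projective if $\operatorname{Ext}^i(M,A)=0$ for all $i\ge1$, where $A$ is the regular left (right) module. The $A$-dual of a left module is a right module and conversely. $M$ is reflexive if the canonical map $\phi_M\colon M\to M^{**}$, $\phi_M(m)(f)=f(m)$, is bijective. $\Omega M$ is the kernel of a projective cover of $M$. $M$ is Gorenstein-projective if it is isomorphic to the image of $d^0\colon P^0\to P^1$ for some doubly infinite exact sequence $P^\bullet$ of finitely generated projective modules such that $\operatorname{Hom}_A(P^\bullet,A)$ is exact. *)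

theory Defs
  imports "HOL-Algebra.Module" "HOL-Algebra.Ideal" "HOL-Algebra.Elementary_Groups"
begin

section \<open>Modules over a not necessarily commutative ring\<close>

text \<open>
  The library locale \<^locale>\<open>module\<close> requires a commutative ring of scalars; the record
  \<^type>\<open>module_ext\<close> and the locale \<^locale>\<open>submodule\<close> do not, and are used unchanged.
  As in the library, the ring multiplication and unit stored in a module record are irrelevant.
\<close>

locale left_module = R?: ring A + M?: abelian_group M
  for A :: "('a, 'x) ring_scheme" (structure) and M :: "('a, 'm, 'z) module_scheme" (structure) +
  assumes smult_closed [simp, intro]:
      "\<lbrakk> a \<in> carrier A; x \<in> carrier M \<rbrakk> \<Longrightarrow> a \<odot>\<^bsub>M\<^esub> x \<in> carrier M"
    and smult_l_distr:
      "\<lbrakk> a \<in> carrier A; b \<in> carrier A; x \<in> carrier M \<rbrakk> \<Longrightarrow>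
        (a \<oplus> b) \<odot>\<^bsub>M\<^esub> x = a \<odot>\<^bsub>M\<^esub> x \<oplus>\<^bsub>M\<^esub> b \<odot>\<^bsub>M\<^esub> x"
    and smult_r_distr:
      "\<lbrakk> a \<in> carrier A; x \<in> carrier M; y \<in> carrier M \<rbrakk> \<Longrightarrow>
        a \<odot>\<^bsub>M\<^esub> (x \<oplus>\<^bsub>M\<^esub> y) = a \<odot>\<^bsub>M\<^esub> x \<oplus>\<^bsub>M\<^esub> a \<odot>\<^bsub>M\<^esub> y"
    and smult_assoc1:
      "\<lbrakk> a \<in> carrier A; b \<in> carrier A; x \<in> carrier M \<rbrakk> \<Longrightarrow>
        (a \<otimes> b) \<odot>\<^bsub>M\<^esub> x = a \<odot>\<^bsub>M\<^esub> (b \<odot>\<^bsub>M\<^esub> x)"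
    and smult_one [simp]:
      "x \<in> carrier M \<Longrightarrow> \<one> \<odot>\<^bsub>M\<^esub> x = x"

text \<open>
  Right \<open>A\<close>-modules are left modules over the opposite ring: \<open>a \<odot> x\<close> stands for \<open>x a\<close>.
  Consequently every notion below, applied to \<open>op_ring A\<close>, is the notion for right \<open>A\<close>-modules.
\<close>

definition op_ring :: "('a, 'x) ring_scheme \<Rightarrow> ('a, 'x) ring_scheme"
  where "op_ring A = A\<lparr> mult := (\<lambda>x y. y \<otimes>\<^bsub>A\<^esub> x) \<rparr>"

abbreviation right_module :: "('a, 'x) ring_scheme \<Rightarrow> ('a, 'm, 'z) module_scheme \<Rightarrow> bool"
  where "right_module A M \<equiv> left_module (op_ring A) M"

definition fin_gen :: "('a, 'x) ring_scheme \<Rightarrow> ('a, 'm, 'z) module_scheme \<Rightarrow> bool"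
  where "fin_gen A M \<longleftrightarrow>
    (\<exists>S. finite S \<and> S \<subseteq> carrier M \<and>
      (\<forall>x \<in> carrier M. \<exists>c \<in> S \<rightarrow> carrier A. x = (\<Oplus>\<^bsub>M\<^esub>s\<in>S. c s \<odot>\<^bsub>M\<^esub> s)))"

definition regular_module :: "('a, 'x) ring_scheme \<Rightarrow> ('a, 'a) module"
  where "regular_module A =
    \<lparr> carrier = carrier A, mult = mult A, one = one A, zero = zero A, add = add A, smult = mult A \<rparr>"

text \<open>Homomorphisms are extensional, so that equality of functions is equality of homomorphisms.\<close>

definition mod_hom ::
  "('a, 'x) ring_scheme \<Rightarrow> ('a, 'm, 'y) module_scheme \<Rightarrow> ('a, 'n, 'z) module_scheme \<Rightarrow> ('m \<Rightarrow> 'n) set"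
  where "mod_hom A M N =
    {f \<in> carrier M \<rightarrow>\<^sub>E carrier N.
      (\<forall>x \<in> carrier M. \<forall>y \<in> carrier M. f (x \<oplus>\<^bsub>M\<^esub> y) = f x \<oplus>\<^bsub>N\<^esub> f y) \<and>
      (\<forall>a \<in> carrier A. \<forall>x \<in> carrier M. f (a \<odot>\<^bsub>M\<^esub> x) = a \<odot>\<^bsub>N\<^esub> f x)}"

definition mod_iso ::
  "('a, 'x) ring_scheme \<Rightarrow> ('a, 'm, 'y) module_scheme \<Rightarrow> ('a, 'n, 'z) module_scheme \<Rightarrow> bool"
  where "mod_iso A M N \<longleftrightarrow> (\<exists>f \<in> mod_hom A M N. bij_betw f (carrier M) (carrier N))"

definition hom_kernel ::
  "('a, 'm, 'y) module_scheme \<Rightarrow> ('a, 'n, 'z) module_scheme \<Rightarrow> ('m \<Rightarrow> 'n) \<Rightarrow> 'm set"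
  where "hom_kernel M N f = {x \<in> carrier M. f x = \<zero>\<^bsub>N\<^esub>}"

definition hom_group ::
  "('a, 'x) ring_scheme \<Rightarrow> ('a, 'm, 'y) module_scheme \<Rightarrow> ('a, 'n, 'z) module_scheme \<Rightarrow> ('m \<Rightarrow> 'n) ring"
  where "hom_group A M N =
    \<lparr> carrier = mod_hom A M N, mult = undefined, one = undefined,
      zero = (\<lambda>x\<in>carrier M. \<zero>\<^bsub>N\<^esub>),
      add = (\<lambda>f g. \<lambda>x\<in>carrier M. f x \<oplus>\<^bsub>N\<^esub> g x) \<rparr>"


section \<open>Artin algebras\<close>

definition artinian :: "('k, 'x) ring_scheme \<Rightarrow> bool"
  where "artinian k \<longleftrightarrow>
    (\<forall>I :: nat \<Rightarrow> 'k set. (\<forall>n. ideal (I n) k \<and> I (Suc n) \<subseteq> I n) \<longrightarrow> (\<exists>N. \<forall>n\<ge>N. I n = I N))"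

text \<open>
  Compare the library locale \<^locale>\<open>algebra\<close>, in which the algebra itself is commutative.
  The \<open>k\<close>-algebra structure on \<open>A\<close> is the scalar multiplication of the record \<open>A\<close>.
\<close>

locale artin_algebra = module k A + A?: ring A
  for k :: "('k, 'x) ring_scheme" (structure) and A :: "('k, 'a, 'z) module_scheme" (structure) +
  assumes smult_mult_left:
      "\<lbrakk> c \<in> carrier k; x \<in> carrier A; y \<in> carrier A \<rbrakk> \<Longrightarrow>
        (c \<odot>\<^bsub>A\<^esub> x) \<otimes>\<^bsub>A\<^esub> y = c \<odot>\<^bsub>A\<^esub> (x \<otimes>\<^bsub>A\<^esub> y)"
    and smult_mult_right:
      "\<lbrakk> c \<in> carrier k; x \<in> carrier A; y \<in> carrier A \<rbrakk> \<Longrightarrow>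
        x \<otimes>\<^bsub>A\<^esub> (c \<odot>\<^bsub>A\<^esub> y) = c \<odot>\<^bsub>A\<^esub> (x \<otimes>\<^bsub>A\<^esub> y)"
    and artinian_base: "artinian k"
    and fin_gen_over_base: "fin_gen k A"


section \<open>Duals and reflexive modules\<close>

text \<open>
  For a left \<open>A\<close>-module \<open>M\<close>, the group \<open>Hom(M, A)\<close> is a right \<open>A\<close>-module via \<open>(f a)(x) = f(x) a\<close>.
  For a right \<open>A\<close>-module \<open>N\<close>, \<open>dual (op_ring A) N\<close> is the left \<open>A\<close>-module \<open>Hom(N, A)\<close>
  with \<open>(a f)(x) = a f(x)\<close>; the bidual of \<open>M\<close> is thus \<open>dual (op_ring A) (dual A M)\<close>.
\<close>

definition dual :: "('a, 'x) ring_scheme \<Rightarrow> ('a, 'm, 'z) module_scheme \<Rightarrow> ('a, 'm \<Rightarrow> 'a) module"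
  where "dual A M =
    \<lparr> carrier = mod_hom A M (regular_module A), mult = undefined, one = undefined,
      zero = (\<lambda>x\<in>carrier M. \<zero>\<^bsub>A\<^esub>),
      add = (\<lambda>f g. \<lambda>x\<in>carrier M. f x \<oplus>\<^bsub>A\<^esub> g x),
      smult = (\<lambda>a f. \<lambda>x\<in>carrier M. f x \<otimes>\<^bsub>A\<^esub> a) \<rparr>"

definition eval_map ::
  "('a, 'x) ring_scheme \<Rightarrow> ('a, 'm, 'z) module_scheme \<Rightarrow> 'm \<Rightarrow> ('m \<Rightarrow> 'a) \<Rightarrow> 'a"
  where "eval_map A M = (\<lambda>x\<in>carrier M. \<lambda>f\<in>carrier (dual A M). f x)"

definition reflexive :: "('a, 'x) ring_scheme \<Rightarrow> ('a, 'm, 'z) module_scheme \<Rightarrow> bool"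
  where "reflexive A M \<longleftrightarrow>
    bij_betw (eval_map A M) (carrier M) (carrier (dual (op_ring A) (dual A M)))"


section \<open>Finitely generated projective modules, projective covers, syzygies\<close>

definition free_module :: "('a, 'x) ring_scheme \<Rightarrow> nat \<Rightarrow> ('a, nat \<Rightarrow> 'a) module"
  where "free_module A n =
    \<lparr> carrier = {..<n} \<rightarrow>\<^sub>E carrier A, mult = undefined, one = undefined,
      zero = (\<lambda>i\<in>{..<n}. \<zero>\<^bsub>A\<^esub>),
      add = (\<lambda>u v. \<lambda>i\<in>{..<n}. u i \<oplus>\<^bsub>A\<^esub> v i),
      smult = (\<lambda>a u. \<lambda>i\<in>{..<n}. a \<otimes>\<^bsub>A\<^esub> u i) \<rparr>"

text \<open>
  Finitely generated projective: a direct summand of some \<open>A\<^sup>n\<close>.  In particular each such module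
  is isomorphic to one whose elements have type \<^typ>\<open>nat \<Rightarrow> 'a\<close>, so nothing is lost
  when quantifiers over finitely generated projective modules below range over modules on that type.
\<close>

definition fg_projective :: "('a, 'x) ring_scheme \<Rightarrow> ('a, 'p, 'z) module_scheme \<Rightarrow> bool"
  where "fg_projective A P \<longleftrightarrow> left_module A P \<and>
    (\<exists>n. \<exists>i \<in> mod_hom A P (free_module A n). \<exists>r \<in> mod_hom A (free_module A n) P.
      \<forall>x \<in> carrier P. r (i x) = x)"

text \<open>A projective cover is an epimorphism from a projective module with superfluous kernel.\<close>

definition projective_cover ::
  "('a, 'x) ring_scheme \<Rightarrow> ('a, 'm, 'y) module_scheme \<Rightarrow> ('a, 'p, 'z) module_scheme \<Rightarrow> ('p \<Rightarrow> 'm) \<Rightarrow> bool"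
  where "projective_cover A M P p \<longleftrightarrow>
    fg_projective A P \<and> p \<in> mod_hom A P M \<and> p ` carrier P = carrier M \<and>
    (\<forall>L. submodule L A P \<and> L <+>\<^bsub>P\<^esub> hom_kernel P M p = carrier P \<longrightarrow> L = carrier P)"

text \<open>
  The syzygy \<open>\<Omega> M\<close> is determined only up to isomorphism; \<open>is_syzygy A M K\<close> says that \<open>K\<close> is
  the kernel of some projective cover of \<open>M\<close>.
\<close>

definition is_syzygy ::
  "('a, 'x) ring_scheme \<Rightarrow> ('a, 'm, 'y) module_scheme \<Rightarrow> ('a, 'p, 'z) module_scheme \<Rightarrow> bool"
  where "is_syzygy A M K \<longleftrightarrow>
    (\<exists>P p. projective_cover A M P p \<and> K = P\<lparr> carrier := hom_kernel P M p \<rparr>)"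


section \<open>Ext and (semi-)Gorenstein-projective modules\<close>

text \<open>\<open>\<dots> \<rightarrow> P 2 \<rightarrow> P 1 \<rightarrow> P 0 \<rightarrow> M \<rightarrow> 0\<close> with \<open>d n : P (n + 1) \<rightarrow> P n\<close> and augmentation \<open>e\<close>.\<close>

definition projective_resolution ::
  "('a, 'x) ring_scheme \<Rightarrow> ('a, 'm, 'y) module_scheme \<Rightarrow> (nat \<Rightarrow> ('a, 'p, 'z) module_scheme) \<Rightarrow>
    (nat \<Rightarrow> 'p \<Rightarrow> 'p) \<Rightarrow> ('p \<Rightarrow> 'm) \<Rightarrow> bool"
  where "projective_resolution A M P d e \<longleftrightarrow>
    (\<forall>n. fg_projective A (P n)) \<and>
    (\<forall>n. d n \<in> mod_hom A (P (Suc n)) (P n)) \<and>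
    e \<in> mod_hom A (P 0) M \<and>
    e ` carrier (P 0) = carrier M \<and>
    d 0 ` carrier (P 1) = hom_kernel (P 0) M e \<and>
    (\<forall>n. d (Suc n) ` carrier (P (Suc (Suc n))) = hom_kernel (P (Suc n)) (P n) (d n))"

definition cocycles ::
  "('a, 'x) ring_scheme \<Rightarrow> (nat \<Rightarrow> ('a, 'p, 'y) module_scheme) \<Rightarrow> (nat \<Rightarrow> 'p \<Rightarrow> 'p) \<Rightarrow>
    ('a, 'n, 'z) module_scheme \<Rightarrow> nat \<Rightarrow> ('p \<Rightarrow> 'n) set"
  where "cocycles A P d N n =
    {f \<in> mod_hom A (P n) N. \<forall>x \<in> carrier (P (Suc n)). f (d n x) = \<zero>\<^bsub>N\<^esub>}"

definition coboundaries ::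
  "('a, 'x) ring_scheme \<Rightarrow> (nat \<Rightarrow> ('a, 'p, 'y) module_scheme) \<Rightarrow> (nat \<Rightarrow> 'p \<Rightarrow> 'p) \<Rightarrow>
    ('a, 'n, 'z) module_scheme \<Rightarrow> nat \<Rightarrow> ('p \<Rightarrow> 'n) set"
  where "coboundaries A P d N n =
    (case n of
      0 \<Rightarrow> {\<lambda>x\<in>carrier (P 0). \<zero>\<^bsub>N\<^esub>}
    | Suc m \<Rightarrow> (\<lambda>g. compose (carrier (P n)) g (d m)) ` mod_hom A (P m) N)"

text \<open>
  \<open>Ext A M N n\<close> is the \<open>n\<close>-th cohomology group of \<open>Hom(P, N)\<close> for a chosen resolution \<open>P\<close> of \<open>M\<close>
  by finitely generated projective modules.  It is intended for finitely generated \<open>M\<close> over an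
  artin algebra, where such a resolution exists, and it does not depend on the choice
  up to isomorphism.
\<close>

definition Ext ::
  "('a, 'x) ring_scheme \<Rightarrow> ('a, 'm, 'y) module_scheme \<Rightarrow> ('a, 'n, 'z) module_scheme \<Rightarrow> nat \<Rightarrow>
    ((nat \<Rightarrow> 'a) \<Rightarrow> 'n) set monoid"
  where "Ext A M N n =
    (let (P, d) = (SOME (P, d). \<exists>e. projective_resolution A M
                    (P :: nat \<Rightarrow> ('a, nat \<Rightarrow> 'a) module) d e)
     in (hom_group A (P n) N)\<lparr> carrier := cocycles A P d N n \<rparr> A_Mod coboundaries A P d N n)"

definition semi_gorenstein_projective ::
  "('a, 'x) ring_scheme \<Rightarrow> ('a, 'm, 'z) module_scheme \<Rightarrow> bool"
  where "semi_gorenstein_projective A M \<longleftrightarrow>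
    (\<forall>i\<ge>1. trivial_group (Ext A M (regular_module A) i))"

text \<open>
  Exactness of \<open>Hom(P, A)\<close> at \<open>Hom(P i, A)\<close>: the homomorphisms killed by composition with
  \<open>d (i - 1)\<close> are those that factor through \<open>d i\<close>.
\<close>

definition complete_resolution ::
  "('a, 'x) ring_scheme \<Rightarrow> (int \<Rightarrow> ('a, 'p, 'z) module_scheme) \<Rightarrow> (int \<Rightarrow> 'p \<Rightarrow> 'p) \<Rightarrow> bool"
  where "complete_resolution A P d \<longleftrightarrow>
    (\<forall>i. fg_projective A (P i)) \<and>
    (\<forall>i. d i \<in> mod_hom A (P i) (P (i + 1))) \<and>
    (\<forall>i. d (i - 1) ` carrier (P (i - 1)) = hom_kernel (P i) (P (i + 1)) (d i)) \<and>
    (\<forall>i. (\<lambda>g. compose (carrier (P i)) g (d i)) ` mod_hom A (P (i + 1)) (regular_module A) =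
      {f \<in> mod_hom A (P i) (regular_module A). \<forall>x \<in> carrier (P (i - 1)). f (d (i - 1) x) = \<zero>\<^bsub>A\<^esub>})"

definition gorenstein_projective :: "('a, 'x) ring_scheme \<Rightarrow> ('a, 'm, 'z) module_scheme \<Rightarrow> bool"
  where "gorenstein_projective A M \<longleftrightarrow>
    (\<exists>(P :: int \<Rightarrow> ('a, nat \<Rightarrow> 'a) module) d. complete_resolution A P d \<and>
      mod_iso A M ((P 1)\<lparr> carrier := d 0 ` carrier (P 0) \<rparr>))"

section \<open>Consistency of the opposite-ring encoding\<close>

lemma op_ring_simps [simp]:
  "carrier (op_ring A) = carrier A" "zero (op_ring A) = zero A" "one (op_ring A) = one A"
  "add (op_ring A) = add A" "x \<otimes>\<^bsub>op_ring A\<^esub> y = y \<otimes>\<^bsub>A\<^esub> x" "op_ring (op_ring A) = A"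
  by (simp_all add: op_ring_def)

lemma ring_op_ring:
  assumes "ring A" shows "ring (op_ring A)"
proof -
  interpret ring A by fact
  have neg: "\<exists>y\<in>carrier A. y \<oplus>\<^bsub>A\<^esub> x = \<zero>\<^bsub>A\<^esub>" if "x \<in> carrier A" for x
    using that by (intro bexI[where x = "\<ominus>\<^bsub>A\<^esub> x"]) (auto simp: l_neg)
  have "abelian_group (op_ring A)"
    by (rule abelian_groupI) (auto simp: a_ac neg)
  moreover have "monoid (op_ring A)"
    by (rule monoidI) (auto simp: m_assoc)
  ultimately show ?thesis
    by (rule ringI) (auto simp: l_distr r_distr)
qed

lemma left_module_regular:
  assumes "ring A" shows "left_module A (regular_module A)"
proof -
  interpret ring A by fact
  have neg: "\<exists>y\<in>carrier A. y \<oplus>\<^bsub>A\<^esub> x = \<zero>\<^bsub>A\<^esub>" if "x \<in> carrier A" for x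
    using that by (intro bexI[where x = "\<ominus>\<^bsub>A\<^esub> x"]) (auto simp: l_neg)
  have "abelian_group (regular_module A)"
    by (rule abelian_groupI) (auto simp: regular_module_def a_ac neg)
  with assms show ?thesis
    by (intro left_module.intro left_module_axioms.intro)
      (auto simp: regular_module_def m_assoc l_distr r_distr)
qed

lemma right_module_dual:
  assumes "left_module A M" shows "right_module A (dual A M)"
proof -
  interpret left_module A M by fact
  have reg: "carrier (regular_module A) = carrier A" "add (regular_module A) = add A"
    "smult (regular_module A) = mult A" "zero (regular_module A) = zero A"
    by (simp_all add: regular_module_def)
  note defs = dual_def mod_hom_def reg
  have val: "f x \<in> carrier A" if "f \<in> mod_hom A M (regular_module A)" "x \<in> carrier M" for f x
    using that by (auto simp: defs)
  have ext: "f = g" if "f \<in> mod_hom A M (regular_module A)" "g \<in> mod_hom A M (regular_module A)"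
    "\<And>x. x \<in> carrier M \<Longrightarrow> f x = g x" for f g
    using that by (auto simp: defs intro: PiE_ext)
  have add: "(\<lambda>x\<in>carrier M. f x \<oplus>\<^bsub>A\<^esub> g x) \<in> mod_hom A M (regular_module A)"
    if "f \<in> mod_hom A M (regular_module A)" "g \<in> mod_hom A M (regular_module A)" for f g
  proof -
    have "f x \<in> carrier A" "g x \<in> carrier A" if "x \<in> carrier M" for x
      using that \<open>f \<in> _\<close> \<open>g \<in> _\<close> by (auto simp: val)
    with that show ?thesis by (auto simp: defs R.a_ac R.r_distr)
  qed
  have neg: "(\<lambda>x\<in>carrier M. \<ominus>\<^bsub>A\<^esub> f x) \<in> mod_hom A M (regular_module A)"
    if "f \<in> mod_hom A M (regular_module A)" for f
  proof -
    have "f x \<in> carrier A" if "x \<in> carrier M" for x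
      using that \<open>f \<in> _\<close> by (auto simp: val)
    with that show ?thesis by (auto simp: defs R.minus_add R.r_minus)
  qed
  have zero: "(\<lambda>x\<in>carrier M. \<zero>\<^bsub>A\<^esub>) \<in> mod_hom A M (regular_module A)"
    by (auto simp: defs)
  have smult: "(\<lambda>x\<in>carrier M. f x \<otimes>\<^bsub>A\<^esub> a) \<in> mod_hom A M (regular_module A)"
    if "f \<in> mod_hom A M (regular_module A)" "a \<in> carrier A" for f a
  proof -
    have "f x \<in> carrier A" if "x \<in> carrier M" for x
      using that \<open>f \<in> _\<close> by (auto simp: val)
    with that show ?thesis by (auto simp: defs R.l_distr R.m_assoc)
  qed
  have car: "carrier (dual A M) = mod_hom A M (regular_module A)"
    by (simp add: dual_def)
  have "abelian_group (dual A M)"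
  proof (rule abelian_groupI)
    fix f assume f: "f \<in> carrier (dual A M)"
    show "\<exists>g\<in>carrier (dual A M). g \<oplus>\<^bsub>dual A M\<^esub> f = \<zero>\<^bsub>dual A M\<^esub>"
      using f neg[of f] val[of f]
      by (intro bexI[where x = "\<lambda>x\<in>carrier M. \<ominus>\<^bsub>A\<^esub> f x"])
        (auto simp: dual_def R.l_neg intro!: restrict_ext)
  qed (auto simp: dual_def add zero zero[unfolded restrict_def] val R.a_assoc intro!: ext restrict_ext add zero R.a_comm)
  moreover have "ring (op_ring A)"
    by (rule ring_op_ring) (rule R.ring_axioms)
  ultimately show ?thesis
    by (intro left_module.intro left_module_axioms.intro)
      (auto simp: dual_def val R.l_distr R.r_distr R.m_assoc smult add
        intro!: ext restrict_ext)
qed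

end

theory Submission
  imports Defs
begin

text \<open>
  Write \<open>M\<^sup>*\<close> for the \<open>A\<close>-dual of \<open>M\<close>.  Everything rests on one form of dimension shifting
  (\<open>semi_gorenstein_projective_syzygy\<close>): if \<open>K\<close> is the kernel of an epimorphism from a finitely generated
  projective module \<open>P\<close> to \<open>M\<close>, then \<open>M\<close> is semi-Gorenstein-projective if and only if \<open>K\<close> is so and
  every homomorphism \<open>K \<rightarrow> A\<close> extends to \<open>P\<close>.

  Let \<open>M\<close> be semi-Gorenstein-projective, \<open>K = \<Omega> M\<close> and \<open>L = \<Omega> K\<close>, with projective covers \<open>P \<rightarrow> M\<close> and
  \<open>Q \<rightarrow> K\<close>.  Then \<open>K\<close> and \<open>L\<close> are semi-Gorenstein-projective, and functionals extend from \<open>K\<close> to \<open>P\<close> and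
  from \<open>L\<close> to \<open>Q\<close>.  Since \<open>L\<close> is the kernel of a map from the reflexive module \<open>Q\<close> to the torsionless
  module \<open>K\<close>, the extension property makes \<open>L\<close> reflexive (\<open>reflexive_kernel\<close>).  The properties can also
  be moved upwards: the dual sequence \<open>0 \<rightarrow> M\<^sup>* \<rightarrow> P\<^sup>* \<rightarrow> K\<^sup>* \<rightarrow> 0\<close> is exact, and if \<open>K\<close> is reflexive and
  \<open>K\<^sup>*\<close> is semi-Gorenstein-projective, then dimension shifting for right modules and the five lemma give
  the same for \<open>M\<close> and \<open>M\<^sup>*\<close> (\<open>reflexive_cokernel\<close>).  So if \<open>L\<^sup>*\<close> were semi-Gorenstein-projective, two
  such steps would show that \<open>M\<close> satisfies (G1), (G2) and (G3).  But then a projective resolution of \<open>M\<close>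
  and the dual of a projective resolution of \<open>M\<^sup>*\<close> fit together to a complete resolution, and \<open>M\<close> is
  Gorenstein-projective (\<open>gorenstein_projective_criterion\<close>).

  For the second assertion, let \<open>M'\<close> be reflexive and \<open>N = M'\<^sup>*\<close>.  The dual of \<open>N\<close> is isomorphic to \<open>M'\<close>,
  so (G1) for \<open>M'\<close> is (G2) for \<open>N\<close>; the dual of a reflexive module is reflexive; and \<open>N\<close> fails (G1)
  because \<open>M'\<close> fails (G2).

  These arguments use \<open>Ext\<close> only through the exactness of \<open>Hom(P, A)\<close> for a resolution \<open>P\<close>
  (\<open>semi_gorenstein_projective_iff\<close>).  This presupposes that resolutions exist, also for duals and kernels,
  which holds because an artin algebra is noetherian on both sides (\<open>artin_algebra_noetherian\<close>), and that
  the exactness does not depend on the resolution (\<open>dual_acyclic_independent\<close>).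
\<close>

section \<open>Modules, submodules and homomorphisms\<close>

lemma regular_module_simps [simp]:
  "carrier (regular_module A) = carrier A" "add (regular_module A) = add A"
  "zero (regular_module A) = zero A" "smult (regular_module A) = mult A"
  by (simp_all add: regular_module_def)

abbreviation functionals :: "('a, 'x) ring_scheme \<Rightarrow> ('a, 'm, 'z) module_scheme \<Rightarrow> ('m \<Rightarrow> 'a) set"
  where "functionals A M \<equiv> mod_hom A M (regular_module A)"

lemma regular_module_minus [simp]:
  "a_inv (regular_module A) = a_inv A" "x \<ominus>\<^bsub>regular_module A\<^esub> y = x \<ominus>\<^bsub>A\<^esub> y"
  by (simp_all add: a_minus_def a_inv_def m_inv_def fun_eq_iff)

context left_module
begin

lemma smult_l_null [simp]: "x \<in> carrier M \<Longrightarrow> \<zero> \<odot>\<^bsub>M\<^esub> x = \<zero>\<^bsub>M\<^esub>"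
  by (metis M.add.r_cancel_one' R.add.l_cancel_one' R.zero_closed smult_closed smult_l_distr)

lemma smult_r_null [simp]: "a \<in> carrier A \<Longrightarrow> a \<odot>\<^bsub>M\<^esub> \<zero>\<^bsub>M\<^esub> = \<zero>\<^bsub>M\<^esub>"
  by (metis M.add.l_cancel_one' M.zero_closed smult_closed smult_r_distr)

lemma smult_minus_one: "x \<in> carrier M \<Longrightarrow> (\<ominus> \<one>) \<odot>\<^bsub>M\<^esub> x = \<ominus>\<^bsub>M\<^esub> x"
  by (metis M.minus_equality R.add.inv_closed R.l_neg R.one_closed smult_closed smult_l_distr
      smult_l_null smult_one)

lemma smult_r_minus:
  "\<lbrakk> a \<in> carrier A; x \<in> carrier M \<rbrakk> \<Longrightarrow> a \<odot>\<^bsub>M\<^esub> (\<ominus>\<^bsub>M\<^esub> x) = \<ominus>\<^bsub>M\<^esub> (a \<odot>\<^bsub>M\<^esub> x)"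
  by (rule M.minus_equality[symmetric]) (auto simp: smult_r_distr[symmetric] M.l_neg)

text \<open>Closure under negation is automatic, as \<open>- x = (- 1) x\<close>.\<close>

lemma submodule_iff:
  "submodule H A M \<longleftrightarrow> H \<subseteq> carrier M \<and> \<zero>\<^bsub>M\<^esub> \<in> H \<and>
    (\<forall>x\<in>H. \<forall>y\<in>H. x \<oplus>\<^bsub>M\<^esub> y \<in> H) \<and> (\<forall>a\<in>carrier A. \<forall>x\<in>H. a \<odot>\<^bsub>M\<^esub> x \<in> H)"
  (is "_ \<longleftrightarrow> ?R")
proof
  assume "submodule H A M"
  then interpret H: submodule H A M .
  show ?R using H.subset H.one_closed H.m_closed by auto
next
  assume R: ?R
  have "\<ominus>\<^bsub>M\<^esub> x \<in> H" if "x \<in> H" for x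
    using R that smult_minus_one[of x] by (metis R.add.inv_closed R.one_closed subsetD)
  with R show "submodule H A M"
    unfolding submodule_def submodule_axioms_def subgroup_def by (auto simp: a_inv_def)
qed

lemma left_module_submodule:
  assumes "submodule H A M"
  shows "left_module A (M\<lparr>carrier := H\<rparr>)"
proof -
  have H: "H \<subseteq> carrier M" "\<zero>\<^bsub>M\<^esub> \<in> H" "\<And>x y. x \<in> H \<Longrightarrow> y \<in> H \<Longrightarrow> x \<oplus>\<^bsub>M\<^esub> y \<in> H"
    "\<And>a x. a \<in> carrier A \<Longrightarrow> x \<in> H \<Longrightarrow> a \<odot>\<^bsub>M\<^esub> x \<in> H"
    using assms by (auto simp: submodule_iff)
  note sub = H(1)[THEN subsetD]
  have "\<exists>y\<in>H. y \<oplus>\<^bsub>M\<^esub> x = \<zero>\<^bsub>M\<^esub>" if "x \<in> H" for x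
    using that H smult_minus_one[of x] M.l_neg[of x] by (metis R.add.inv_closed R.one_closed subsetD)
  then have "abelian_group (M\<lparr>carrier := H\<rparr>)"
    by (intro abelian_groupI) (auto simp: H M.a_ac sub)
  then show ?thesis
    by (intro left_module.intro left_module_axioms.intro R.ring_axioms)
      (auto simp: H sub smult_l_distr smult_r_distr smult_assoc1)
qed

lemma finsum_smult:
  "\<lbrakk> finite I; a \<in> carrier A; f \<in> I \<rightarrow> carrier M \<rbrakk> \<Longrightarrow>
     a \<odot>\<^bsub>M\<^esub> (\<Oplus>\<^bsub>M\<^esub>i\<in>I. f i) = (\<Oplus>\<^bsub>M\<^esub>i\<in>I. a \<odot>\<^bsub>M\<^esub> f i)"
  by (induction set: finite) (auto simp: Pi_def smult_r_distr)

lemma submodule_finsum: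
  assumes "submodule H A M" "finite I" "\<And>i. i \<in> I \<Longrightarrow> f i \<in> H"
  shows "(\<Oplus>\<^bsub>M\<^esub>i\<in>I. f i) \<in> H"
  using assms(2,3)
proof (induction set: finite)
  case (insert i I)
  then show ?case using assms(1) by (subst M.finsum_insert) (auto simp: submodule_iff Pi_def)
qed (use assms in \<open>auto simp: submodule_iff\<close>)

end

lemma mod_hom_closed: "\<lbrakk> f \<in> mod_hom A M N; x \<in> carrier M \<rbrakk> \<Longrightarrow> f x \<in> carrier N"
  by (auto simp: mod_hom_def)

lemma mod_hom_add:
  "\<lbrakk> f \<in> mod_hom A M N; x \<in> carrier M; y \<in> carrier M \<rbrakk> \<Longrightarrow> f (x \<oplus>\<^bsub>M\<^esub> y) = f x \<oplus>\<^bsub>N\<^esub> f y"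
  by (auto simp: mod_hom_def)

lemma mod_hom_smult:
  "\<lbrakk> f \<in> mod_hom A M N; a \<in> carrier A; x \<in> carrier M \<rbrakk> \<Longrightarrow> f (a \<odot>\<^bsub>M\<^esub> x) = a \<odot>\<^bsub>N\<^esub> f x"
  by (auto simp: mod_hom_def)

lemma mod_hom_ext:
  "\<lbrakk> f \<in> mod_hom A M N; g \<in> mod_hom A M N'; \<And>x. x \<in> carrier M \<Longrightarrow> f x = g x \<rbrakk> \<Longrightarrow> f = g"
  by (rule extensionalityI[of _ "carrier M"]) (auto simp: mod_hom_def PiE_def)

lemma mod_hom_restrict_eq:
  "\<lbrakk> f \<in> mod_hom A M N; \<And>x. x \<in> carrier M \<Longrightarrow> g x = f x \<rbrakk> \<Longrightarrow> restrict g (carrier M) = f"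
  by (rule extensionalityI[of _ "carrier M"]) (auto simp: mod_hom_def PiE_def)

lemma mod_hom_restrictI:
  assumes "left_module A M"
    and "\<And>x. x \<in> carrier M \<Longrightarrow> f x \<in> carrier N"
    and "\<And>x y. \<lbrakk> x \<in> carrier M; y \<in> carrier M \<rbrakk> \<Longrightarrow> f (x \<oplus>\<^bsub>M\<^esub> y) = f x \<oplus>\<^bsub>N\<^esub> f y"
    and "\<And>a x. \<lbrakk> a \<in> carrier A; x \<in> carrier M \<rbrakk> \<Longrightarrow> f (a \<odot>\<^bsub>M\<^esub> x) = a \<odot>\<^bsub>N\<^esub> f x"
  shows "(\<lambda>x\<in>carrier M. f x) \<in> mod_hom A M N"
proof -
  interpret left_module A M by fact
  show ?thesis using assms(2-4) by (auto simp: mod_hom_def)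
qed

lemma mod_hom_zero:
  assumes "left_module A M" "left_module A N" "f \<in> mod_hom A M N"
  shows "f \<zero>\<^bsub>M\<^esub> = \<zero>\<^bsub>N\<^esub>"
proof -
  interpret M: left_module A M by fact
  interpret N: left_module A N by fact
  have "f (\<zero>\<^bsub>A\<^esub> \<odot>\<^bsub>M\<^esub> \<zero>\<^bsub>M\<^esub>) = \<zero>\<^bsub>A\<^esub> \<odot>\<^bsub>N\<^esub> f \<zero>\<^bsub>M\<^esub>"
    using assms(3) by (intro mod_hom_smult) auto
  then show ?thesis using mod_hom_closed[OF assms(3)] by simp
qed

lemma mod_hom_minus:
  assumes "left_module A M" "left_module A N" "f \<in> mod_hom A M N" "x \<in> carrier M"
  shows "f (\<ominus>\<^bsub>M\<^esub> x) = \<ominus>\<^bsub>N\<^esub> f x"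
proof -
  interpret M: left_module A M by fact
  interpret N: left_module A N by fact
  have "f ((\<ominus>\<^bsub>A\<^esub> \<one>\<^bsub>A\<^esub>) \<odot>\<^bsub>M\<^esub> x) = (\<ominus>\<^bsub>A\<^esub> \<one>\<^bsub>A\<^esub>) \<odot>\<^bsub>N\<^esub> f x"
    using assms(3,4) by (intro mod_hom_smult) auto
  then show ?thesis
    using mod_hom_closed[OF assms(3,4)] assms(4) by (simp add: M.smult_minus_one N.smult_minus_one)
qed

lemma mod_hom_diff:
  assumes "left_module A M" "left_module A N" "f \<in> mod_hom A M N" "x \<in> carrier M" "y \<in> carrier M"
  shows "f (x \<ominus>\<^bsub>M\<^esub> y) = f x \<ominus>\<^bsub>N\<^esub> f y"
proof -
  interpret M: left_module A M by fact
  show ?thesis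
    using assms by (simp add: a_minus_def mod_hom_add[OF assms(3)] mod_hom_minus[OF assms(1-3)])
qed

lemma mod_hom_finsum:
  assumes "left_module A M" "left_module A N" "f \<in> mod_hom A M N"
    and "finite I" "\<And>i. i \<in> I \<Longrightarrow> x i \<in> carrier M"
  shows "f (\<Oplus>\<^bsub>M\<^esub>i\<in>I. x i) = (\<Oplus>\<^bsub>N\<^esub>i\<in>I. f (x i))"
proof -
  interpret M: left_module A M by fact
  interpret N: left_module A N by fact
  show ?thesis using assms(4,5)
  proof (induction set: finite)
    case empty
    then show ?case by (simp add: mod_hom_zero[OF assms(1-3)])
  next
    case (insert i I)
    then have "x \<in> I \<rightarrow> carrier M" "(\<lambda>i. f (x i)) \<in> I \<rightarrow> carrier N" "f (x i) \<in> carrier N"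
      using mod_hom_closed[OF assms(3)] by auto
    with insert show ?case by (simp add: mod_hom_add[OF assms(3)])
  qed
qed

lemma mod_hom_compose:
  assumes "left_module A M" "f \<in> mod_hom A M N" "g \<in> mod_hom A N N'"
  shows "compose (carrier M) g f \<in> mod_hom A M N'"
  unfolding compose_def using assms
  by (intro mod_hom_restrictI)
    (auto simp: mod_hom_add[OF assms(2)] mod_hom_smult[OF assms(2)] mod_hom_add[OF assms(3)]
      mod_hom_smult[OF assms(3)] mod_hom_closed[OF assms(2)] mod_hom_closed[OF assms(3)])

lemma mod_hom_id: "left_module A M \<Longrightarrow> (\<lambda>x\<in>carrier M. x) \<in> mod_hom A M M"
  by (rule mod_hom_restrictI) auto

lemma mod_hom_restrict:
  assumes "left_module A M" "f \<in> mod_hom A M N" "submodule H A M"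
  shows "restrict f H \<in> mod_hom A (M\<lparr>carrier := H\<rparr>) N"
proof -
  interpret left_module A M by fact
  show ?thesis
    using assms(3) subsetD[of H "carrier M"] mod_hom_closed[OF assms(2)] mod_hom_add[OF assms(2)]
      mod_hom_smult[OF assms(2)]
    unfolding submodule_iff by (auto simp: mod_hom_def)
qed

lemma mod_hom_codomain:
  "f \<in> mod_hom A M N \<Longrightarrow> f ` carrier M \<subseteq> H \<Longrightarrow> f \<in> mod_hom A M (N\<lparr>carrier := H\<rparr>)"
  by (auto simp: mod_hom_def)

lemma mod_hom_codomain_mono:
  "f \<in> mod_hom A M (N\<lparr>carrier := H\<rparr>) \<Longrightarrow> H \<subseteq> carrier N \<Longrightarrow> f \<in> mod_hom A M N"
  by (auto simp: mod_hom_def)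

lemma submodule_vimage:
  assumes "left_module A M" "left_module A N" "f \<in> mod_hom A M N" "submodule X A N"
  shows "submodule {x \<in> carrier M. f x \<in> X} A M"
proof -
  interpret M: left_module A M by fact
  interpret N: left_module A N by fact
  show ?thesis using assms(4) unfolding M.submodule_iff N.submodule_iff
    by (auto simp: mod_hom_zero[OF assms(1-3)] mod_hom_add[OF assms(3)] mod_hom_smult[OF assms(3)])
qed

lemma submodule_kernel:
  assumes "left_module A M" "left_module A N" "f \<in> mod_hom A M N"
  shows "submodule (hom_kernel M N f) A M"
proof -
  interpret N: left_module A N by fact
  have "submodule {\<zero>\<^bsub>N\<^esub>} A N" by (auto simp: N.submodule_iff)
  from submodule_vimage[OF assms this] show ?thesis by (simp add: hom_kernel_def)
qed

lemma submodule_image: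
  assumes "left_module A M" "left_module A N" "f \<in> mod_hom A M N" "submodule H A M"
  shows "submodule (f ` H) A N"
proof -
  interpret M: left_module A M by fact
  interpret N: left_module A N by fact
  have H: "H \<subseteq> carrier M" "\<zero>\<^bsub>M\<^esub> \<in> H" "\<And>x y. x \<in> H \<Longrightarrow> y \<in> H \<Longrightarrow> x \<oplus>\<^bsub>M\<^esub> y \<in> H"
    "\<And>a x. a \<in> carrier A \<Longrightarrow> x \<in> H \<Longrightarrow> a \<odot>\<^bsub>M\<^esub> x \<in> H"
    using assms(4) by (auto simp: M.submodule_iff)
  have "f x \<oplus>\<^bsub>N\<^esub> f y = f (x \<oplus>\<^bsub>M\<^esub> y)" if "x \<in> H" "y \<in> H" for x y
    using subsetD[OF H(1)] that by (intro mod_hom_add[OF assms(3), symmetric])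
  moreover have "a \<odot>\<^bsub>N\<^esub> f x = f (a \<odot>\<^bsub>M\<^esub> x)" if "a \<in> carrier A" "x \<in> H" for a x
    using subsetD[OF H(1)] that by (intro mod_hom_smult[OF assms(3), symmetric])
  ultimately show ?thesis
    unfolding N.submodule_iff ball_simps
    using H(2-4) mod_hom_zero[OF assms(1-3)] mod_hom_closed[OF assms(3)] subsetD[OF H(1)]
    by (metis (no_types, lifting) image_eqI image_subsetI)
qed

lemma submodule_carrier: "left_module A M \<Longrightarrow> submodule (carrier M) A M"
proof -
  assume "left_module A M"
  then interpret left_module A M .
  show ?thesis by (auto simp: submodule_iff)
qed

lemma (in abelian_group) diff_eq_zero_iff:
  "\<lbrakk> x \<in> carrier G; y \<in> carrier G \<rbrakk> \<Longrightarrow> x \<ominus> y = \<zero> \<longleftrightarrow> x = y"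
  by (metis a_minus_def a_inv_closed minus_equality minus_minus r_neg)

text \<open>
  Two preimages of the same element differ by an element of the kernel of \<open>p\<close>, where \<open>f\<close> vanishes;
  so applying \<open>f\<close> to arbitrarily chosen preimages is a linear map.
\<close>

lemma mod_hom_factor:
  assumes P: "left_module A P" and M: "left_module A M" and N: "left_module A N"
    and p: "p \<in> mod_hom A P M" "p ` carrier P = carrier M"
    and f: "f \<in> mod_hom A P N" "\<And>x. x \<in> carrier P \<Longrightarrow> p x = \<zero>\<^bsub>M\<^esub> \<Longrightarrow> f x = \<zero>\<^bsub>N\<^esub>"
  obtains g where "g \<in> mod_hom A M N" "\<And>x. x \<in> carrier P \<Longrightarrow> g (p x) = f x"
proof -
  interpret P: left_module A P by fact
  interpret M: left_module A M by fact
  interpret N: left_module A N by fact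
  define s where "s y = (SOME x. x \<in> carrier P \<and> p x = y)" for y
  have s: "s y \<in> carrier P \<and> p (s y) = y" if "y \<in> carrier M" for y
  proof -
    have "\<exists>x. x \<in> carrier P \<and> p x = y" using that p(2) by (metis imageE)
    then show ?thesis unfolding s_def by (rule someI_ex)
  qed
  have fs: "f (s (p x)) = f x" if "x \<in> carrier P" for x
  proof -
    have c: "s (p x) \<in> carrier P" "p (s (p x)) = p x"
      using s mod_hom_closed[OF p(1) that] by auto
    then have "p (s (p x) \<ominus>\<^bsub>P\<^esub> x) = \<zero>\<^bsub>M\<^esub>"
      using that mod_hom_closed[OF p(1) that] by (simp add: mod_hom_diff[OF P M p(1)] M.diff_eq_zero_iff)
    then have "f (s (p x)) \<ominus>\<^bsub>N\<^esub> f x = \<zero>\<^bsub>N\<^esub>"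
      using c that f(2)[of "s (p x) \<ominus>\<^bsub>P\<^esub> x"] by (simp add: mod_hom_diff[OF P N f(1)])
    then show ?thesis
      using c that mod_hom_closed[OF f(1)] by (simp add: N.diff_eq_zero_iff)
  qed
  have "(\<lambda>y\<in>carrier M. f (s y)) \<in> mod_hom A M N"
  proof (rule mod_hom_restrictI[OF M])
    fix x y assume xy: "x \<in> carrier M" "y \<in> carrier M"
    then have "f (s x \<oplus>\<^bsub>P\<^esub> s y) = f (s (x \<oplus>\<^bsub>M\<^esub> y))"
      using fs[of "s x \<oplus>\<^bsub>P\<^esub> s y"] s mod_hom_add[OF p(1), of "s x" "s y"] by auto
    then show "f (s (x \<oplus>\<^bsub>M\<^esub> y)) = f (s x) \<oplus>\<^bsub>N\<^esub> f (s y)"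
      using s xy by (simp add: mod_hom_add[OF f(1)])
  next
    fix a x assume ax: "a \<in> carrier A" "x \<in> carrier M"
    then have "f (a \<odot>\<^bsub>P\<^esub> s x) = f (s (a \<odot>\<^bsub>M\<^esub> x))"
      using fs[of "a \<odot>\<^bsub>P\<^esub> s x"] s mod_hom_smult[OF p(1), of a "s x"] by auto
    then show "f (s (a \<odot>\<^bsub>M\<^esub> x)) = a \<odot>\<^bsub>N\<^esub> f (s x)"
      using s ax by (simp add: mod_hom_smult[OF f(1)])
  qed (use s mod_hom_closed[OF f(1)] in auto)
  moreover have "(\<lambda>y\<in>carrier M. f (s y)) (p x) = f x" if "x \<in> carrier P" for x
    using that fs mod_hom_closed[OF p(1)] by simp
  ultimately show ?thesis using that by blast
qed

lemma mod_hom_inverse: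
  assumes M: "left_module A M" and N: "left_module A N"
    and f: "f \<in> mod_hom A M N" "inj_on f (carrier M)"
  obtains g where "g \<in> mod_hom A (N\<lparr>carrier := f ` carrier M\<rparr>) M"
    "\<And>x. x \<in> carrier M \<Longrightarrow> g (f x) = x"
proof -
  let ?I = "N\<lparr>carrier := f ` carrier M\<rparr>"
  interpret M: left_module A M by fact
  interpret N: left_module A N by fact
  have I: "left_module A ?I"
    by (intro N.left_module_submodule submodule_image[OF M N f(1)] submodule_carrier[OF M])
  have f': "f \<in> mod_hom A M ?I" using f(1) by (rule mod_hom_codomain) auto
  show ?thesis
  proof (rule mod_hom_factor[OF M I M f' _ mod_hom_id[OF M]])
    fix x assume "x \<in> carrier M" "f x = \<zero>\<^bsub>?I\<^esub>"
    then show "(\<lambda>x\<in>carrier M. x) x = \<zero>\<^bsub>M\<^esub>"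
      using inj_onD[OF f(2), of x "\<zero>\<^bsub>M\<^esub>"] mod_hom_zero[OF M N f(1)] by auto
  qed (use that in auto)
qed

lemma inj_on_mod_homI:
  assumes M: "left_module A M" and N: "left_module A N" and f: "f \<in> mod_hom A M N"
    and "\<And>x. x \<in> carrier M \<Longrightarrow> f x = \<zero>\<^bsub>N\<^esub> \<Longrightarrow> x = \<zero>\<^bsub>M\<^esub>"
  shows "inj_on f (carrier M)"
proof (rule inj_onI)
  interpret M: left_module A M by fact
  interpret N: left_module A N by fact
  fix x y assume xy: "x \<in> carrier M" "y \<in> carrier M" "f x = f y"
  then have "f (x \<ominus>\<^bsub>M\<^esub> y) = \<zero>\<^bsub>N\<^esub>"
    using mod_hom_closed[OF f] by (simp add: mod_hom_diff[OF M N f] N.diff_eq_zero_iff)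
  then show "x = y" using assms(4)[of "x \<ominus>\<^bsub>M\<^esub> y"] xy by (simp add: M.diff_eq_zero_iff)
qed

section \<open>Duals\<close>

lemma dual_simps [simp]:
  "carrier (dual A M) = functionals A M"
  "zero (dual A M) = (\<lambda>x\<in>carrier M. \<zero>\<^bsub>A\<^esub>)"
  "f \<oplus>\<^bsub>dual A M\<^esub> g = (\<lambda>x\<in>carrier M. f x \<oplus>\<^bsub>A\<^esub> g x)"
  "a \<odot>\<^bsub>dual A M\<^esub> f = (\<lambda>x\<in>carrier M. f x \<otimes>\<^bsub>A\<^esub> a)"
  by (simp_all add: dual_def)

lemma zero_functional:
  assumes "left_module A M"
  shows "(\<lambda>x\<in>carrier M. \<zero>\<^bsub>A\<^esub>) \<in> functionals A M"
proof -
  interpret left_module A M by fact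
  show ?thesis by (rule mod_hom_restrictI[OF assms]) auto
qed

lemma left_module_dual_op: "left_module (op_ring A) N \<Longrightarrow> left_module A (dual (op_ring A) N)"
  using right_module_dual[of "op_ring A" N] by simp

lemma eval_map_apply [simp]:
  "x \<in> carrier M \<Longrightarrow> f \<in> functionals A M \<Longrightarrow> eval_map A M x f = f x"
  by (simp add: eval_map_def)

lemma eval_map_closed:
  assumes "left_module A M" "x \<in> carrier M"
  shows "eval_map A M x \<in> functionals (op_ring A) (dual A M)"
proof -
  have "eval_map A M x = (\<lambda>f\<in>carrier (dual A M). f x)"
    using assms(2) by (simp add: eval_map_def)
  moreover have "\<dots> \<in> functionals (op_ring A) (dual A M)"
    using assms(2) by (intro mod_hom_restrictI right_module_dual[OF assms(1)])
      (auto dest: mod_hom_closed)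
  ultimately show ?thesis by simp
qed

lemma eval_map_hom:
  assumes "left_module A M"
  shows "eval_map A M \<in> mod_hom A M (dual (op_ring A) (dual A M))"
proof -
  interpret left_module A M by fact
  show ?thesis unfolding eval_map_def
  proof (rule mod_hom_restrictI[OF assms])
    fix x assume "x \<in> carrier M"
    then show "(\<lambda>f\<in>carrier (dual A M). f x) \<in> carrier (dual (op_ring A) (dual A M))"
      using eval_map_closed[OF assms] by (simp add: eval_map_def)
  qed (auto simp: mod_hom_add mod_hom_smult intro!: restrict_ext)
qed

text \<open>
  Injectivity of the evaluation map says that functionals separate the elements of \<open>M\<close>, that is,
  that \<open>M\<close> is torsionless; surjectivity says that every element of the bidual is an evaluation.
\<close>

lemma reflexive_iff:
  assumes M: "left_module A M"
  shows "reflexive A M \<longleftrightarrow>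
    (\<forall>x\<in>carrier M. (\<forall>f\<in>functionals A M. f x = \<zero>\<^bsub>A\<^esub>) \<longrightarrow> x = \<zero>\<^bsub>M\<^esub>) \<and>
    (\<forall>\<xi>\<in>functionals (op_ring A) (dual A M).
      \<exists>x\<in>carrier M. \<forall>f\<in>functionals A M. \<xi> f = f x)"
    (is "_ \<longleftrightarrow> ?inj \<and> ?surj")
proof -
  let ?D = "dual (op_ring A) (dual A M)"
  interpret left_module A M by fact
  have D: "left_module A ?D"
    by (intro left_module_dual_op right_module_dual M)
  note E = eval_map_hom[OF M]
  have zero_iff: "eval_map A M x = \<zero>\<^bsub>?D\<^esub> \<longleftrightarrow> (\<forall>f\<in>functionals A M. f x = \<zero>\<^bsub>A\<^esub>)"
    if "x \<in> carrier M" for x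
    using that by (force simp: eval_map_def fun_eq_iff restrict_def)
  have "inj_on (eval_map A M) (carrier M) \<longleftrightarrow> ?inj"
  proof
    assume inj: "inj_on (eval_map A M) (carrier M)"
    show ?inj
      using inj_onD[OF inj] mod_hom_zero[OF M D E] zero_iff by (metis M.zero_closed)
  next
    assume ?inj
    then show "inj_on (eval_map A M) (carrier M)"
      using zero_iff by (intro inj_on_mod_homI[OF M D E]) blast
  qed
  moreover have "eval_map A M ` carrier M = carrier ?D \<longleftrightarrow> ?surj"
  proof
    assume "eval_map A M ` carrier M = carrier ?D"
    moreover have "\<xi> \<in> carrier ?D" if "\<xi> \<in> functionals (op_ring A) (dual A M)" for \<xi>
      using that by simp
    ultimately show ?surj using eval_map_apply by (metis (no_types, lifting) imageE)
  next
    assume s: ?surj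
    have "\<xi> \<in> eval_map A M ` carrier M" if \<xi>: "\<xi> \<in> carrier ?D" for \<xi>
    proof -
      obtain x where x: "x \<in> carrier M" "\<And>f. f \<in> functionals A M \<Longrightarrow> \<xi> f = f x"
        using s \<xi> by auto
      then have "\<xi> = eval_map A M x"
        using \<xi> mod_hom_closed[OF E x(1)] by (intro mod_hom_ext[where M = "dual A M"]) auto
      with x(1) show ?thesis by blast
    qed
    then show "eval_map A M ` carrier M = carrier ?D"
      using mod_hom_closed[OF E] by blast
  qed
  ultimately show ?thesis unfolding reflexive_def bij_betw_def by blast
qed

section \<open>Finitely generated projective modules\<close>

lemma free_module_simps [simp]:
  "carrier (free_module A n) = {..<n} \<rightarrow>\<^sub>E carrier A"
  "zero (free_module A n) = (\<lambda>i\<in>{..<n}. \<zero>\<^bsub>A\<^esub>)"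
  "u \<oplus>\<^bsub>free_module A n\<^esub> v = (\<lambda>i\<in>{..<n}. u i \<oplus>\<^bsub>A\<^esub> v i)"
  "a \<odot>\<^bsub>free_module A n\<^esub> u = (\<lambda>i\<in>{..<n}. a \<otimes>\<^bsub>A\<^esub> u i)"
  by (simp_all add: free_module_def)

lemma left_module_free:
  assumes "ring A"
  shows "left_module A (free_module A n)"
proof -
  interpret ring A by fact
  let ?F = "free_module A n"
  have c: "u i \<in> carrier A" if "u \<in> carrier ?F" "i < n" for u i
    using that by auto
  have clI: "(\<lambda>i\<in>{..<n}. w i) \<in> carrier ?F" if "\<And>i. i < n \<Longrightarrow> w i \<in> carrier A" for w
    using that by auto
  have eqI: "u = v" if "u \<in> carrier ?F" "v \<in> carrier ?F" "\<And>i. i < n \<Longrightarrow> u i = v i" for u v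
    using that by (intro PiE_ext[of u "{..<n}" "\<lambda>_. carrier A" v]) auto
  have add: "u \<oplus>\<^bsub>?F\<^esub> v \<in> carrier ?F" if "u \<in> carrier ?F" "v \<in> carrier ?F" for u v
    unfolding free_module_simps(3) using that by (intro clI) (simp add: c)
  have sm: "a \<odot>\<^bsub>?F\<^esub> u \<in> carrier ?F" if "a \<in> carrier A" "u \<in> carrier ?F" for a u
    unfolding free_module_simps(4) using that by (intro clI) (simp add: c)
  have zero: "\<zero>\<^bsub>?F\<^esub> \<in> carrier ?F"
    unfolding free_module_simps(2) by (intro clI) simp
  have "abelian_group ?F"
  proof (rule abelian_groupI)
    fix u assume u: "u \<in> carrier ?F"
    let ?v = "\<lambda>i\<in>{..<n}. \<ominus>\<^bsub>A\<^esub> u i"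
    have v: "?v \<in> carrier ?F" using u by (intro clI) (simp add: c)
    then have "?v \<oplus>\<^bsub>?F\<^esub> u = \<zero>\<^bsub>?F\<^esub>"
      using u by (intro eqI add zero) (auto simp: c l_neg simp del: free_module_simps(1))
    with v show "\<exists>v\<in>carrier ?F. v \<oplus>\<^bsub>?F\<^esub> u = \<zero>\<^bsub>?F\<^esub>" by blast
    show "\<zero>\<^bsub>?F\<^esub> \<oplus>\<^bsub>?F\<^esub> u = u"
      using u by (intro eqI add zero) (auto simp: c simp del: free_module_simps(1))
  next
    fix u v assume uv: "u \<in> carrier ?F" "v \<in> carrier ?F"
    then show "u \<oplus>\<^bsub>?F\<^esub> v = v \<oplus>\<^bsub>?F\<^esub> u"
      by (intro eqI add) (auto simp: c a_comm simp del: free_module_simps(1))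
    fix w assume "w \<in> carrier ?F"
    with uv show "u \<oplus>\<^bsub>?F\<^esub> v \<oplus>\<^bsub>?F\<^esub> w = u \<oplus>\<^bsub>?F\<^esub> (v \<oplus>\<^bsub>?F\<^esub> w)"
      by (intro eqI add) (auto simp: c a_assoc simp del: free_module_simps(1))
  qed (fact add zero)+
  moreover have "left_module_axioms A ?F"
    by (rule left_module_axioms.intro; (intro eqI add sm)?)
      (auto simp: c m_assoc l_distr r_distr add sm simp del: free_module_simps(1))
  ultimately show ?thesis
    using assms by (intro left_module.intro)
qed

text \<open>
  The dual basis criterion: \<open>P\<close> is a direct summand of \<open>A\<^sup>n\<close> precisely if every element \<open>x\<close> is
  \<open>\<Sum>\<^sub>j \<phi>\<^sub>j(x) p\<^sub>j\<close> for fixed elements \<open>p\<^sub>j\<close> and functionals \<open>\<phi>\<^sub>j\<close>.  Lifting,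
  reflexivity and the projectivity of the dual are read off from such a formula.
\<close>

definition dual_basis ::
  "('a, 'x) ring_scheme \<Rightarrow> ('a, 'p, 'z) module_scheme \<Rightarrow> nat \<Rightarrow> (nat \<Rightarrow> 'p) \<Rightarrow> (nat \<Rightarrow> 'p \<Rightarrow> 'a) \<Rightarrow> bool"
  where "dual_basis A P n p \<phi> \<longleftrightarrow>
    (\<forall>j<n. p j \<in> carrier P \<and> \<phi> j \<in> functionals A P) \<and>
    (\<forall>x\<in>carrier P. x = (\<Oplus>\<^bsub>P\<^esub>j\<in>{..<n}. \<phi> j x \<odot>\<^bsub>P\<^esub> p j))"

lemma linear_combination_hom:
  fixes n :: nat
  assumes M: "left_module A M" and N: "left_module A N"
    and \<phi>: "\<And>j. j < n \<Longrightarrow> \<phi> j \<in> functionals A M"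
    and y: "\<And>j. j < n \<Longrightarrow> y j \<in> carrier N"
  shows "(\<lambda>x\<in>carrier M. \<Oplus>\<^bsub>N\<^esub>j\<in>{..<n}. \<phi> j x \<odot>\<^bsub>N\<^esub> y j) \<in> mod_hom A M N"
proof -
  interpret M: left_module A M by fact
  interpret N: left_module A N by fact
  have c: "\<phi> j x \<in> carrier A" if "j < n" "x \<in> carrier M" for j x
    using mod_hom_closed[OF \<phi> that(2)] that(1) by simp
  show ?thesis
  proof (rule mod_hom_restrictI[OF M])
    fix x x' assume x: "x \<in> carrier M" "x' \<in> carrier M"
    have "(\<Oplus>\<^bsub>N\<^esub>j\<in>{..<n}. \<phi> j (x \<oplus>\<^bsub>M\<^esub> x') \<odot>\<^bsub>N\<^esub> y j)
      = (\<Oplus>\<^bsub>N\<^esub>j\<in>{..<n}. \<phi> j x \<odot>\<^bsub>N\<^esub> y j \<oplus>\<^bsub>N\<^esub> \<phi> j x' \<odot>\<^bsub>N\<^esub> y j)"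
      using x c y by (intro N.finsum_cong') (auto simp: mod_hom_add[OF \<phi>] N.smult_l_distr)
    also have "\<dots> = (\<Oplus>\<^bsub>N\<^esub>j\<in>{..<n}. \<phi> j x \<odot>\<^bsub>N\<^esub> y j) \<oplus>\<^bsub>N\<^esub> (\<Oplus>\<^bsub>N\<^esub>j\<in>{..<n}. \<phi> j x' \<odot>\<^bsub>N\<^esub> y j)"
      using x c y by (intro N.finsum_addf) auto
    finally show "(\<Oplus>\<^bsub>N\<^esub>j\<in>{..<n}. \<phi> j (x \<oplus>\<^bsub>M\<^esub> x') \<odot>\<^bsub>N\<^esub> y j) = \<dots>" .
  next
    fix a x assume x: "a \<in> carrier A" "x \<in> carrier M"
    have "(\<Oplus>\<^bsub>N\<^esub>j\<in>{..<n}. \<phi> j (a \<odot>\<^bsub>M\<^esub> x) \<odot>\<^bsub>N\<^esub> y j) = (\<Oplus>\<^bsub>N\<^esub>j\<in>{..<n}. a \<odot>\<^bsub>N\<^esub> (\<phi> j x \<odot>\<^bsub>N\<^esub> y j))"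
      using x c y by (intro N.finsum_cong') (auto simp: mod_hom_smult[OF \<phi>] N.smult_assoc1)
    also have "\<dots> = a \<odot>\<^bsub>N\<^esub> (\<Oplus>\<^bsub>N\<^esub>j\<in>{..<n}. \<phi> j x \<odot>\<^bsub>N\<^esub> y j)"
      using x c y by (intro N.finsum_smult[symmetric] finite_lessThan) auto
    finally show "(\<Oplus>\<^bsub>N\<^esub>j\<in>{..<n}. \<phi> j (a \<odot>\<^bsub>M\<^esub> x) \<odot>\<^bsub>N\<^esub> y j) = \<dots>" .
  qed (use c y in \<open>auto intro!: N.finsum_closed\<close>)
qed

lemma dual_basis_expand:
  assumes P: "left_module A P" and Y: "left_module A Y" and db: "dual_basis A P n p \<phi>"
    and f: "f \<in> mod_hom A P Y" and x: "x \<in> carrier P"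
  shows "f x = (\<Oplus>\<^bsub>Y\<^esub>j\<in>{..<n}. \<phi> j x \<odot>\<^bsub>Y\<^esub> f (p j))"
proof -
  interpret P: left_module A P by fact
  interpret Y: left_module A Y by fact
  have p: "p j \<in> carrier P" "\<phi> j x \<in> carrier A" if "j < n" for j
    using db that x mod_hom_closed[of "\<phi> j" A P "regular_module A"] by (auto simp: dual_basis_def)
  have "f x = f (\<Oplus>\<^bsub>P\<^esub>j\<in>{..<n}. \<phi> j x \<odot>\<^bsub>P\<^esub> p j)"
    using db x by (auto simp: dual_basis_def)
  also have "\<dots> = (\<Oplus>\<^bsub>Y\<^esub>j\<in>{..<n}. f (\<phi> j x \<odot>\<^bsub>P\<^esub> p j))"
    using p by (intro mod_hom_finsum[OF P Y f]) auto
  also have "\<dots> = (\<Oplus>\<^bsub>Y\<^esub>j\<in>{..<n}. \<phi> j x \<odot>\<^bsub>Y\<^esub> f (p j))"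
    using p mod_hom_closed[OF f] by (intro Y.finsum_cong') (auto simp: mod_hom_smult[OF f])
  finally show ?thesis .
qed

definition unit_vector :: "('a, 'x) ring_scheme \<Rightarrow> nat \<Rightarrow> nat \<Rightarrow> nat \<Rightarrow> 'a"
  where "unit_vector A n j = (\<lambda>i\<in>{..<n}. if i = j then \<one>\<^bsub>A\<^esub> else \<zero>\<^bsub>A\<^esub>)"

lemma coordinate_hom:
  "ring A \<Longrightarrow> j < n \<Longrightarrow>
    (\<lambda>u\<in>carrier (free_module A n). u j) \<in> functionals A (free_module A n)"
  by (intro mod_hom_restrictI left_module_free) auto

lemma dual_basis_free:
  assumes "ring A"
  shows "dual_basis A (free_module A n) n (unit_vector A n) (\<lambda>j. \<lambda>u\<in>carrier (free_module A n). u j)"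
proof -
  interpret ring A by fact
  let ?F = "free_module A n"
  have F: "left_module A ?F" by (rule left_module_free) fact
  interpret F: left_module A ?F by fact
  have e: "unit_vector A n j \<in> carrier ?F" for j by (auto simp: unit_vector_def)
  have "u = (\<Oplus>\<^bsub>?F\<^esub>j\<in>{..<n}. u j \<odot>\<^bsub>?F\<^esub> unit_vector A n j)" (is "u = ?s") if u: "u \<in> carrier ?F" for u
  proof (rule PiE_ext)
    have t: "u j \<odot>\<^bsub>?F\<^esub> unit_vector A n j \<in> carrier ?F" if "j < n" for j
      using u that e by (intro F.smult_closed) auto
    show s: "?s \<in> {..<n} \<rightarrow>\<^sub>E carrier A"
      using t F.finsum_closed[of "\<lambda>j. u j \<odot>\<^bsub>?F\<^esub> unit_vector A n j" "{..<n}"]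
      by (simp only: free_module_simps(1)) auto
    show "u \<in> {..<n} \<rightarrow>\<^sub>E carrier A" using u by simp
    fix i assume i: "i \<in> {..<n}"
    let ?c = "\<lambda>v\<in>carrier ?F. v i"
    have "?s i = ?c ?s" using s by simp
    also have "\<dots> = (\<Oplus>\<^bsub>regular_module A\<^esub>j\<in>{..<n}. ?c (u j \<odot>\<^bsub>?F\<^esub> unit_vector A n j))"
      using i t by (intro mod_hom_finsum[OF F left_module_regular coordinate_hom]) (auto simp: assms)
    also have "\<dots> = (\<Oplus>\<^bsub>A\<^esub>j\<in>{..<n}. ?c (u j \<odot>\<^bsub>?F\<^esub> unit_vector A n j))"
      by (simp add: finsum_def finprod_def)
    also have "\<dots> = (\<Oplus>\<^bsub>A\<^esub>j\<in>{..<n}. if i = j then u j else \<zero>\<^bsub>A\<^esub>)"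
    proof (rule finsum_cong')
      fix j assume "j \<in> {..<n}"
      moreover from this have "u j \<in> carrier A" using u by auto
      ultimately show "?c (u j \<odot>\<^bsub>?F\<^esub> unit_vector A n j) = (if i = j then u j else \<zero>\<^bsub>A\<^esub>)"
        using u i t[of j] by (auto simp: unit_vector_def)
    next
      show "(\<lambda>j. if i = j then u j else \<zero>\<^bsub>A\<^esub>) \<in> {..<n} \<rightarrow> carrier A"
        using PiE_mem[of u "{..<n}" "\<lambda>_. carrier A"] u by simp
    qed simp
    also have "\<dots> = u i" using u i by (intro add.finprod_singleton) auto
    finally show "u i = ?s i" by simp
  qed
  moreover have "(\<lambda>v\<in>carrier ?F. v j) u = u j" if "u \<in> carrier ?F" for u j using that by simp
  ultimately show ?thesis
    unfolding dual_basis_def using e coordinate_hom[OF assms] by simp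
qed

lemma fg_projective_iff:
  "fg_projective A P \<longleftrightarrow> left_module A P \<and> (\<exists>n p \<phi>. dual_basis A P n p \<phi>)"
proof (intro iffI conjI)
  assume fg: "fg_projective A P"
  then show P: "left_module A P" by (simp add: fg_projective_def)
  interpret P: left_module A P by fact
  obtain n i r where ir: "i \<in> mod_hom A P (free_module A n)" "r \<in> mod_hom A (free_module A n) P"
    "\<And>x. x \<in> carrier P \<Longrightarrow> r (i x) = x"
    using fg by (auto simp: fg_projective_def)
  let ?F = "free_module A n"
  have F: "left_module A ?F" by (rule left_module_free) (rule P.R.ring_axioms)
  let ?c = "\<lambda>j. \<lambda>u\<in>carrier ?F. u j"
  have c: "?c j \<in> functionals A ?F" if "j < n" for j
    using that by (rule coordinate_hom[OF P.R.ring_axioms])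
  have db: "dual_basis A ?F n (unit_vector A n) ?c"
    by (rule dual_basis_free) (rule P.R.ring_axioms)
  have "dual_basis A P n (\<lambda>j. r (unit_vector A n j)) (\<lambda>j. compose (carrier P) (?c j) i)"
    unfolding dual_basis_def
  proof (intro conjI allI impI ballI)
    fix j assume j: "j < n"
    show "r (unit_vector A n j) \<in> carrier P"
      using db j mod_hom_closed[OF ir(2)] by (auto simp: dual_basis_def)
    show "compose (carrier P) (?c j) i \<in> functionals A P"
      by (rule mod_hom_compose[OF P ir(1) c[OF j]])
  next
    fix x assume x: "x \<in> carrier P"
    have "x = r (i x)" using ir(3)[OF x] by simp
    also have "\<dots> = (\<Oplus>\<^bsub>P\<^esub>j\<in>{..<n}. ?c j (i x) \<odot>\<^bsub>P\<^esub> r (unit_vector A n j))"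
      by (rule dual_basis_expand[OF F P db ir(2) mod_hom_closed[OF ir(1) x]])
    finally show "x = (\<Oplus>\<^bsub>P\<^esub>j\<in>{..<n}. compose (carrier P) (?c j) i x \<odot>\<^bsub>P\<^esub> r (unit_vector A n j))"
      using x by (simp add: compose_def)
  qed
  then show "\<exists>n p \<phi>. dual_basis A P n p \<phi>" by blast
next
  assume "left_module A P \<and> (\<exists>n p \<phi>. dual_basis A P n p \<phi>)"
  then obtain n p \<phi> where P: "left_module A P" and db: "dual_basis A P n p \<phi>" by blast
  interpret P: left_module A P by fact
  let ?F = "free_module A n"
  have F: "left_module A ?F" by (rule left_module_free) (rule P.R.ring_axioms)
  have p: "p j \<in> carrier P" "\<phi> j \<in> functionals A P" if "j < n" for j
    using db that by (auto simp: dual_basis_def)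
  have c: "\<phi> j x \<in> carrier A" if "j < n" "x \<in> carrier P" for j x
    using mod_hom_closed[OF p(2) that(2)] that(1) by simp
  let ?i = "\<lambda>x\<in>carrier P. \<lambda>j\<in>{..<n}. \<phi> j x"
  let ?r = "\<lambda>u\<in>carrier ?F. \<Oplus>\<^bsub>P\<^esub>j\<in>{..<n}. (\<lambda>u\<in>carrier ?F. u j) u \<odot>\<^bsub>P\<^esub> p j"
  have i: "?i \<in> mod_hom A P ?F"
    by (rule mod_hom_restrictI[OF P])
      (auto simp: c mod_hom_add[OF p(2)] mod_hom_smult[OF p(2)] intro!: restrict_ext)
  have r: "?r \<in> mod_hom A ?F P"
    by (rule linear_combination_hom[OF F P coordinate_hom[OF P.R.ring_axioms] p(1)])
  have "?r (?i x) = x" if x: "x \<in> carrier P" for x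
  proof -
    have ix: "?i x \<in> carrier ?F" using mod_hom_closed[OF i x] .
    have "?r (?i x) = (\<Oplus>\<^bsub>P\<^esub>j\<in>{..<n}. \<phi> j x \<odot>\<^bsub>P\<^esub> p j)"
      unfolding restrict_apply'[OF ix] using x p c by (intro P.finsum_cong') auto
    also have "\<dots> = x" using db x by (simp add: dual_basis_def)
    finally show ?thesis .
  qed
  then show "fg_projective A P" unfolding fg_projective_def using P i r by blast
qed

lemma fg_projective_module: "fg_projective A P \<Longrightarrow> left_module A P"
  by (simp add: fg_projective_def)

lemma fg_projective_free: "ring A \<Longrightarrow> fg_projective A (free_module A n)"
  unfolding fg_projective_iff using left_module_free dual_basis_free by blast

text \<open>
  Lifting the images of the \<open>p\<^sub>j\<close> and combining the lifts with the coefficients \<open>\<phi>\<^sub>j(x)\<close> lifts \<open>f\<close>.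
\<close>

lemma projective_lift:
  assumes P: "fg_projective A P" and X: "left_module A X" and Y: "left_module A Y"
    and f: "f \<in> mod_hom A P Y" and h: "h \<in> mod_hom A X Y"
    and im: "f ` carrier P \<subseteq> h ` carrier X"
  obtains g where "g \<in> mod_hom A P X" "\<And>x. x \<in> carrier P \<Longrightarrow> h (g x) = f x"
proof -
  obtain n p \<phi> where PM: "left_module A P" and db: "dual_basis A P n p \<phi>"
    using P by (auto simp: fg_projective_iff)
  interpret X: left_module A X by fact
  interpret Y: left_module A Y by fact
  have p: "p j \<in> carrier P" "\<phi> j \<in> functionals A P" if "j < n" for j
    using db that by (auto simp: dual_basis_def)
  have c: "\<phi> j x \<in> carrier A" if "j < n" "x \<in> carrier P" for j x
    using mod_hom_closed[OF p(2) that(2)] that(1) by simp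
  have "\<forall>j<n. \<exists>y\<in>carrier X. h y = f (p j)"
    using p im by (metis image_eqI image_subset_iff imageE)
  then obtain y where y: "\<And>j. j < n \<Longrightarrow> y j \<in> carrier X \<and> h (y j) = f (p j)" by metis
  let ?g = "\<lambda>x\<in>carrier P. \<Oplus>\<^bsub>X\<^esub>j\<in>{..<n}. \<phi> j x \<odot>\<^bsub>X\<^esub> y j"
  have "?g \<in> mod_hom A P X"
    using p y by (intro linear_combination_hom[OF PM X]) auto
  moreover have "h (?g x) = f x" if x: "x \<in> carrier P" for x
  proof -
    have "h (?g x) = (\<Oplus>\<^bsub>Y\<^esub>j\<in>{..<n}. h (\<phi> j x \<odot>\<^bsub>X\<^esub> y j))"
      using x y c by (simp, intro mod_hom_finsum[OF X Y h]) auto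
    also have "\<dots> = (\<Oplus>\<^bsub>Y\<^esub>j\<in>{..<n}. \<phi> j x \<odot>\<^bsub>Y\<^esub> f (p j))"
      using x y c p mod_hom_closed[OF f] by (intro Y.finsum_cong') (auto simp: mod_hom_smult[OF h])
    also have "\<dots> = f x"
      by (rule dual_basis_expand[OF PM Y db f x, symmetric])
    finally show ?thesis .
  qed
  ultimately show ?thesis using that by blast
qed

lemma projective_separated:
  assumes "fg_projective A P" "x \<in> carrier P"
    and "\<And>f. f \<in> functionals A P \<Longrightarrow> f x = \<zero>\<^bsub>A\<^esub>"
  shows "x = \<zero>\<^bsub>P\<^esub>"
proof -
  obtain n p \<phi> where PM: "left_module A P" and db: "dual_basis A P n p \<phi>"
    using assms(1) by (auto simp: fg_projective_iff)
  interpret left_module A P by fact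
  have z: "\<phi> j x \<odot>\<^bsub>P\<^esub> p j = \<zero>\<^bsub>P\<^esub>" if "j < n" for j
    using db assms(3)[of "\<phi> j"] that by (simp add: dual_basis_def)
  have "x = (\<Oplus>\<^bsub>P\<^esub>j\<in>{..<n}. \<phi> j x \<odot>\<^bsub>P\<^esub> p j)"
    using db assms(2) by (simp add: dual_basis_def)
  also have "\<dots> = (\<Oplus>\<^bsub>P\<^esub>j\<in>{..<n}. \<zero>\<^bsub>P\<^esub>)"
    using z by (intro M.finsum_cong') auto
  finally show ?thesis by simp
qed

text \<open>
  The roles of elements and functionals are exchanged: \<open>f = \<Sum>\<^sub>j \<phi>\<^sub>j f(p\<^sub>j)\<close> holds because both
  sides agree on every \<open>x = \<Sum>\<^sub>j \<phi>\<^sub>j(x) p\<^sub>j\<close>.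
\<close>

lemma dual_basis_dual:
  assumes P: "left_module A P" and db: "dual_basis A P n p \<phi>"
  shows "dual_basis (op_ring A) (dual A P) n \<phi> (\<lambda>j. eval_map A P (p j))"
proof -
  interpret P: left_module A P by fact
  interpret D: left_module "op_ring A" "dual A P" by (rule right_module_dual) fact
  have p: "p j \<in> carrier P" "\<phi> j \<in> functionals A P" if "j < n" for j
    using db that by (auto simp: dual_basis_def)
  have c: "\<phi> j x \<in> carrier A" if "j < n" "x \<in> carrier P" for j x
    using mod_hom_closed[OF p(2) that(2)] that(1) by simp
  have "f = (\<Oplus>\<^bsub>dual A P\<^esub>j\<in>{..<n}. f (p j) \<odot>\<^bsub>dual A P\<^esub> \<phi> j)" (is "f = ?s")
    if f: "f \<in> functionals A P" for f
  proof (rule mod_hom_ext[OF f])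
    have t: "f (p j) \<odot>\<^bsub>dual A P\<^esub> \<phi> j \<in> carrier (dual A P)" if "j < n" for j
      using p[OF that] mod_hom_closed[OF f] by (intro D.smult_closed) auto
    then show s: "?s \<in> functionals A P"
      using D.finsum_closed[of "\<lambda>j. f (p j) \<odot>\<^bsub>dual A P\<^esub> \<phi> j" "{..<n}"]
      by (simp only: dual_simps(1)) auto
    fix x assume x: "x \<in> carrier P"
    have "?s x = eval_map A P x ?s" using x s by simp
    also have "\<dots> = (\<Oplus>\<^bsub>regular_module (op_ring A)\<^esub>j\<in>{..<n}. eval_map A P x (f (p j) \<odot>\<^bsub>dual A P\<^esub> \<phi> j))"
      using t by (intro mod_hom_finsum[OF D.left_module_axioms left_module_regular eval_map_closed[OF P x]])
        (auto intro: D.R.ring_axioms)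
    \<comment> \<open>Sums in the regular modules of \<open>A\<close> and of its opposite ring depend only on the common addition.\<close>
    also have "\<dots> = (\<Oplus>\<^bsub>regular_module A\<^esub>j\<in>{..<n}. eval_map A P x (f (p j) \<odot>\<^bsub>dual A P\<^esub> \<phi> j))"
      by (simp add: finsum_def finprod_def)
    also have "\<dots> = (\<Oplus>\<^bsub>regular_module A\<^esub>j\<in>{..<n}. \<phi> j x \<odot>\<^bsub>regular_module A\<^esub> f (p j))"
    proof -
      interpret reg: left_module A "regular_module A"
        by (rule left_module_regular) (rule P.R.ring_axioms)
      show ?thesis
      proof (rule reg.finsum_cong')
        fix j assume "j \<in> {..<n}"
        then show "eval_map A P x (f (p j) \<odot>\<^bsub>dual A P\<^esub> \<phi> j) = \<phi> j x \<odot>\<^bsub>regular_module A\<^esub> f (p j)"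
          using x t[of j] by (simp del: dual_simps(4)) simp
      qed (use p c[OF _ x] mod_hom_closed[OF f] in auto)
    qed
    also have "\<dots> = f x"
      using dual_basis_expand[OF P left_module_regular db f x] P.R.ring_axioms by simp
    finally show "f x = ?s x" by simp
  qed
  moreover have "(\<Oplus>\<^bsub>dual A P\<^esub>j\<in>{..<n}. eval_map A P (p j) f \<odot>\<^bsub>dual A P\<^esub> \<phi> j)
      = (\<Oplus>\<^bsub>dual A P\<^esub>j\<in>{..<n}. f (p j) \<odot>\<^bsub>dual A P\<^esub> \<phi> j)"
    if f: "f \<in> functionals A P" for f
  proof (rule D.finsum_cong')
    show "(\<lambda>j. f (p j) \<odot>\<^bsub>dual A P\<^esub> \<phi> j) \<in> {..<n} \<rightarrow> carrier (dual A P)"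
      using p mod_hom_closed[OF f] by (intro funcsetI D.smult_closed) auto
  qed (use f p in auto)
  ultimately show ?thesis
    unfolding dual_basis_def using p eval_map_closed[OF P] by simp
qed

lemma fg_projective_dual: "fg_projective A P \<Longrightarrow> fg_projective (op_ring A) (dual A P)"
  unfolding fg_projective_iff using dual_basis_dual right_module_dual by blast

text \<open>An element of the bidual sends \<open>f = \<Sum>\<^sub>j \<phi>\<^sub>j f(p\<^sub>j)\<close> to \<open>f (\<Sum>\<^sub>j \<xi>(\<phi>\<^sub>j) p\<^sub>j)\<close>.\<close>

lemma projective_reflexive:
  assumes "fg_projective A P"
  shows "reflexive A P"
proof -
  obtain n p \<phi> where P: "left_module A P" and db: "dual_basis A P n p \<phi>"
    using assms by (auto simp: fg_projective_iff)
  interpret P: left_module A P by fact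
  interpret D: left_module "op_ring A" "dual A P" by (rule right_module_dual) fact
  have p: "p j \<in> carrier P" "\<phi> j \<in> functionals A P" if "j < n" for j
    using db that by (auto simp: dual_basis_def)
  have reg: "left_module A (regular_module A)"
    by (rule left_module_regular) (rule P.R.ring_axioms)
  have "\<exists>x\<in>carrier P. \<forall>f\<in>functionals A P. \<xi> f = f x"
    if \<xi>: "\<xi> \<in> functionals (op_ring A) (dual A P)" for \<xi>
  proof (intro bexI ballI)
    let ?x = "\<Oplus>\<^bsub>P\<^esub>j\<in>{..<n}. \<xi> (\<phi> j) \<odot>\<^bsub>P\<^esub> p j"
    have c: "\<xi> (\<phi> j) \<in> carrier A" if "j < n" for j
      using mod_hom_closed[OF \<xi>] p(2)[OF that] by simp
    show "?x \<in> carrier P" using c p by (intro P.finsum_closed) auto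
    fix f assume f: "f \<in> functionals A P"
    interpret reg: left_module A "regular_module A" by (rule reg)
    have "\<xi> f = (\<Oplus>\<^bsub>regular_module (op_ring A)\<^esub>j\<in>{..<n}.
        eval_map A P (p j) f \<odot>\<^bsub>regular_module (op_ring A)\<^esub> \<xi> (\<phi> j))"
      using f by (intro dual_basis_expand[OF D.left_module_axioms left_module_regular dual_basis_dual[OF P db] \<xi>])
        (auto intro: D.R.ring_axioms)
    also have "\<dots> = (\<Oplus>\<^bsub>regular_module A\<^esub>j\<in>{..<n}.
        eval_map A P (p j) f \<odot>\<^bsub>regular_module (op_ring A)\<^esub> \<xi> (\<phi> j))"
      by (simp add: finsum_def finprod_def)
    also have "\<dots> = (\<Oplus>\<^bsub>regular_module A\<^esub>j\<in>{..<n}. f (\<xi> (\<phi> j) \<odot>\<^bsub>P\<^esub> p j))"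
      using p c f mod_hom_closed[OF f] by (intro reg.finsum_cong') (auto simp: mod_hom_smult[OF f])
    also have "\<dots> = f ?x"
      using p c by (intro mod_hom_finsum[OF P reg f, symmetric]) auto
    finally show "\<xi> f = f ?x" .
  qed
  then show ?thesis
    unfolding reflexive_iff[OF P] using projective_separated[OF assms] by blast
qed

lemma fg_projective_iso:
  assumes P: "fg_projective A P" and Q: "left_module A Q"
    and f: "f \<in> mod_hom A P Q" "bij_betw f (carrier P) (carrier Q)"
  shows "fg_projective A Q"
proof -
  have PM: "left_module A P" by (rule fg_projective_module[OF P])
  obtain n i r where ir: "i \<in> mod_hom A P (free_module A n)" "r \<in> mod_hom A (free_module A n) P"
    "\<And>x. x \<in> carrier P \<Longrightarrow> r (i x) = x"
    using P by (auto simp: fg_projective_def)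
  have F: "left_module A (free_module A n)"
    using PM by (intro left_module_free) (simp add: left_module_def)
  obtain g where "g \<in> mod_hom A (Q\<lparr>carrier := f ` carrier P\<rparr>) P" and gf: "\<And>x. x \<in> carrier P \<Longrightarrow> g (f x) = x"
    using mod_hom_inverse[OF PM Q f(1)] f(2) by (auto simp: bij_betw_def)
  moreover have "f ` carrier P = carrier Q" using f(2) by (simp add: bij_betw_def)
  ultimately have g: "g \<in> mod_hom A Q P" unfolding mod_hom_def by simp
  have "compose (carrier (free_module A n)) f r (compose (carrier Q) i g y) = y" if "y \<in> carrier Q" for y
  proof -
    obtain x where x: "x \<in> carrier P" "y = f x" using f(2) \<open>y \<in> carrier Q\<close> by (auto simp: bij_betw_def)
    then show ?thesis
      using that gf ir(3) mod_hom_closed[OF ir(1) x(1)] by (simp add: compose_def)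
  qed
  then show ?thesis
    unfolding fg_projective_def
    using Q mod_hom_compose[OF Q g ir(1)] mod_hom_compose[OF F ir(2) f(1)] by blast
qed

text \<open>
  The definitions of \<open>Ext\<close> and of Gorenstein-projectivity quantify over modules whose elements have
  type \<^typ>\<open>nat \<Rightarrow> 'a\<close>; a projective module on another type, such as a dual, is replaced by its
  image under a split embedding into some \<open>A\<^sup>n\<close>.
\<close>

lemma fg_projective_transport:
  assumes "fg_projective A P"
  obtains P' :: "('a, nat \<Rightarrow> 'a) module" and f g
  where "fg_projective A P'" "f \<in> mod_hom A P P'" "g \<in> mod_hom A P' P"
    "bij_betw f (carrier P) (carrier P')"
    "\<And>x. x \<in> carrier P \<Longrightarrow> g (f x) = x" "\<And>y. y \<in> carrier P' \<Longrightarrow> f (g y) = y"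
proof -
  have PM: "left_module A P" by (rule fg_projective_module[OF assms])
  obtain n i r where ir: "i \<in> mod_hom A P (free_module A n)" "r \<in> mod_hom A (free_module A n) P"
    "\<And>x. x \<in> carrier P \<Longrightarrow> r (i x) = x"
    using assms by (auto simp: fg_projective_def)
  let ?P = "(free_module A n)\<lparr>carrier := i ` carrier P\<rparr>"
  have F: "left_module A (free_module A n)"
    using PM by (intro left_module_free) (simp add: left_module_def)
  have P': "left_module A ?P"
    by (intro left_module.left_module_submodule[OF F] submodule_image[OF PM F ir(1)]
        submodule_carrier[OF PM])
  have i: "i \<in> mod_hom A P ?P" by (rule mod_hom_codomain[OF ir(1)]) auto
  have inj: "inj_on i (carrier P)" using ir(3) by (intro inj_on_inverseI[where g = r])
  obtain g where g: "g \<in> mod_hom A ?P P" "\<And>x. x \<in> carrier P \<Longrightarrow> g (i x) = x"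
    using mod_hom_inverse[OF PM F ir(1) inj] by blast
  have bij: "bij_betw i (carrier P) (carrier ?P)" using inj by (simp add: bij_betw_def)
  show ?thesis
    by (rule that[OF fg_projective_iso[OF assms P' i bij] i g(1) bij g(2)]) (use g(2) in auto)
qed

section \<open>Noetherian modules\<close>

text \<open>
  As an intersection of submodules, the span supports arguments about generators that never mention
  linear combinations; \<open>fin_gen_iff_span\<close> below translates to coefficients.
\<close>

definition module_span ::
  "('a, 'x) ring_scheme \<Rightarrow> ('a, 'm, 'z) module_scheme \<Rightarrow> 'm set \<Rightarrow> 'm set"
  where "module_span A M S = \<Inter>{N. submodule N A M \<and> S \<subseteq> N}"

definition noetherian_module ::
  "('a, 'x) ring_scheme \<Rightarrow> ('a, 'm, 'z) module_scheme \<Rightarrow> bool"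
  where "noetherian_module A M \<longleftrightarrow>
    (\<forall>N. submodule N A M \<longrightarrow> (\<exists>S. finite S \<and> S \<subseteq> N \<and> N = module_span A M S))"

abbreviation left_noetherian :: "('a, 'x) ring_scheme \<Rightarrow> bool"
  where "left_noetherian A \<equiv> noetherian_module A (regular_module A)"

lemma noetherian_moduleE:
  assumes "noetherian_module A M" "submodule N A M"
  obtains S where "finite S" "S \<subseteq> N" "N = module_span A M S"
  using assms unfolding noetherian_module_def by metis

lemma module_span_superset: "S \<subseteq> module_span A M S"
  by (auto simp: module_span_def)

lemma module_span_least: "submodule N A M \<Longrightarrow> S \<subseteq> N \<Longrightarrow> module_span A M S \<subseteq> N"
  by (auto simp: module_span_def)

context left_module
begin

lemma submodule_span: "S \<subseteq> carrier M \<Longrightarrow> submodule (module_span A M S) A M"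
proof -
  assume "S \<subseteq> carrier M"
  then have "module_span A M S \<subseteq> carrier M"
    by (intro module_span_least submodule_carrier left_module_axioms)
  then show ?thesis unfolding submodule_iff by (auto simp: module_span_def submodule_iff)
qed

lemma submodule_Int:
  "submodule H A M \<Longrightarrow> submodule H' A M \<Longrightarrow> submodule (H \<inter> H') A M"
  unfolding submodule_iff by blast

lemma submodule_diff:
  assumes "submodule H A M" "x \<in> H" "y \<in> H"
  shows "x \<ominus>\<^bsub>M\<^esub> y \<in> H"
  using assms smult_minus_one[of y] unfolding submodule_iff a_minus_def
  by (metis R.add.inv_closed R.one_closed subsetD)

lemma set_add_iff: "x \<in> H <+>\<^bsub>M\<^esub> H' \<longleftrightarrow> (\<exists>y\<in>H. \<exists>z\<in>H'. x = y \<oplus>\<^bsub>M\<^esub> z)"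
  by (auto simp: set_add_def set_mult_def)

text \<open>
  Sums of submodules carry the two reductions modulo a submodule in the next proofs: adjoining one
  generator to a span, and comparing elements of a submodule through one coefficient.
\<close>

lemma submodule_set_add:
  assumes H: "submodule H A M" and H': "submodule H' A M"
  shows "submodule (H <+>\<^bsub>M\<^esub> H') A M" "H \<subseteq> H <+>\<^bsub>M\<^esub> H'" "H' \<subseteq> H <+>\<^bsub>M\<^esub> H'"
proof -
  have c: "y \<in> carrier M" "z \<in> carrier M" if "y \<in> H" "z \<in> H'" for y z
    using that H H' by (auto simp: submodule_iff)
  have z: "\<zero>\<^bsub>M\<^esub> \<in> H" "\<zero>\<^bsub>M\<^esub> \<in> H'" using H H' by (auto simp: submodule_iff)
  have I: "y \<oplus>\<^bsub>M\<^esub> z \<in> H <+>\<^bsub>M\<^esub> H'" if "y \<in> H" "z \<in> H'" for y z using that by (auto simp: set_add_iff)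
  show "H \<subseteq> H <+>\<^bsub>M\<^esub> H'" using I[OF _ z(2)] c(1)[OF _ z(2)] by fastforce
  show "H' \<subseteq> H <+>\<^bsub>M\<^esub> H'" using I[OF z(1)] c(2)[OF z(1)] by fastforce
  show "submodule (H <+>\<^bsub>M\<^esub> H') A M" unfolding submodule_iff
  proof (intro conjI ballI)
    show "H <+>\<^bsub>M\<^esub> H' \<subseteq> carrier M" using c by (auto simp: set_add_iff)
    show "\<zero>\<^bsub>M\<^esub> \<in> H <+>\<^bsub>M\<^esub> H'" using I[OF z] by simp
  next
    fix u v assume "u \<in> H <+>\<^bsub>M\<^esub> H'" "v \<in> H <+>\<^bsub>M\<^esub> H'"
    then obtain y z y' z' where m: "y \<in> H" "z \<in> H'" "y' \<in> H" "z' \<in> H'"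
      and uv: "u = y \<oplus>\<^bsub>M\<^esub> z" "v = y' \<oplus>\<^bsub>M\<^esub> z'" unfolding set_add_iff by blast
    have "u \<oplus>\<^bsub>M\<^esub> v = (y \<oplus>\<^bsub>M\<^esub> y') \<oplus>\<^bsub>M\<^esub> (z \<oplus>\<^bsub>M\<^esub> z')"
      unfolding uv using c[OF m(1,2)] c[OF m(3,4)] by (simp add: M.a_ac)
    then show "u \<oplus>\<^bsub>M\<^esub> v \<in> H <+>\<^bsub>M\<^esub> H'" using m H H' I by (simp add: submodule_iff)
  next
    fix a u assume a: "a \<in> carrier A" and "u \<in> H <+>\<^bsub>M\<^esub> H'"
    then obtain y z where m: "y \<in> H" "z \<in> H'" "u = y \<oplus>\<^bsub>M\<^esub> z" unfolding set_add_iff by blast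
    then have "a \<odot>\<^bsub>M\<^esub> u = a \<odot>\<^bsub>M\<^esub> y \<oplus>\<^bsub>M\<^esub> a \<odot>\<^bsub>M\<^esub> z" using a c by (simp add: smult_r_distr)
    then show "a \<odot>\<^bsub>M\<^esub> u \<in> H <+>\<^bsub>M\<^esub> H'" using m a H H' I by (simp add: submodule_iff)
  qed
qed

lemma scalar_hom:
  "s \<in> carrier M \<Longrightarrow> (\<lambda>a\<in>carrier (regular_module A). a \<odot>\<^bsub>M\<^esub> s) \<in> mod_hom A (regular_module A) M"
  by (rule mod_hom_restrictI[OF left_module_regular[OF R.ring_axioms]])
    (auto simp: smult_l_distr smult_assoc1)

lemma span_insert:
  assumes "s \<in> carrier M" "S \<subseteq> carrier M" "x \<in> module_span A M (insert s S)"
  obtains a m where "a \<in> carrier A" "m \<in> module_span A M S" "x = a \<odot>\<^bsub>M\<^esub> s \<oplus>\<^bsub>M\<^esub> m"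
proof -
  have reg: "left_module A (regular_module A)" by (rule left_module_regular[OF R.ring_axioms])
  let ?C = "(\<lambda>a\<in>carrier (regular_module A). a \<odot>\<^bsub>M\<^esub> s) ` carrier (regular_module A)"
  have C: "submodule ?C A M"
    by (rule submodule_image[OF reg left_module_axioms scalar_hom[OF assms(1)] submodule_carrier[OF reg]])
  note sum = submodule_set_add[OF C submodule_span[OF assms(2)]]
  have "s \<in> ?C" using assms(1) by (intro rev_image_eqI[of "\<one>"]) auto
  then have "insert s S \<subseteq> ?C <+>\<^bsub>M\<^esub> module_span A M S"
    using sum(2,3) module_span_superset[of S A M] by blast
  then have "x \<in> ?C <+>\<^bsub>M\<^esub> module_span A M S"
    using assms(3) module_span_least[OF sum(1)] by blast
  then show ?thesis using that unfolding set_add_iff by auto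
qed

text \<open>
  Induction on the number of generators: modulo the span of the others, a submodule is controlled
  by the ideal of its coefficients at the new generator, which is finitely generated.
\<close>

lemma submodule_of_fin_span:
  assumes noeth: "left_noetherian A"
    and "finite S" "S \<subseteq> carrier M" "submodule N A M" "N \<subseteq> module_span A M S"
  shows "\<exists>T. finite T \<and> T \<subseteq> N \<and> N = module_span A M T"
  using assms(2-)
proof (induction S arbitrary: N rule: finite_induct)
  case empty
  have "submodule {\<zero>\<^bsub>M\<^esub>} A M" by (auto simp: submodule_iff)
  then have "N \<subseteq> {\<zero>\<^bsub>M\<^esub>}" using empty module_span_least[of "{\<zero>\<^bsub>M\<^esub>}" A M "{}"] by auto
  moreover have "\<zero>\<^bsub>M\<^esub> \<in> module_span A M {}"
    using submodule_span[of "{}"] by (auto simp: submodule_iff)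
  ultimately have "N = module_span A M {}"
    using module_span_least[OF empty(2), of "{}"] by blast
  then show ?case by blast
next
  case (insert s S)
  note N = \<open>submodule N A M\<close>
  have sS: "s \<in> carrier M" "S \<subseteq> carrier M" using insert by auto
  let ?B = "module_span A M S"
  have B: "submodule ?B A M" by (rule submodule_span) (fact sS)
  let ?c = "\<lambda>a\<in>carrier (regular_module A). a \<odot>\<^bsub>M\<^esub> s"
  \<comment> \<open>The coefficients at \<open>s\<close> of elements of \<open>X\<close>, modulo the span of the other generators.\<close>
  define coeff where "coeff X = {a \<in> carrier (regular_module A). ?c a \<in> X <+>\<^bsub>M\<^esub> ?B}" for X
  have coeff: "submodule (coeff X) A (regular_module A)" if "submodule X A M" for X
    unfolding coeff_def
    by (rule submodule_vimage[OF left_module_regular[OF R.ring_axioms] left_module_axioms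
          scalar_hom[OF sS(1)] submodule_set_add(1)[OF that B]])
  have coeff_iff: "a \<in> coeff X \<longleftrightarrow> a \<in> carrier A \<and> (\<exists>y\<in>X. \<exists>b\<in>?B. a \<odot>\<^bsub>M\<^esub> s = y \<oplus>\<^bsub>M\<^esub> b)" for a X
    by (auto simp: coeff_def set_add_iff)
  obtain T0 where T0: "finite T0" "T0 \<subseteq> coeff N" "coeff N = module_span A (regular_module A) T0"
    by (rule noetherian_moduleE[OF noeth coeff[OF N]])
  have "\<forall>a\<in>T0. \<exists>y\<in>N. \<exists>b\<in>?B. a \<odot>\<^bsub>M\<^esub> s = y \<oplus>\<^bsub>M\<^esub> b" using T0(2) coeff_iff by blast
  then obtain y where y: "\<And>a. a \<in> T0 \<Longrightarrow> y a \<in> N" "\<And>a. a \<in> T0 \<Longrightarrow> \<exists>b\<in>?B. a \<odot>\<^bsub>M\<^esub> s = y a \<oplus>\<^bsub>M\<^esub> b"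
    by metis
  \<comment> \<open>\<open>U\<close> realises all coefficients at \<open>s\<close>, and \<open>T1\<close> generates what remains when they are removed.\<close>
  define U where "U = y ` T0"
  have U: "U \<subseteq> N" using y(1) by (auto simp: U_def)
  have NC: "N \<subseteq> carrier M" using N by (auto simp: submodule_iff)
  obtain T1 where T1: "finite T1" "T1 \<subseteq> N \<inter> ?B" "N \<inter> ?B = module_span A M T1"
    using insert.IH[OF sS(2) submodule_Int[OF N B]] by blast
  have W: "submodule (module_span A M (U \<union> T1)) A M"
    using U T1(2) NC by (intro submodule_span) auto
  have US: "submodule (module_span A M U) A M" using U NC by (intro submodule_span) auto
  have "T0 \<subseteq> coeff (module_span A M U)"
  proof
    fix a assume a: "a \<in> T0"
    then have "y a \<in> module_span A M U" using module_span_superset[of U A M] by (auto simp: U_def)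
    then show "a \<in> coeff (module_span A M U)" using y(2)[OF a] a T0(2) coeff_iff by blast
  qed
  then have coeff_U: "coeff N \<subseteq> coeff (module_span A M U)"
    unfolding T0(3) by (rule module_span_least[OF coeff[OF US]])
  have "x \<in> module_span A M (U \<union> T1)" if x: "x \<in> N" for x
  proof -
    obtain a b where ab: "a \<in> carrier A" "b \<in> ?B" "x = a \<odot>\<^bsub>M\<^esub> s \<oplus>\<^bsub>M\<^esub> b"
      using span_insert[OF sS] insert.prems(3) x by blast
    have bc: "b \<in> carrier M" "\<ominus>\<^bsub>M\<^esub> b \<in> ?B"
      using ab(2) B submodule_diff[OF B _ ab(2), of "\<zero>\<^bsub>M\<^esub>"] by (auto simp: submodule_iff a_minus_def)
    have "a \<odot>\<^bsub>M\<^esub> s = x \<oplus>\<^bsub>M\<^esub> \<ominus>\<^bsub>M\<^esub> b"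
      using ab bc(1) sS(1) by (simp add: M.a_assoc M.r_neg)
    then have "a \<in> coeff N" using ab(1) x bc(2) coeff_iff by blast
    then obtain u b' where u: "u \<in> module_span A M U" "b' \<in> ?B" "a \<odot>\<^bsub>M\<^esub> s = u \<oplus>\<^bsub>M\<^esub> b'"
      using coeff_U coeff_iff by blast
    have uN: "u \<in> N" "u \<in> module_span A M (U \<union> T1)"
      using u(1) module_span_least[OF N U] module_span_least[OF W, of U]
        module_span_superset[of "U \<union> T1" A M] by blast+
    have c: "u \<in> carrier M" "b' \<in> carrier M" using uN(1) NC u(2) B by (auto simp: submodule_iff)
    have xu: "x = u \<oplus>\<^bsub>M\<^esub> (b' \<oplus>\<^bsub>M\<^esub> b)" using c bc(1) by (simp add: ab(3) u(3) M.a_assoc)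
    then have "x \<ominus>\<^bsub>M\<^esub> u = b' \<oplus>\<^bsub>M\<^esub> b" using c bc(1) by (simp add: a_minus_def M.a_ac M.r_neg1 M.r_neg)
    moreover have "b' \<oplus>\<^bsub>M\<^esub> b \<in> ?B" using B u(2) ab(2) by (simp add: submodule_iff)
    ultimately have "b' \<oplus>\<^bsub>M\<^esub> b \<in> N \<inter> ?B" using submodule_diff[OF N x uN(1)] by simp
    then have "b' \<oplus>\<^bsub>M\<^esub> b \<in> module_span A M (U \<union> T1)"
      using T1(3) module_span_least[OF W, of T1] module_span_superset[of "U \<union> T1" A M] by auto
    then show ?thesis unfolding xu using W uN(2) by (simp add: submodule_iff)
  qed
  moreover have "module_span A M (U \<union> T1) \<subseteq> N"
    using U T1(2) by (intro module_span_least[OF N]) auto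
  ultimately have "N = module_span A M (U \<union> T1)" by blast
  then show ?case using U T1 T0(1) by (intro exI[of _ "U \<union> T1"]) (auto simp: U_def)
qed

lemma span_cover:
  assumes S: "finite S" "S \<subseteq> carrier M" "module_span A M S = carrier M"
  obtains e h where "bij_betw e {..<card S} S" "h \<in> mod_hom A (free_module A (card S)) M"
    "\<forall>u\<in>carrier (free_module A (card S)). h u = (\<Oplus>\<^bsub>M\<^esub>j\<in>{..<card S}. u j \<odot>\<^bsub>M\<^esub> e j)"
    "h ` carrier (free_module A (card S)) = carrier M"
proof -
  obtain e where e: "bij_betw e {..<card S} S"
    using ex_bij_betw_nat_finite[OF S(1)] by (auto simp: atLeast0LessThan)
  let ?n = "card S"
  let ?F = "free_module A ?n"
  have F: "left_module A ?F" by (rule left_module_free[OF R.ring_axioms])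
  have es: "e j \<in> carrier M" if "j < ?n" for j using e S(2) that by (auto simp: bij_betw_def)
  let ?h = "\<lambda>u\<in>carrier ?F. \<Oplus>\<^bsub>M\<^esub>j\<in>{..<?n}. (\<lambda>u\<in>carrier ?F. u j) u \<odot>\<^bsub>M\<^esub> e j"
  have h: "?h \<in> mod_hom A ?F M"
    by (rule linear_combination_hom[OF F left_module_axioms coordinate_hom[OF R.ring_axioms] es])
  have h_app: "?h u = (\<Oplus>\<^bsub>M\<^esub>j\<in>{..<?n}. u j \<odot>\<^bsub>M\<^esub> e j)" if u: "u \<in> carrier ?F" for u
  proof -
    have "u j \<in> carrier A" if "j < ?n" for j using u that by auto
    then show ?thesis unfolding restrict_apply'[OF u] using u es by (intro M.finsum_cong') auto
  qed
  have "e k \<in> ?h ` carrier ?F" if k: "k < ?n" for k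
  proof -
    have v: "unit_vector A ?n k \<in> carrier ?F" by (auto simp: unit_vector_def)
    have "?h (unit_vector A ?n k) = (\<Oplus>\<^bsub>M\<^esub>j\<in>{..<?n}. if k = j then e j else \<zero>\<^bsub>M\<^esub>)"
      unfolding h_app[OF v] using es by (intro M.finsum_cong') (auto simp: unit_vector_def)
    also have "\<dots> = e k" using k es by (intro M.finsum_singleton) auto
    finally show ?thesis by (rule image_eqI[OF sym v])
  qed
  then have "e ` {..<?n} \<subseteq> ?h ` carrier ?F" by (intro image_subsetI) simp
  then have "S \<subseteq> ?h ` carrier ?F" using e by (simp only: bij_betw_def)
  then have "carrier M \<subseteq> ?h ` carrier ?F"
    using module_span_least[OF submodule_image[OF F left_module_axioms h submodule_carrier[OF F]]] S(3) by blast
  then have "?h ` carrier ?F = carrier M" using mod_hom_closed[OF h] by blast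
  with e h h_app show ?thesis by (intro that[of e ?h]) blast+
qed

lemma fin_gen_iff_span:
  "fin_gen A M \<longleftrightarrow> (\<exists>S. finite S \<and> S \<subseteq> carrier M \<and> module_span A M S = carrier M)"
proof
  assume "fin_gen A M"
  then obtain S where S: "finite S" "S \<subseteq> carrier M"
    "\<And>x. x \<in> carrier M \<Longrightarrow> \<exists>c \<in> S \<rightarrow> carrier A. x = (\<Oplus>\<^bsub>M\<^esub>s\<in>S. c s \<odot>\<^bsub>M\<^esub> s)"
    unfolding fin_gen_def by blast
  have sp: "submodule (module_span A M S) A M" by (rule submodule_span) fact
  have "x \<in> module_span A M S" if "x \<in> carrier M" for x
  proof -
    obtain c where c: "c \<in> S \<rightarrow> carrier A" "x = (\<Oplus>\<^bsub>M\<^esub>s\<in>S. c s \<odot>\<^bsub>M\<^esub> s)" using S(3)[OF \<open>x \<in> carrier M\<close>] by blast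
    have "c s \<odot>\<^bsub>M\<^esub> s \<in> module_span A M S" if "s \<in> S" for s
      using sp c(1) that module_span_superset[of S A M] unfolding submodule_iff by blast
    then show ?thesis unfolding c(2) by (intro submodule_finsum[OF sp S(1)])
  qed
  then show "\<exists>S. finite S \<and> S \<subseteq> carrier M \<and> module_span A M S = carrier M"
    using S sp unfolding submodule_iff by blast
next
  assume "\<exists>S. finite S \<and> S \<subseteq> carrier M \<and> module_span A M S = carrier M"
  then obtain S where S: "finite S" "S \<subseteq> carrier M" "module_span A M S = carrier M" by blast
  obtain e h where e: "bij_betw e {..<card S} S" and "h \<in> mod_hom A (free_module A (card S)) M"
    and h: "\<forall>u\<in>carrier (free_module A (card S)). h u = (\<Oplus>\<^bsub>M\<^esub>j\<in>{..<card S}. u j \<odot>\<^bsub>M\<^esub> e j)"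
      "h ` carrier (free_module A (card S)) = carrier M"
    by (rule span_cover[OF S])
  have "\<exists>c\<in>S \<rightarrow> carrier A. x = (\<Oplus>\<^bsub>M\<^esub>s\<in>S. c s \<odot>\<^bsub>M\<^esub> s)" if "x \<in> carrier M" for x
  proof -
    have "x \<in> h ` carrier (free_module A (card S))" unfolding h(2) by (rule that)
    then obtain u where u: "u \<in> carrier (free_module A (card S))" "x = h u" by blast
    let ?c = "\<lambda>s. u (the_inv_into {..<card S} e s)"
    have inv: "the_inv_into {..<card S} e (e j) = j" if "j < card S" for j
      using e that by (simp add: bij_betw_def the_inv_into_f_f)
    have uc: "u j \<in> carrier A" if "j < card S" for j using u(1) that by auto
    have c: "?c \<in> S \<rightarrow> carrier A"
    proof
      fix s assume "s \<in> S"
      then obtain j where "j < card S" "s = e j" using e by (auto simp: bij_betw_def)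
      then show "?c s \<in> carrier A" using inv uc by simp
    qed
    have es: "e j \<in> carrier M" if "j < card S" for j
      using e S(2) that by (auto simp: bij_betw_def)
    have "x = (\<Oplus>\<^bsub>M\<^esub>j\<in>{..<card S}. ?c (e j) \<odot>\<^bsub>M\<^esub> e j)"
      unfolding u(2) h(1)[rule_format, OF u(1)] using inv uc es by (intro M.finsum_cong') auto
    also have "\<dots> = (\<Oplus>\<^bsub>M\<^esub>s\<in>e ` {..<card S}. ?c s \<odot>\<^bsub>M\<^esub> s)"
      using c S(2) e by (intro M.finsum_reindex[symmetric]) (auto simp: bij_betw_def)
    finally show ?thesis using c e by (intro bexI[of _ ?c]) (auto simp: bij_betw_def)
  qed
  then show "fin_gen A M" unfolding fin_gen_def using S(1,2) by blast
qed

lemma noetherian_of_fin_gen: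
  assumes "left_noetherian A" "fin_gen A M"
  shows "noetherian_module A M"
proof -
  obtain S where S: "finite S" "S \<subseteq> carrier M" "module_span A M S = carrier M"
    using assms(2) unfolding fin_gen_iff_span by blast
  show ?thesis unfolding noetherian_module_def
    using submodule_of_fin_span[OF assms(1) S(1,2)] S(3) by (auto simp: submodule_iff)
qed

lemma fin_gen_submodule:
  assumes "noetherian_module A M" "submodule H A M"
  shows "fin_gen A (M\<lparr>carrier := H\<rparr>)"
proof -
  interpret H: left_module A "M\<lparr>carrier := H\<rparr>" by (rule left_module_submodule) fact
  have sub: "submodule X A (M\<lparr>carrier := H\<rparr>) \<longleftrightarrow> submodule X A M \<and> X \<subseteq> H" for X
    using assms(2) unfolding H.submodule_iff submodule_iff by auto
  obtain S where S: "finite S" "S \<subseteq> H" "H = module_span A M S"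
    by (rule noetherian_moduleE[OF assms])
  then have "H \<subseteq> module_span A (M\<lparr>carrier := H\<rparr>) S"
    unfolding module_span_def[of A "M\<lparr>carrier := H\<rparr>"] sub using module_span_least by blast
  moreover have "module_span A (M\<lparr>carrier := H\<rparr>) S \<subseteq> H"
    using assms(2) S(2) sub by (intro module_span_least) auto
  ultimately show ?thesis
    unfolding H.fin_gen_iff_span using S by (intro exI[of _ S]) auto
qed

end

text \<open>
  The preimage of the span of the images of generators contains these generators, hence everything.
\<close>

lemma fin_gen_surj:
  assumes M: "left_module A M" and N: "left_module A N" and f: "f \<in> mod_hom A M N"
    and surj: "f ` carrier M = carrier N" and fg: "fin_gen A M"
  shows "fin_gen A N"
proof -
  interpret M: left_module A M by fact
  interpret N: left_module A N by fact
  obtain S where S: "finite S" "S \<subseteq> carrier M" "module_span A M S = carrier M"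
    using fg unfolding M.fin_gen_iff_span by blast
  have fS: "f ` S \<subseteq> carrier N" using S(2) mod_hom_closed[OF f] by auto
  let ?X = "module_span A N (f ` S)"
  have X: "submodule ?X A N" by (rule N.submodule_span) fact
  have "submodule {x \<in> carrier M. f x \<in> ?X} A M" by (rule submodule_vimage[OF M N f X])
  moreover have "S \<subseteq> {x \<in> carrier M. f x \<in> ?X}"
    using S(2) module_span_superset[of "f ` S" A N] by auto
  ultimately have "module_span A M S \<subseteq> {x \<in> carrier M. f x \<in> ?X}" by (rule module_span_least)
  then have "carrier N \<subseteq> ?X" unfolding S(3) using surj[symmetric] by auto
  moreover have "?X \<subseteq> carrier N" using X by (simp add: N.submodule_iff)
  ultimately show ?thesis unfolding N.fin_gen_iff_span using S(1) fS by blast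
qed

lemma fin_gen_inj:
  assumes M: "left_module A M" and N: "left_module A N" and f: "f \<in> mod_hom A M N"
    and inj: "inj_on f (carrier M)" and noeth: "noetherian_module A N"
  shows "fin_gen A M"
proof -
  have sub: "submodule (f ` carrier M) A N"
    by (rule submodule_image[OF M N f submodule_carrier[OF M]])
  obtain g where g: "g \<in> mod_hom A (N\<lparr>carrier := f ` carrier M\<rparr>) M"
    "\<And>x. x \<in> carrier M \<Longrightarrow> g (f x) = x"
    using mod_hom_inverse[OF M N f inj] by blast
  have "g ` carrier (N\<lparr>carrier := f ` carrier M\<rparr>) = carrier M"
    using g(2) by (simp add: image_image)
  then show ?thesis
    by (intro fin_gen_surj[OF left_module.left_module_submodule[OF N sub] M g(1)]
        left_module.fin_gen_submodule[OF N noeth sub])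
qed

lemma fin_gen_projective:
  assumes "fg_projective A P"
  shows "fin_gen A P"
proof -
  obtain n p \<phi> where P: "left_module A P" and db: "dual_basis A P n p \<phi>"
    using assms by (auto simp: fg_projective_iff)
  interpret left_module A P by fact
  have p: "p ` {..<n} \<subseteq> carrier P" using db by (auto simp: dual_basis_def)
  have sp: "submodule (module_span A P (p ` {..<n})) A P" by (rule submodule_span) fact
  have "x \<in> module_span A P (p ` {..<n})" if x: "x \<in> carrier P" for x
  proof -
    have "\<phi> j x \<odot>\<^bsub>P\<^esub> p j \<in> module_span A P (p ` {..<n})" if "j < n" for j
    proof -
      have "\<phi> j x \<in> carrier A"
        using db that x mod_hom_closed[of "\<phi> j" A P "regular_module A"] by (auto simp: dual_basis_def)
      moreover have "p j \<in> module_span A P (p ` {..<n})"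
        using that module_span_superset[of "p ` {..<n}" A P] by auto
      ultimately show ?thesis using sp unfolding submodule_iff by blast
    qed
    then have "(\<Oplus>\<^bsub>P\<^esub>j\<in>{..<n}. \<phi> j x \<odot>\<^bsub>P\<^esub> p j) \<in> module_span A P (p ` {..<n})"
      by (intro submodule_finsum[OF sp]) auto
    then show ?thesis using db x by (simp add: dual_basis_def)
  qed
  then show ?thesis
    unfolding fin_gen_iff_span using p sp unfolding submodule_iff
    by (intro exI[of _ "p ` {..<n}"]) auto
qed

lemma free_cover:
  assumes M: "left_module A M" and "fin_gen A M"
  obtains n h where "h \<in> mod_hom A (free_module A n) M" "h ` carrier (free_module A n) = carrier M"
proof -
  interpret M: left_module A M by fact
  obtain S where "finite S" "S \<subseteq> carrier M" "module_span A M S = carrier M"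
    using assms(2) unfolding M.fin_gen_iff_span by blast
  then show ?thesis by (rule M.span_cover) (rule that)
qed

section \<open>Artin algebras are noetherian\<close>

lemma artinian_minimal_ideal:
  assumes "artinian R" "I0 \<in> C" "\<And>I. I \<in> C \<Longrightarrow> ideal I R"
  obtains I where "I \<in> C" "\<And>J. J \<in> C \<Longrightarrow> J \<subseteq> I \<Longrightarrow> J = I"
proof (rule ccontr)
  note minimal = that
  assume "\<not> thesis"
  have *: "\<exists>J. J \<in> C \<and> J \<subset> I" if "I \<in> C" for I
    using \<open>\<not> thesis\<close> \<open>I \<in> C\<close> minimal by (metis psubsetI)
  obtain f where f: "\<And>n::nat. f n \<in> C \<and> f (Suc n) \<subset> f n"
    using dependent_nat_choice[of "\<lambda>_ I. I \<in> C" "\<lambda>_ I J. J \<subset> I"] assms(2) * by blast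
  then have "\<forall>n. ideal (f n) R \<and> f (Suc n) \<subseteq> f n" using assms(3) by blast
  then obtain N where "\<forall>n\<ge>N. f n = f N"
    using assms(1)[unfolded artinian_def, rule_format, of f] by metis
  then have "f (Suc N) = f N" by (blast intro: le_SucI)
  with f show False by blast
qed

lemma (in cring) ideal_iff_submodule: "ideal I R \<longleftrightarrow> submodule I R (regular_module R)"
proof -
  interpret reg: left_module R "regular_module R" by (rule left_module_regular) (rule ring_axioms)
  show ?thesis
  proof
    assume "ideal I R"
    then interpret ideal I R .
    show "submodule I R (regular_module R)"
      unfolding reg.submodule_iff using additive_subgroup.zero_closed[OF additive_subgroup_axioms]
      by (auto intro: I_l_closed)
  next
    assume I: "submodule I R (regular_module R)"
    have sub: "subgroup I (add_monoid R)"
      using I unfolding submodule_def subgroup_def by (simp add: regular_module_def a_inv_def m_inv_def)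
    show "ideal I R"
    proof (rule idealI[OF ring_axioms sub])
      fix a x assume "a \<in> I" "x \<in> carrier R"
      then have "x \<otimes> a \<in> I" "a \<in> carrier R" using I unfolding reg.submodule_iff by auto
      then show "x \<otimes> a \<in> I" "a \<otimes> x \<in> I" using \<open>x \<in> carrier R\<close> by (simp_all add: m_comm)
    qed
  qed
qed

text \<open>
  Let \<open>I\<close> be minimal among the ideals that are not finitely generated.  For each scalar \<open>x\<close> either
  \<open>x I = I\<close>, or \<open>x I\<close> is finitely generated; the latter \<open>x\<close> form an ideal \<open>p\<close>, and every other
  scalar is invertible modulo \<open>p\<close>.  If \<open>p I\<close> is smaller than \<open>I\<close>, then \<open>I / p I\<close> is a vector space
  over the field \<open>R / p\<close> and has a hyperplane; its preimage is finitely generated, hence so is \<open>I\<close>.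
  If \<open>p I = I\<close>, take \<open>J\<close> minimal with \<open>J I \<noteq> 0\<close> and \<open>x \<in> J\<close> with \<open>x I \<noteq> 0\<close>.  Then \<open>x p = J\<close>, so
  \<open>x = x a\<close> for some \<open>a \<in> p\<close>, and \<open>x I = x (1 - a) I = 0\<close>.
\<close>

theorem (in cring) artinian_imp_noetherian:
  assumes art: "artinian R"
  shows "left_noetherian R"
proof (rule ccontr)
  let ?S = "\<lambda>I. submodule I R (regular_module R)"
  let ?span = "module_span R (regular_module R)"
  define fg where "fg I \<longleftrightarrow> (\<exists>S. finite S \<and> S \<subseteq> I \<and> I = ?span S)" for I
  interpret reg: left_module R "regular_module R" by (rule left_module_regular) (rule ring_axioms)
  have S_iff: "?S I \<longleftrightarrow> I \<subseteq> carrier R \<and> \<zero> \<in> I \<and> (\<forall>x\<in>I. \<forall>y\<in>I. x \<oplus> y \<in> I) \<and>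
      (\<forall>a\<in>carrier R. \<forall>x\<in>I. a \<otimes> x \<in> I)" for I
    unfolding reg.submodule_iff by simp
  have SD: "I \<subseteq> carrier R" "\<zero> \<in> I" "\<And>x y. x \<in> I \<Longrightarrow> y \<in> I \<Longrightarrow> x \<oplus> y \<in> I"
    "\<And>a x. a \<in> carrier R \<Longrightarrow> x \<in> I \<Longrightarrow> a \<otimes> x \<in> I" "\<And>x. x \<in> I \<Longrightarrow> x \<in> carrier R" if "?S I" for I
    using that unfolding S_iff by blast+
  have min: "\<exists>I. I \<in> C \<and> (\<forall>J. J \<in> C \<and> J \<subseteq> I \<longrightarrow> J = I)"
    if "I0 \<in> C" "\<And>I. I \<in> C \<Longrightarrow> ?S I" for I0 C
    using artinian_minimal_ideal[OF art that(1)] that(2) ideal_iff_submodule by metis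
  assume "\<not> left_noetherian R"
  then obtain I0 where "?S I0" "\<not> fg I0" unfolding noetherian_module_def fg_def by blast
  then have I0: "I0 \<in> {I. ?S I \<and> \<not> fg I}" by simp
  obtain I where I_in: "I \<in> {I. ?S I \<and> \<not> fg I}"
    and I_min': "\<forall>J. J \<in> {I. ?S I \<and> \<not> fg I} \<and> J \<subseteq> I \<longrightarrow> J = I"
    using min[OF I0] by auto
  then have I: "?S I" "\<not> fg I" by auto
  have I_min: "fg J" if "?S J" "J \<subseteq> I" "J \<noteq> I" for J
    using I_min'[rule_format, of J] that by auto
  note IC = SD(5)[OF I(1)]
  have fgI: "fg I" if S: "finite S" "S \<subseteq> I" and least: "\<And>J. ?S J \<Longrightarrow> S \<subseteq> J \<Longrightarrow> I \<subseteq> J" for S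
  proof -
    have "?S (?span S)" using S(2) IC by (intro reg.submodule_span) auto
    then have "I \<subseteq> ?span S" using module_span_superset by (rule least)
    then show ?thesis using S module_span_least[OF I(1) S(2)] unfolding fg_def by blast
  qed
  have I_nz: "\<exists>i\<in>I. i \<noteq> \<zero>"
  proof (rule ccontr)
    assume "\<not> (\<exists>i\<in>I. i \<noteq> \<zero>)"
    then have "I \<subseteq> {\<zero>}" by blast
    then have "fg I" by (intro fgI[of "{}"]) (auto simp: S_iff)
    with I(2) show False ..
  qed
  define m where "m x = (\<lambda>i. x \<otimes> i) ` I" for x
  have mult_sub: "?S ((\<lambda>i. x \<otimes> i) ` J)" if J: "?S J" and x: "x \<in> carrier R" for J x
  proof -
    have "(\<lambda>i\<in>carrier R. x \<otimes> i) \<in> functionals R (regular_module R)"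
      using mod_hom_restrictI[OF reg.left_module_axioms, of "\<lambda>i. x \<otimes> i" "regular_module R"] x
      by (simp add: r_distr m_lcomm)
    from submodule_image[OF reg.left_module_axioms reg.left_module_axioms this J]
    have "?S ((\<lambda>i\<in>carrier R. x \<otimes> i) ` J)" .
    moreover have "(\<lambda>i\<in>carrier R. x \<otimes> i) ` J = (\<lambda>i. x \<otimes> i) ` J"
      by (rule image_cong) (use SD(5)[OF J] in auto)
    ultimately show ?thesis by simp
  qed
  have m_sub: "?S (m x)" "m x \<subseteq> I" if x: "x \<in> carrier R" for x
    using mult_sub[OF I(1) x] SD(4)[OF I(1) x] by (auto simp: m_def)
  define p where "p = {x \<in> carrier R. m x \<noteq> I}"
  have notp: "m x = I" if "x \<in> carrier R" "x \<notin> p" for x using that by (simp add: p_def)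
  have div: "\<exists>j\<in>I. x \<otimes> j = i" if "x \<in> carrier R" "x \<notin> p" "i \<in> I" for x i
  proof -
    have "i \<in> m x" using notp that by simp
    then show ?thesis by (auto simp: m_def)
  qed
  have one_p: "\<one> \<notin> p" using IC by (auto simp: p_def m_def)
  have zero_p: "\<zero> \<in> p" using I_nz IC by (auto simp: p_def m_def)
  have add_p: "x \<oplus> y \<in> p" if x: "x \<in> p" and y: "y \<in> p" for x y
  proof (rule ccontr)
    assume np: "x \<oplus> y \<notin> p"
    have c: "x \<in> carrier R" "y \<in> carrier R" using x y by (auto simp: p_def)
    have fgm: "fg (m x)" "fg (m y)"
      using x y by (intro I_min m_sub c; simp add: p_def)+
    then obtain S T where S: "finite S" "S \<subseteq> m x" "m x = ?span S"
      and T: "finite T" "T \<subseteq> m y" "m y = ?span T"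
      unfolding fg_def by blast
    have "fg I"
    proof (rule fgI[of "S \<union> T"])
      fix J assume J: "?S J" "S \<union> T \<subseteq> J"
      then have "?span S \<subseteq> J" "?span T \<subseteq> J" by (simp_all add: module_span_least)
      then have sub: "m x \<subseteq> J" "m y \<subseteq> J" unfolding S(3)[symmetric] T(3)[symmetric] .
      show "I \<subseteq> J"
      proof
        fix i assume "i \<in> I"
        then obtain j where j: "j \<in> I" "(x \<oplus> y) \<otimes> j = i" using div[OF _ np] c by blast
        have "x \<otimes> j \<oplus> y \<otimes> j \<in> J" using sub j(1) SD(3)[OF J(1)] unfolding m_def by blast
        then show "i \<in> J" using j c IC by (simp add: l_distr)
      qed
    next
      show "S \<union> T \<subseteq> I" using S(2) T(2) m_sub(2)[OF c(1)] m_sub(2)[OF c(2)] by blast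
    qed (use S T in simp)
    with I(2) show False ..
  qed
  have mult_p: "r \<otimes> x \<in> p" if r: "r \<in> carrier R" and x: "x \<in> p" for r x
  proof (rule ccontr)
    assume np: "r \<otimes> x \<notin> p"
    have c: "x \<in> carrier R" using x by (simp add: p_def)
    have "I \<subseteq> m x"
    proof
      fix i assume "i \<in> I"
      then obtain j where j: "j \<in> I" "(r \<otimes> x) \<otimes> j = i" using div[OF _ np] c r by blast
      then have "x \<otimes> (r \<otimes> j) = i" using c r IC by (metis m_assoc m_comm)
      then show "i \<in> m x" using SD(4)[OF I(1) r j(1)] by (auto simp: m_def)
    qed
    then show False using m_sub(2)[OF c] x by (auto simp: p_def)
  qed
  have p_sub: "?S p" unfolding S_iff using zero_p add_p mult_p by (auto simp: p_def)
  have mult_np: "x \<otimes> y \<notin> p" if x: "x \<in> carrier R" "x \<notin> p" and y: "y \<in> carrier R" "y \<notin> p" for x y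
  proof -
    have "I \<subseteq> m (x \<otimes> y)"
    proof
      fix i assume "i \<in> I"
      then obtain j where j: "j \<in> I" "x \<otimes> j = i" using div[OF x] by blast
      obtain l where l: "l \<in> I" "y \<otimes> l = j" using div[OF y j(1)] by blast
      then have "(x \<otimes> y) \<otimes> l = i" using j x y IC by (simp add: m_assoc)
      then show "i \<in> m (x \<otimes> y)" using l by (auto simp: m_def)
    qed
    then show ?thesis using m_sub(2)[of "x \<otimes> y"] x y by (auto simp: p_def)
  qed
  \<comment> \<open>The chain of principal ideals generated by the powers of \<open>x\<close> stops: \<open>x\<^sup>N (1 - x r) = 0\<close>.\<close>
  have inv_p: "\<exists>r\<in>carrier R. \<one> \<ominus> x \<otimes> r \<in> p" if x: "x \<in> carrier R" "x \<notin> p" for x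
  proof -
    define f where "f n = (\<lambda>r. x [^] n \<otimes> r) ` carrier R" for n :: nat
    have "?S (f n)" for n
      unfolding f_def using x by (intro mult_sub submodule_carrier[OF reg.left_module_axioms, simplified]) auto
    moreover have "f (Suc n) \<subseteq> f n" for n
    proof
      fix u assume "u \<in> f (Suc n)"
      then obtain a where "a \<in> carrier R" "u = x [^] Suc n \<otimes> a" by (auto simp: f_def)
      then show "u \<in> f n" unfolding f_def using x
        by (intro rev_image_eqI[of "x \<otimes> a"]) (auto simp: m_assoc)
    qed
    ultimately have "\<forall>n. ideal (f n) R \<and> f (Suc n) \<subseteq> f n" by (simp add: ideal_iff_submodule)
    then obtain N where N: "\<forall>n\<ge>N. f n = f N"
      using art[unfolded artinian_def, rule_format, of f] by metis
    have "x [^] N \<in> f N" unfolding f_def using x by (intro rev_image_eqI[of \<one>]) auto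
    moreover have "f (Suc N) = f N" using N by (blast intro: le_SucI)
    ultimately have "x [^] N \<in> f (Suc N)" by blast
    then obtain r where r: "r \<in> carrier R" "x [^] N = x [^] Suc N \<otimes> r" by (auto simp: f_def)
    have "x [^] N \<otimes> (\<one> \<ominus> x \<otimes> r) = \<zero>"
    proof -
      have "x [^] N \<otimes> (\<one> \<ominus> x \<otimes> r) = x [^] N \<ominus> x [^] Suc N \<otimes> r"
        using r(1) x by (simp add: a_minus_def r_distr r_minus m_assoc)
      then show ?thesis unfolding r(2)[symmetric] using x by (simp add: diff_eq_zero_iff)
    qed
    moreover have "x [^] n \<notin> p" for n :: nat
      by (induction n) (use one_p mult_np x in auto)
    ultimately have "\<one> \<ominus> x \<otimes> r \<in> p"
      using mult_np[of "x [^] N" "\<one> \<ominus> x \<otimes> r"] zero_p x r(1) by auto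
    with r(1) show ?thesis by blast
  qed
  let ?g = "{a \<otimes> i | a i. a \<in> p \<and> i \<in> I}"
  define T where "T = module_span R (regular_module R) ?g"
  have pc: "a \<in> carrier R" if "a \<in> p" for a using that by (simp add: p_def)
  have T: "?S T" unfolding T_def by (rule reg.submodule_span) (use pc IC in auto)
  have "?g \<subseteq> T" unfolding T_def by (rule module_span_superset)
  then have T_gen: "a \<otimes> i \<in> T" if "a \<in> p" "i \<in> I" for a i
    using that by auto
  have T_least: "T \<subseteq> J" if "?S J" "\<And>a i. a \<in> p \<Longrightarrow> i \<in> I \<Longrightarrow> a \<otimes> i \<in> J" for J
    unfolding T_def using that by (intro module_span_least) auto
  have TI: "T \<subseteq> I" using SD(4)[OF I(1)] pc by (intro T_least I(1)) auto
  show False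
  proof (cases "T = I")
    case False
    then obtain v where v: "v \<in> I" "v \<notin> T" using TI by blast
    \<comment> \<open>A maximal element of \<open>AA\<close> is the preimage of a hyperplane of \<open>I / p I\<close> complementary to \<open>v\<close>.\<close>
    define AA where "AA = {J. ?S J \<and> T \<subseteq> J \<and> J \<subseteq> I \<and> v \<notin> J}"
    have "\<exists>J\<in>AA. \<forall>X\<in>AA. J \<subseteq> X \<longrightarrow> X = J"
    proof (rule subset_Zorn)
      fix C assume C: "subset.chain AA C"
      show "\<exists>U\<in>AA. \<forall>X\<in>C. X \<subseteq> U"
      proof (cases "C = {}")
        case True
        then show ?thesis using T TI v by (auto simp: AA_def)
      next
        case nonempty: False
        have CA: "X \<in> AA" if "X \<in> C" for X using C that by (auto simp: subset.chain_def)
        have tot: "X \<subseteq> Y \<or> Y \<subseteq> X" if "X \<in> C" "Y \<in> C" for X Y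
          using C that by (auto simp: subset.chain_def)
        have "?S (\<Union>C)" unfolding S_iff
        proof (intro conjI ballI)
          show "\<Union>C \<subseteq> carrier R" using CA SD(1) by (fastforce simp: AA_def)
          show "\<zero> \<in> \<Union>C" using nonempty CA SD(2) by (fastforce simp: AA_def)
        next
          fix x y assume "x \<in> \<Union>C" "y \<in> \<Union>C"
          then obtain X where "X \<in> C" "x \<in> X" "y \<in> X" using tot by blast
          then show "x \<oplus> y \<in> \<Union>C" using CA[of X] SD(3)[of X] by (auto simp: AA_def)
        next
          fix a x assume "a \<in> carrier R" "x \<in> \<Union>C"
          then show "a \<otimes> x \<in> \<Union>C" using CA SD(4) by (fastforce simp: AA_def)
        qed
        then have "\<Union>C \<in> AA" using nonempty CA by (fastforce simp: AA_def)
        then show ?thesis by blast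
      qed
    qed
    then obtain J where J: "J \<in> AA" and J_max: "\<And>X. X \<in> AA \<Longrightarrow> J \<subseteq> X \<Longrightarrow> X = J" by blast
    have Js: "?S J" "T \<subseteq> J" "J \<subseteq> I" "v \<notin> J" using J by (auto simp: AA_def)
    note JC = SD(5)[OF Js(1)]
    have "fg J" using I_min[OF Js(1,3)] Js(4) v(1) by blast
    then obtain S where S: "finite S" "S \<subseteq> J" "J = ?span S" unfolding fg_def by blast
    have "fg I"
    proof (rule fgI[of "insert v S"])
      fix X assume X: "?S X" "insert v S \<subseteq> X"
      then have "?span S \<subseteq> X" by (intro module_span_least) auto
      then have JX: "J \<subseteq> X" unfolding S(3)[symmetric] .
      show "I \<subseteq> X"
      proof (rule subsetI, rule ccontr)
        fix w assume w: "w \<in> I" and wX: "w \<notin> X"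
        note wC = IC[OF w]
        let ?K = "?span (insert w J)"
        have K: "?S ?K" using wC SD(1)[OF Js(1)] by (intro reg.submodule_span) simp
        have JK: "J \<subseteq> ?K" and wK: "w \<in> ?K"
          using module_span_superset[of "insert w J" R "regular_module R"] by auto
        have "?K \<subseteq> I" using Js(3) w by (intro module_span_least[OF I(1)]) simp
        moreover have "?K \<noteq> J" using wK wX JX by blast
        ultimately have "v \<in> ?K" using J_max[of ?K] K JK Js(2) unfolding AA_def by blast
        then obtain r j where rj: "r \<in> carrier R" "j \<in> ?span J" "v = r \<otimes> w \<oplus> j"
          using reg.span_insert[of w J v] wC SD(1)[OF Js(1)] by auto
        have "?span J \<subseteq> J" by (rule module_span_least[OF Js(1)]) simp
        then have jr: "j \<in> J" "r \<in> carrier R" "v = j \<oplus> r \<otimes> w"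
          using rj wC JC by (auto simp: a_comm)
        note jC = JC[OF jr(1)]
        have "r \<notin> p"
        proof
          assume "r \<in> p"
          then have "r \<otimes> w \<in> J" using T_gen w Js(2) by blast
          then show False using SD(3)[OF Js(1)] jr Js(4) by blast
        qed
        then obtain s where s: "s \<in> carrier R" "\<one> \<ominus> r \<otimes> s \<in> p" using inv_p jr(2) by blast
        \<comment> \<open>\<open>v = j + r w\<close> and \<open>r s = 1\<close> modulo \<open>p\<close>, so \<open>w = s (v - j)\<close> modulo \<open>p I\<close>.\<close>
        have "(\<one> \<ominus> r \<otimes> s) \<otimes> w \<in> X" using T_gen[OF s(2) w] Js(2) JX by blast
        moreover have "s \<otimes> v \<in> X" using X s(1) SD(4)[OF X(1)] by blast
        moreover have "(\<ominus> s) \<otimes> j \<in> X" using JX jr(1) s(1) SD(4)[OF X(1)] by blast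
        ultimately have "(\<one> \<ominus> r \<otimes> s) \<otimes> w \<oplus> (s \<otimes> v \<oplus> (\<ominus> s) \<otimes> j) \<in> X"
          using SD(3)[OF X(1)] by blast
        moreover have "(\<one> \<ominus> r \<otimes> s) \<otimes> w \<oplus> (s \<otimes> v \<oplus> (\<ominus> s) \<otimes> j) = w"
          using s(1) jr(2,3) jC wC by algebra
        ultimately show False using wX by simp
      qed
    next
      show "insert v S \<subseteq> I" using S(2) Js(3) v(1) by blast
    qed (use S in simp)
    with I(2) show False ..
  next
    case True
    define CC where "CC = {J. ?S J \<and> (\<exists>x\<in>J. \<exists>i\<in>I. x \<otimes> i \<noteq> \<zero>)}"
    obtain i0 where "i0 \<in> I" "i0 \<noteq> \<zero>" using I_nz by blast
    then have "\<one> \<otimes> i0 \<noteq> \<zero>" using IC by simp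
    moreover have "?S (carrier R)" by (simp add: S_iff)
    ultimately have "carrier R \<in> CC"
      using \<open>i0 \<in> I\<close> one_closed unfolding CC_def by blast
    moreover have "?S X" if "X \<in> CC" for X using that by (simp add: CC_def)
    ultimately obtain J where J: "J \<in> CC" and J_min: "X \<in> CC \<Longrightarrow> X \<subseteq> J \<Longrightarrow> X = J" for X
      using min[of "carrier R" CC] by metis
    then obtain x i where x: "x \<in> J" "i \<in> I" "x \<otimes> i \<noteq> \<zero>" and Js: "?S J" by (auto simp: CC_def)
    note xC = SD(5)[OF Js x(1)]
    let ?X = "(\<lambda>a. x \<otimes> a) ` p"
    have X: "?S ?X" by (rule mult_sub[OF p_sub xC])
    have XJ: "?X \<subseteq> J" using SD(4)[OF Js _ x(1)] pc xC by (auto simp: m_comm)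
    have "?X \<in> CC"
    proof (rule ccontr)
      assume "?X \<notin> CC"
      then have z: "x \<otimes> a \<otimes> j = \<zero>" if "a \<in> p" "j \<in> I" for a j
        using X that unfolding CC_def by blast
      have "?S {j \<in> carrier R. x \<otimes> j = \<zero>}"
        unfolding S_iff using xC by (auto simp: r_distr m_lcomm)
      moreover have "a \<otimes> j \<in> {j \<in> carrier R. x \<otimes> j = \<zero>}" if "a \<in> p" "j \<in> I" for a j
        using z[OF that] pc[OF that(1)] IC[OF that(2)] xC by (simp add: m_assoc)
      ultimately have "T \<subseteq> {j \<in> carrier R. x \<otimes> j = \<zero>}" by (rule T_least)
      then show False using True x by blast
    qed
    then have "x \<in> ?X" using J_min[OF _ XJ] x(1) by simp
    then obtain a where a: "a \<in> p" "x = x \<otimes> a" by blast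
    note aC = pc[OF a(1)]
    have "\<one> \<ominus> a \<notin> p"
    proof
      assume "\<one> \<ominus> a \<in> p"
      then have "(\<one> \<ominus> a) \<oplus> a \<in> p" using a(1) by (rule add_p)
      moreover have "(\<one> \<ominus> a) \<oplus> a = \<one>" using aC by (simp add: a_minus_def a_assoc l_neg)
      ultimately show False using one_p by simp
    qed
    then obtain j where j: "j \<in> I" "(\<one> \<ominus> a) \<otimes> j = i" using div[of "\<one> \<ominus> a", OF _ _ x(2)] aC by auto
    note jC = IC[OF j(1)]
    have "x \<otimes> i = x \<otimes> ((\<one> \<ominus> a) \<otimes> j)" using j by simp
    also have "\<dots> = (x \<ominus> x \<otimes> a) \<otimes> j"
      using xC aC jC by (simp add: a_minus_def l_distr r_distr l_minus r_minus m_assoc)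
    also have "x \<ominus> x \<otimes> a = \<zero>" unfolding a(2)[symmetric] using xC by (simp add: diff_eq_zero_iff)
    also have "\<zero> \<otimes> j = \<zero>" using jC by simp
    finally show False using x(3) by simp
  qed
qed

text \<open>
  If the scalars of \<open>k\<close> act through multiplications of \<open>B\<close>, then every left ideal of \<open>B\<close> is a
  \<open>k\<close>-submodule, and its generators over \<open>k\<close> generate it over \<open>B\<close>.
\<close>

lemma noetherian_over_algebra:
  assumes K: "left_module k A'" "noetherian_module k A'" and B: "ring B"
    and eq: "carrier A' = carrier B" "\<And>x y. x \<oplus>\<^bsub>A'\<^esub> y = x \<oplus>\<^bsub>B\<^esub> y" "\<zero>\<^bsub>A'\<^esub> = \<zero>\<^bsub>B\<^esub>"
    and scalar: "\<And>c x. c \<in> carrier k \<Longrightarrow> x \<in> carrier B \<Longrightarrow>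
      \<exists>b\<in>carrier B. c \<odot>\<^bsub>A'\<^esub> x = b \<otimes>\<^bsub>B\<^esub> x"
  shows "left_noetherian B"
  unfolding noetherian_module_def
proof (intro allI impI)
  interpret K: left_module k A' by fact
  interpret reg: left_module B "regular_module B" by (rule left_module_regular) fact
  have sub: "submodule H k A'" if "submodule H B (regular_module B)" for H
    unfolding K.submodule_iff
  proof (intro conjI ballI)
    fix c x assume cx: "c \<in> carrier k" "x \<in> H"
    have H: "H \<subseteq> carrier B" "\<And>b x. b \<in> carrier B \<Longrightarrow> x \<in> H \<Longrightarrow> b \<otimes>\<^bsub>B\<^esub> x \<in> H"
      using that unfolding reg.submodule_iff by auto
    then obtain b where "b \<in> carrier B" "c \<odot>\<^bsub>A'\<^esub> x = b \<otimes>\<^bsub>B\<^esub> x" using scalar cx by blast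
    then show "c \<odot>\<^bsub>A'\<^esub> x \<in> H" using H(2) cx by simp
  qed (use that eq in \<open>auto simp: reg.submodule_iff\<close>)
  fix H assume H: "submodule H B (regular_module B)"
  obtain S where S: "finite S" "S \<subseteq> H" "H = module_span k A' S"
    by (rule noetherian_moduleE[OF K(2) sub[OF H]])
  have "S \<subseteq> carrier (regular_module B)" using S(2) H unfolding reg.submodule_iff by blast
  then have "submodule (module_span B (regular_module B) S) B (regular_module B)"
    by (rule reg.submodule_span)
  then have "H \<subseteq> module_span B (regular_module B) S"
    unfolding S(3) by (intro module_span_least sub module_span_superset)
  moreover have "module_span B (regular_module B) S \<subseteq> H" by (rule module_span_least[OF H S(2)])
  ultimately show "\<exists>S. finite S \<and> S \<subseteq> H \<and> H = module_span B (regular_module B) S"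
    using S(1,2) by blast
qed

text \<open>
  \<open>A\<close> is a finitely generated module over the noetherian ring \<open>k\<close>, and both left and right ideals
  are \<open>k\<close>-submodules, because \<open>c x = (c 1) x = x (c 1)\<close>.
\<close>

lemma artin_algebra_noetherian:
  assumes "artin_algebra k A"
  shows "left_noetherian A"
    "left_noetherian (op_ring A)"
proof -
  interpret artin_algebra k A by fact
  have A: "ring A" by (rule A.ring_axioms)
  have K: "left_module k A"
    by (intro left_module.intro left_module_axioms.intro R.ring_axioms M.abelian_group_axioms)
      (auto simp: smult_l_distr smult_r_distr smult_assoc1)
  have N: "noetherian_module k A"
    by (rule left_module.noetherian_of_fin_gen[OF K R.artinian_imp_noetherian[OF artinian_base]
          fin_gen_over_base])
  show "left_noetherian A"
  proof (rule noetherian_over_algebra[OF K N A])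
    fix c x assume "c \<in> carrier k" "x \<in> carrier A"
    then show "\<exists>b\<in>carrier A. c \<odot>\<^bsub>A\<^esub> x = b \<otimes>\<^bsub>A\<^esub> x"
      using smult_mult_left[of c "\<one>\<^bsub>A\<^esub>" x] by (intro bexI[of _ "c \<odot>\<^bsub>A\<^esub> \<one>\<^bsub>A\<^esub>"]) auto
  qed auto
  show "left_noetherian (op_ring A)"
  proof (rule noetherian_over_algebra[OF K N ring_op_ring[OF A]])
    fix c x assume "c \<in> carrier k" "x \<in> carrier (op_ring A)"
    then show "\<exists>b\<in>carrier (op_ring A). c \<odot>\<^bsub>A\<^esub> x = b \<otimes>\<^bsub>op_ring A\<^esub> x"
      using smult_mult_right[of c x "\<one>\<^bsub>A\<^esub>"] by (intro bexI[of _ "c \<odot>\<^bsub>A\<^esub> \<one>\<^bsub>A\<^esub>"]) auto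
  qed auto
qed

section \<open>Projective resolutions\<close>

lemma projective_resolutionD:
  assumes "projective_resolution A M P d e"
  shows "fg_projective A (P n)" "left_module A (P n)" "d n \<in> mod_hom A (P (Suc n)) (P n)"
    "e \<in> mod_hom A (P 0) M" "e ` carrier (P 0) = carrier M"
    "d 0 ` carrier (P (Suc 0)) = hom_kernel (P 0) M e"
    "d (Suc n) ` carrier (P (Suc (Suc n))) = hom_kernel (P (Suc n)) (P n) (d n)"
    "x \<in> carrier (P (Suc 0)) \<Longrightarrow> e (d 0 x) = \<zero>\<^bsub>M\<^esub>"
    "y \<in> carrier (P (Suc (Suc n))) \<Longrightarrow> d n (d (Suc n) y) = \<zero>\<^bsub>P n\<^esub>"
proof -
  note r = assms[unfolded projective_resolution_def]
  show "fg_projective A (P n)" using r by simp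
  then show "left_module A (P n)" by (rule fg_projective_module)
  show "d n \<in> mod_hom A (P (Suc n)) (P n)" "e \<in> mod_hom A (P 0) M" "e ` carrier (P 0) = carrier M"
    using r by simp_all
  show k0: "d 0 ` carrier (P (Suc 0)) = hom_kernel (P 0) M e" using r by simp
  show k: "d (Suc n) ` carrier (P (Suc (Suc n))) = hom_kernel (P (Suc n)) (P n) (d n)" using r by simp
  show "e (d 0 x) = \<zero>\<^bsub>M\<^esub>" if "x \<in> carrier (P (Suc 0))"
  proof -
    have "d 0 x \<in> hom_kernel (P 0) M e" unfolding k0[symmetric] using that by (rule imageI)
    then show ?thesis by (simp add: hom_kernel_def)
  qed
  show "d n (d (Suc n) y) = \<zero>\<^bsub>P n\<^esub>" if "y \<in> carrier (P (Suc (Suc n)))"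
  proof -
    have "d (Suc n) y \<in> hom_kernel (P (Suc n)) (P n) (d n)" unfolding k[symmetric] using that by (rule imageI)
    then show ?thesis by (simp add: hom_kernel_def)
  qed
qed

lemma free_cover_kernel:
  assumes A: "left_noetherian A"
    and M: "left_module A M" "fin_gen A M" and N: "left_module A N" and f: "f \<in> mod_hom A M N"
  obtains n h where "h \<in> mod_hom A (free_module A n) M"
    "h ` carrier (free_module A n) = hom_kernel M N f"
proof -
  let ?K = "M\<lparr>carrier := hom_kernel M N f\<rparr>"
  have sub: "submodule (hom_kernel M N f) A M" by (rule submodule_kernel[OF M(1) N f])
  have "noetherian_module A M" by (rule left_module.noetherian_of_fin_gen[OF M(1) A M(2)])
  then have K: "fin_gen A ?K" using left_module.fin_gen_submodule[OF M(1)] sub by blast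
  obtain n h where h: "h \<in> mod_hom A (free_module A n) ?K" "h ` carrier (free_module A n) = carrier ?K"
    by (rule free_cover[OF left_module.left_module_submodule[OF M(1) sub] K])
  have "h \<in> mod_hom A (free_module A n) M"
    using h(1) by (rule mod_hom_codomain_mono) (auto simp: hom_kernel_def)
  with h(2) show ?thesis using that by simp
qed

text \<open>
  Kernels of maps between finitely generated modules are finitely generated, so covering them by free
  modules can be repeated forever.
\<close>

lemma projective_resolution_exists:
  assumes A: "left_noetherian A"
    and M: "left_module A M" "fin_gen A M"
  obtains P :: "nat \<Rightarrow> ('a, nat \<Rightarrow> 'a) module" and d e
  where "projective_resolution (A :: ('a, 'x) ring_scheme) M P d e"
proof -
  interpret M: left_module A M by fact
  note ring = M.R.ring_axioms
  have F: "left_module A (free_module A n)" "fin_gen A (free_module A n)" for n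
    by (intro left_module_free fin_gen_projective fg_projective_free ring)+
  obtain m0 e where e: "e \<in> mod_hom A (free_module A m0) M" "e ` carrier (free_module A m0) = carrier M"
    by (rule free_cover[OF M])
  \<comment> \<open>The state \<open>(m', m, d)\<close> of the recursion is a map \<open>d\<close> from \<open>A\<^sup>m\<^sup>'\<close> to \<open>A\<^sup>m\<close>.\<close>
  let ?I = "\<lambda>k::nat. \<lambda>(m', m, d). d \<in> mod_hom A (free_module A m') (free_module A m) \<and>
    (k = 0 \<longrightarrow> m = m0 \<and> d ` carrier (free_module A m') = hom_kernel (free_module A m0) M e)"
  let ?Q = "\<lambda>k::nat. \<lambda>(m', m, d) (n', n, d'). n = m' \<and>
    d' ` carrier (free_module A n') = hom_kernel (free_module A m') (free_module A m) d"
  have "\<exists>f. \<forall>k. ?I k (f k) \<and> ?Q k (f k) (f (Suc k))"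
  proof (rule dependent_nat_choice)
    obtain n d where "d \<in> mod_hom A (free_module A n) (free_module A m0)"
      "d ` carrier (free_module A n) = hom_kernel (free_module A m0) M e"
      by (rule free_cover_kernel[OF A F M(1) e(1)])
    then show "\<exists>x. ?I 0 x" by (intro exI[of _ "(n, m0, d)"]) simp
  next
    fix x k assume "?I k x"
    then obtain m' m d where x: "x = (m', m, d)" and d: "d \<in> mod_hom A (free_module A m') (free_module A m)"
      by (cases x) auto
    obtain n d' where "d' \<in> mod_hom A (free_module A n) (free_module A m')"
      "d' ` carrier (free_module A n) = hom_kernel (free_module A m') (free_module A m) d"
      by (rule free_cover_kernel[OF A F F(1) d])
    then show "\<exists>y. ?I (Suc k) y \<and> ?Q k x y" by (intro exI[of _ "(n, m', d')"]) (simp add: x)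
  qed
  then obtain f where "\<forall>k. ?I k (f k) \<and> ?Q k (f k) (f (Suc k))" ..
  then have f: "?I k (f k)" "?Q k (f k) (f (Suc k))" for k by simp_all
  define t where "t k = fst (snd (f k))" for k
  define d where "d k = snd (snd (f k))" for k
  have I: "d k \<in> mod_hom A (free_module A (fst (f k))) (free_module A (t k)) \<and>
      (k = 0 \<longrightarrow> t k = m0 \<and> d k ` carrier (free_module A (fst (f k))) = hom_kernel (free_module A m0) M e)" for k
    using f(1)[of k] unfolding case_prod_beta t_def d_def .
  have Q: "t (Suc k) = fst (f k) \<and> d (Suc k) ` carrier (free_module A (fst (f (Suc k))))
      = hom_kernel (free_module A (fst (f k))) (free_module A (t k)) (d k)" for k
    using f(2)[of k] unfolding case_prod_beta t_def d_def .
  then have t: "fst (f k) = t (Suc k)" for k by metis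
  have t0: "t 0 = m0" using I[of 0] by blast
  have d: "d k \<in> mod_hom A (free_module A (t (Suc k))) (free_module A (t k))" for k
    using I[of k] unfolding t by blast
  have k0: "d 0 ` carrier (free_module A (t (Suc 0))) = hom_kernel (free_module A m0) M e"
    using I[of 0] unfolding t by blast
  have k: "d (Suc k) ` carrier (free_module A (t (Suc (Suc k))))
      = hom_kernel (free_module A (t (Suc k))) (free_module A (t k)) (d k)" for k
    using Q[of k] unfolding t by blast
  have "projective_resolution A M (\<lambda>k. free_module A (t k)) d e"
    unfolding projective_resolution_def using e d k k0 t0
    by (simp add: fg_projective_free[OF ring] del: free_module_simps)
  then show ?thesis by (rule that)
qed

text \<open>Vanishing of the cohomology of \<open>Hom(P, A)\<close> in positive degrees, in terms of elements.\<close>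

definition dual_acyclic ::
  "('a, 'x) ring_scheme \<Rightarrow> (nat \<Rightarrow> ('a, 'p, 'y) module_scheme) \<Rightarrow> (nat \<Rightarrow> 'p \<Rightarrow> 'p) \<Rightarrow> bool"
  where "dual_acyclic A P d \<longleftrightarrow>
    (\<forall>n. \<forall>f\<in>functionals A (P (Suc n)).
      (\<forall>x\<in>carrier (P (Suc (Suc n))). f (d (Suc n) x) = \<zero>\<^bsub>A\<^esub>) \<longrightarrow>
      (\<exists>g\<in>functionals A (P n). \<forall>x\<in>carrier (P (Suc n)). g (d n x) = f x))"

lemma dual_acyclicD:
  assumes "dual_acyclic A P d" "f \<in> functionals A (P (Suc n))"
    "\<And>x. x \<in> carrier (P (Suc (Suc n))) \<Longrightarrow> f (d (Suc n) x) = \<zero>\<^bsub>A\<^esub>"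
  obtains g where "g \<in> functionals A (P n)"
    "\<And>x. x \<in> carrier (P (Suc n)) \<Longrightarrow> g (d n x) = f x"
  using assms unfolding dual_acyclic_def by blast

text \<open>
  The comparison theorem.  Each component is a lift, by projectivity, of the previous component
  composed with \<open>d\<close>; the lift exists because that composite lands in the kernel, hence in the image,
  of the differential \<open>d'\<close>, and this is what the recursion carries along.
\<close>

lemma resolution_chain_map:
  assumes M: "left_module A M"
    and P: "projective_resolution A M P d e" and P': "projective_resolution A M P' d' e'"
  obtains \<phi> where "\<And>n. \<phi> n \<in> mod_hom A (P n) (P' n)"
    "\<And>x. x \<in> carrier (P 0) \<Longrightarrow> e' (\<phi> 0 x) = e x"
    "\<And>n x. x \<in> carrier (P (Suc n)) \<Longrightarrow> d' n (\<phi> (Suc n) x) = \<phi> n (d n x)"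
proof -
  note p = projective_resolutionD[OF P] and p' = projective_resolutionD[OF P']
  let ?I = "\<lambda>k u. u \<in> mod_hom A (P k) (P' k) \<and>
    (\<forall>y\<in>carrier (P (Suc k)). u (d k y) \<in> d' k ` carrier (P' (Suc k))) \<and>
    (k = 0 \<longrightarrow> (\<forall>x\<in>carrier (P 0). e' (u x) = e x))"
  let ?Q = "\<lambda>k u v. \<forall>x\<in>carrier (P (Suc k)). d' k (v x) = u (d k x)"
  have "\<exists>\<phi>. \<forall>k. ?I k (\<phi> k) \<and> ?Q k (\<phi> k) (\<phi> (Suc k))"
  proof (rule dependent_nat_choice)
    have im: "e ` carrier (P 0) \<subseteq> e' ` carrier (P' 0)" using p(5) p'(5) by simp
    obtain u where u: "u \<in> mod_hom A (P 0) (P' 0)" "\<And>x. x \<in> carrier (P 0) \<Longrightarrow> e' (u x) = e x"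
      by (rule projective_lift[OF p(1) p'(2) M p(4) p'(4) im]) blast
    have "u (d 0 y) \<in> d' 0 ` carrier (P' (Suc 0))" if "y \<in> carrier (P (Suc 0))" for y
      unfolding p'(6) hom_kernel_def
      using u p(8)[OF that] mod_hom_closed[OF u(1)] mod_hom_closed[OF p(3) that] by simp
    with u show "\<exists>u. ?I 0 u" by blast
  next
    fix u k assume u: "?I k u"
    have du: "compose (carrier (P (Suc k))) u (d k) \<in> mod_hom A (P (Suc k)) (P' k)"
      using u by (intro mod_hom_compose[OF p(2) p(3)]) blast
    have im: "compose (carrier (P (Suc k))) u (d k) ` carrier (P (Suc k)) \<subseteq> d' k ` carrier (P' (Suc k))"
      using u by (auto simp: compose_def)
    obtain v where v: "v \<in> mod_hom A (P (Suc k)) (P' (Suc k))"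
      "\<And>x. x \<in> carrier (P (Suc k)) \<Longrightarrow> d' k (v x) = compose (carrier (P (Suc k))) u (d k) x"
      by (rule projective_lift[OF p(1) p'(2) p'(2) du p'(3) im]) blast
    have Q: "?Q k u v" using v(2) by (simp add: compose_def)
    have "v (d (Suc k) y) \<in> d' (Suc k) ` carrier (P' (Suc (Suc k)))" if "y \<in> carrier (P (Suc (Suc k)))" for y
    proof -
      have dy: "d (Suc k) y \<in> carrier (P (Suc k))" by (rule mod_hom_closed[OF p(3) that])
      then have "d' k (v (d (Suc k) y)) = u (d k (d (Suc k) y))" using Q by blast
      also have "\<dots> = \<zero>\<^bsub>P' k\<^esub>" using u mod_hom_zero[OF p(2) p'(2)] by (simp add: p(9)[OF that])
      finally show ?thesis
        unfolding p'(7) hom_kernel_def using mod_hom_closed[OF v(1) dy] by simp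
    qed
    with v(1) Q show "\<exists>v. ?I (Suc k) v \<and> ?Q k u v" by blast
  qed
  then obtain \<phi> where "\<forall>k. ?I k (\<phi> k) \<and> ?Q k (\<phi> k) (\<phi> (Suc k))" ..
  then have "?I k (\<phi> k)" "?Q k (\<phi> k) (\<phi> (Suc k))" for k by blast+
  then show ?thesis by (intro that[of \<phi>]) simp_all
qed

text \<open>
  The next component of the homotopy is a lift of \<open>\<theta> - 1 - s d\<close> along \<open>d\<close>; it exists since \<open>d\<close>
  annihilates this map, by the equation for the previous component.
\<close>

lemma resolution_homotopy:
  assumes M: "left_module A M" and P: "projective_resolution A M P d e"
    and \<theta>: "\<And>n. \<theta> n \<in> mod_hom A (P n) (P n)"
      "\<And>x. x \<in> carrier (P 0) \<Longrightarrow> e (\<theta> 0 x) = e x"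
      "\<And>n x. x \<in> carrier (P (Suc n)) \<Longrightarrow> d n (\<theta> (Suc n) x) = \<theta> n (d n x)"
  obtains s where "\<And>n. s n \<in> mod_hom A (P n) (P (Suc n))"
    "\<And>n x. x \<in> carrier (P (Suc n)) \<Longrightarrow>
      d (Suc n) (s (Suc n) x) = (\<theta> (Suc n) x \<ominus>\<^bsub>P (Suc n)\<^esub> x) \<ominus>\<^bsub>P (Suc n)\<^esub> s n (d n x)"
proof -
  note p = projective_resolutionD[OF P]
  have dc: "d n x \<in> carrier (P n)" if "x \<in> carrier (P (Suc n))" for n x
    by (rule mod_hom_closed[OF p(3) that])
  have \<theta>c: "\<theta> n x \<in> carrier (P n)" if "x \<in> carrier (P n)" for n x
    by (rule mod_hom_closed[OF \<theta>(1) that])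
  let ?r = "\<lambda>k s y. (\<theta> (Suc k) y \<ominus>\<^bsub>P (Suc k)\<^esub> y) \<ominus>\<^bsub>P (Suc k)\<^esub> s (d k y)"
  let ?I = "\<lambda>k s. s \<in> mod_hom A (P k) (P (Suc k)) \<and>
    (\<forall>y\<in>carrier (P (Suc k)). ?r k s y \<in> d (Suc k) ` carrier (P (Suc (Suc k))))"
  let ?Q = "\<lambda>k s t. \<forall>y\<in>carrier (P (Suc k)). d (Suc k) (t y) = ?r k s y"
  have inv: "?I k s" if s: "s \<in> mod_hom A (P k) (P (Suc k))"
    and eq: "\<And>y. y \<in> carrier (P (Suc k)) \<Longrightarrow> d k (s (d k y)) = \<theta> k (d k y) \<ominus>\<^bsub>P k\<^esub> d k y" for k s
  proof (intro conjI ballI s)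
    fix y assume y: "y \<in> carrier (P (Suc k))"
    interpret Q: left_module A "P (Suc k)" by (rule p(2))
    interpret R: left_module A "P k" by (rule p(2))
    have c: "\<theta> (Suc k) y \<in> carrier (P (Suc k))" "s (d k y) \<in> carrier (P (Suc k))"
      using \<theta>c[OF y] mod_hom_closed[OF s dc[OF y]] by auto
    have "d k (?r k s y) = (d k (\<theta> (Suc k) y) \<ominus>\<^bsub>P k\<^esub> d k y) \<ominus>\<^bsub>P k\<^esub> d k (s (d k y))"
      using y c by (simp add: mod_hom_diff[OF p(2) p(2) p(3)])
    also have "\<dots> = \<zero>\<^bsub>P k\<^esub>"
      using \<theta>c[OF dc[OF y]] dc[OF y] by (simp add: \<theta>(3)[OF y] eq[OF y] R.diff_eq_zero_iff)
    finally show "?r k s y \<in> d (Suc k) ` carrier (P (Suc (Suc k)))"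
      unfolding p(7) hom_kernel_def using y c by simp
  qed
  have "\<exists>s. \<forall>k. ?I k (s k) \<and> ?Q k (s k) (s (Suc k))"
  proof (rule dependent_nat_choice)
    interpret P0: left_module A "P 0" by (rule p(2))
    interpret M: left_module A M by fact
    let ?f = "\<lambda>x\<in>carrier (P 0). \<theta> 0 x \<ominus>\<^bsub>P 0\<^esub> x"
    have f: "?f \<in> mod_hom A (P 0) (P 0)"
      by (rule mod_hom_restrictI[OF p(2)])
        (auto simp: \<theta>c mod_hom_add[OF \<theta>(1)] mod_hom_smult[OF \<theta>(1)] a_minus_def P0.M.minus_add P0.M.a_ac
          P0.smult_r_distr P0.smult_r_minus)
    have im: "?f ` carrier (P 0) \<subseteq> d 0 ` carrier (P (Suc 0))"
    proof (rule image_subsetI)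
      fix x assume x: "x \<in> carrier (P 0)"
      then have "e (?f x) = \<zero>\<^bsub>M\<^esub>"
        using \<theta>c[OF x] mod_hom_closed[OF p(4) x]
        by (simp add: mod_hom_diff[OF p(2) M p(4)] \<theta>(2) M.diff_eq_zero_iff)
      then show "?f x \<in> d 0 ` carrier (P (Suc 0))"
        unfolding p(6) hom_kernel_def using mod_hom_closed[OF f x] by simp
    qed
    obtain s where s: "s \<in> mod_hom A (P 0) (P (Suc 0))" "\<And>x. x \<in> carrier (P 0) \<Longrightarrow> d 0 (s x) = ?f x"
      by (rule projective_lift[OF p(1) p(2) p(2) f p(3) im]) blast
    have "?I 0 s" by (rule inv[OF s(1)]) (simp add: s(2) dc)
    then show "\<exists>s. ?I 0 s" by blast
  next
    fix s k assume s: "?I k s"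
    interpret Q: left_module A "P (Suc k)" by (rule p(2))
    have sh: "s \<in> mod_hom A (P k) (P (Suc k))" using s by blast
    let ?f = "\<lambda>y\<in>carrier (P (Suc k)). ?r k s y"
    have f: "?f \<in> mod_hom A (P (Suc k)) (P (Suc k))"
      by (rule mod_hom_restrictI[OF p(2)])
        (auto simp: \<theta>c dc mod_hom_closed[OF sh] mod_hom_add[OF \<theta>(1)] mod_hom_smult[OF \<theta>(1)]
          mod_hom_add[OF p(3)] mod_hom_smult[OF p(3)] mod_hom_add[OF sh] mod_hom_smult[OF sh]
          a_minus_def Q.M.minus_add Q.M.a_ac Q.smult_r_distr Q.smult_r_minus)
    have im: "?f ` carrier (P (Suc k)) \<subseteq> d (Suc k) ` carrier (P (Suc (Suc k)))"
      using s by auto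
    obtain t where t: "t \<in> mod_hom A (P (Suc k)) (P (Suc (Suc k)))"
      "\<And>x. x \<in> carrier (P (Suc k)) \<Longrightarrow> d (Suc k) (t x) = ?f x"
      by (rule projective_lift[OF p(1) p(2) p(2) f p(3) im]) blast
    have "?I (Suc k) t"
    proof (rule inv[OF t(1)])
      fix y assume y: "y \<in> carrier (P (Suc (Suc k)))"
      have "s (d k (d (Suc k) y)) = \<zero>\<^bsub>P (Suc k)\<^esub>"
        unfolding p(9)[OF y] by (rule mod_hom_zero[OF p(2) p(2) sh])
      then show "d (Suc k) (t (d (Suc k) y)) = \<theta> (Suc k) (d (Suc k) y) \<ominus>\<^bsub>P (Suc k)\<^esub> d (Suc k) y"
        using \<theta>c[OF dc[OF y]] dc[OF y] by (simp add: t(2)) (simp add: a_minus_def)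
    qed
    moreover have "?Q k s t" using t(2) by simp
    ultimately show "\<exists>t. ?I (Suc k) t \<and> ?Q k s t" by blast
  qed
  then obtain s where "\<forall>k. ?I k (s k) \<and> ?Q k (s k) (s (Suc k))" ..
  then have "?I k (s k)" "?Q k (s k) (s (Suc k))" for k by blast+
  then show ?thesis by (intro that[of s]) simp_all
qed

text \<open>
  With \<open>\<phi>\<close> and \<open>\<psi>\<close> chain maps between the two resolutions and \<open>s\<close> a homotopy from \<open>\<phi> \<psi>\<close> to the
  identity, a cocycle \<open>f\<close> equals \<open>f \<phi> \<psi> - f s d'\<close>, and \<open>f \<phi>\<close> is a coboundary by hypothesis.
\<close>

lemma dual_acyclic_independent:
  assumes M: "left_module A M"
    and P: "projective_resolution A M P d e" and P': "projective_resolution A M P' d' e'"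
    and ac: "dual_acyclic A P d"
  shows "dual_acyclic A P' d'"
proof -
  note p = projective_resolutionD[OF P] and p' = projective_resolutionD[OF P']
  interpret M: left_module A M by fact
  obtain \<phi> where \<phi>: "\<And>n. \<phi> n \<in> mod_hom A (P n) (P' n)"
    "\<And>x. x \<in> carrier (P 0) \<Longrightarrow> e' (\<phi> 0 x) = e x"
    "\<And>n x. x \<in> carrier (P (Suc n)) \<Longrightarrow> d' n (\<phi> (Suc n) x) = \<phi> n (d n x)"
    by (rule resolution_chain_map[OF M P P']) blast
  obtain \<psi> where \<psi>: "\<And>n. \<psi> n \<in> mod_hom A (P' n) (P n)"
    "\<And>x. x \<in> carrier (P' 0) \<Longrightarrow> e (\<psi> 0 x) = e' x"
    "\<And>n x. x \<in> carrier (P' (Suc n)) \<Longrightarrow> d n (\<psi> (Suc n) x) = \<psi> n (d' n x)"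
    by (rule resolution_chain_map[OF M P' P]) blast
  define \<theta> where "\<theta> n = compose (carrier (P' n)) (\<phi> n) (\<psi> n)" for n
  have \<theta>: "\<theta> n \<in> mod_hom A (P' n) (P' n)" for n
    unfolding \<theta>_def by (rule mod_hom_compose[OF p'(2) \<psi>(1) \<phi>(1)])
  have \<theta>_app: "\<theta> n x = \<phi> n (\<psi> n x)" if "x \<in> carrier (P' n)" for n x
    using that by (simp add: \<theta>_def compose_def)
  have \<psi>c: "\<psi> n x \<in> carrier (P n)" if "x \<in> carrier (P' n)" for n x by (rule mod_hom_closed[OF \<psi>(1) that])
  have dc: "d' n x \<in> carrier (P' n)" if "x \<in> carrier (P' (Suc n))" for n x
    by (rule mod_hom_closed[OF p'(3) that])
  obtain s where s: "\<And>n. s n \<in> mod_hom A (P' n) (P' (Suc n))"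
    "\<And>n x. x \<in> carrier (P' (Suc n)) \<Longrightarrow>
      d' (Suc n) (s (Suc n) x) = (\<theta> (Suc n) x \<ominus>\<^bsub>P' (Suc n)\<^esub> x) \<ominus>\<^bsub>P' (Suc n)\<^esub> s n (d' n x)"
    by (rule resolution_homotopy[OF M P' \<theta>]) (auto simp: \<theta>_app \<phi> \<psi> \<psi>c dc)
  show ?thesis unfolding dual_acyclic_def
  proof (intro allI ballI impI)
    fix n f assume f: "f \<in> functionals A (P' (Suc n))"
      and fd: "\<forall>x\<in>carrier (P' (Suc (Suc n))). f (d' (Suc n) x) = \<zero>\<^bsub>A\<^esub>"
    interpret P's: left_module A "P' (Suc n)" by (rule p'(2))
    have reg: "left_module A (regular_module A)" by (rule left_module_regular[OF M.R.ring_axioms])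
    have fc: "f x \<in> carrier A" if "x \<in> carrier (P' (Suc n))" for x using mod_hom_closed[OF f that] by simp
    let ?f = "compose (carrier (P (Suc n))) f (\<phi> (Suc n))"
    have f': "?f \<in> functionals A (P (Suc n))" by (rule mod_hom_compose[OF p(2) \<phi>(1) f])
    obtain g where g: "g \<in> functionals A (P n)"
      "\<And>x. x \<in> carrier (P (Suc n)) \<Longrightarrow> g (d n x) = ?f x"
    proof (rule dual_acyclicD[OF ac f'])
      fix x assume x: "x \<in> carrier (P (Suc (Suc n)))"
      have "?f (d (Suc n) x) = f (d' (Suc n) (\<phi> (Suc (Suc n)) x))"
        using mod_hom_closed[OF p(3) x] \<phi>(3)[OF x] by (simp add: compose_def)
      then show "?f (d (Suc n) x) = \<zero>\<^bsub>A\<^esub>" using fd mod_hom_closed[OF \<phi>(1) x] by simp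
    qed blast
    let ?g = "\<lambda>x\<in>carrier (P' n). g (\<psi> n x) \<ominus>\<^bsub>A\<^esub> f (s n x)"
    have gc: "g x \<in> carrier A" if "x \<in> carrier (P n)" for x using mod_hom_closed[OF g(1) that] by simp
    have sc: "s m x \<in> carrier (P' (Suc m))" if "x \<in> carrier (P' m)" for m x
      by (rule mod_hom_closed[OF s(1) that])
    have "?g \<in> functionals A (P' n)"
      by (rule mod_hom_restrictI[OF p'(2)])
        (auto simp: \<psi>c sc fc gc mod_hom_add[OF \<psi>(1)] mod_hom_smult[OF \<psi>(1)] mod_hom_add[OF g(1)]
          mod_hom_smult[OF g(1)] mod_hom_add[OF s(1)] mod_hom_smult[OF s(1)] mod_hom_add[OF f]
          mod_hom_smult[OF f] a_minus_def M.R.minus_add M.R.a_ac M.R.r_distr M.R.r_minus)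
    moreover have "?g (d' n x) = f x" if x: "x \<in> carrier (P' (Suc n))" for x
    proof -
      have c: "\<theta> (Suc n) x \<in> carrier (P' (Suc n))" "s n (d' n x) \<in> carrier (P' (Suc n))"
        using mod_hom_closed[OF \<theta> x] sc[OF dc[OF x]] by auto
      have "f ((\<theta> (Suc n) x \<ominus>\<^bsub>P' (Suc n)\<^esub> x) \<ominus>\<^bsub>P' (Suc n)\<^esub> s n (d' n x)) = \<zero>\<^bsub>A\<^esub>"
        using fd sc[OF x] s(2)[OF x] by metis
      then have z: "(f (\<theta> (Suc n) x) \<ominus>\<^bsub>A\<^esub> f x) \<ominus>\<^bsub>A\<^esub> f (s n (d' n x)) = \<zero>\<^bsub>A\<^esub>"
        using c x by (simp add: mod_hom_diff[OF p'(2) reg f])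
      have "f (\<theta> (Suc n) x) = g (\<psi> n (d' n x))"
        using g(2)[OF \<psi>c[OF x]] \<psi>(3)[OF x] x \<psi>c[OF x] by (simp add: \<theta>_app compose_def)
      then have "?g (d' n x) = f (\<theta> (Suc n) x) \<ominus>\<^bsub>A\<^esub> f (s n (d' n x))"
        using dc[OF x] by simp
      also have "\<dots> = f x"
      proof -
        have "f (\<theta> (Suc n) x) \<ominus>\<^bsub>A\<^esub> f (s n (d' n x)) \<ominus>\<^bsub>A\<^esub> f x = \<zero>\<^bsub>A\<^esub>"
          using z fc c x by (simp add: a_minus_def M.R.a_ac)
        then show ?thesis using fc c x by (simp add: M.R.diff_eq_zero_iff)
      qed
      finally show ?thesis .
    qed
    ultimately show "\<exists>g\<in>functionals A (P' n). \<forall>x\<in>carrier (P' (Suc n)). g (d' n x) = f x"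
      by blast
  qed
qed

section \<open>Semi-Gorenstein-projective modules through resolutions\<close>

lemma trivial_factor_group:
  assumes "comm_group G" "subgroup H G"
  shows "trivial_group (G Mod H) \<longleftrightarrow> carrier G \<subseteq> H"
proof -
  interpret comm_group G by fact
  interpret normal H G by (rule subgroup_imp_normal) fact
  have self: "x \<in> H #>\<^bsub>G\<^esub> x" if "x \<in> carrier G" for x using that by (rule rcos_self) (rule subgroup_axioms)
  have "carrier (G Mod H) = {H} \<longleftrightarrow> carrier G \<subseteq> H"
  proof
    assume eq: "carrier (G Mod H) = {H}"
    show "carrier G \<subseteq> H"
    proof
      fix x assume x: "x \<in> carrier G"
      then have "H #>\<^bsub>G\<^esub> x \<in> carrier (G Mod H)" by (auto simp: FactGroup_def RCOSETS_def)
      then show "x \<in> H" using eq self[OF x] by simp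
    qed
  next
    assume "carrier G \<subseteq> H"
    then have "H #>\<^bsub>G\<^esub> x = H" if "x \<in> carrier G" for x using that rcos_const by blast
    then show "carrier (G Mod H) = {H}" using one_closed by (auto simp: FactGroup_def RCOSETS_def)
  qed
  then show ?thesis unfolding trivial_group_def using factorgroup_is_group by (simp add: FactGroup_def)
qed

lemma dual_map_hom:
  assumes M: "left_module A M" and N: "left_module A N" and f: "f \<in> mod_hom A M N"
  shows "(\<lambda>g\<in>carrier (dual A N). compose (carrier M) g f) \<in> mod_hom (op_ring A) (dual A N) (dual A M)"
proof (rule mod_hom_restrictI[OF right_module_dual[OF N]])
  fix g assume "g \<in> carrier (dual A N)"
  then show "compose (carrier M) g f \<in> carrier (dual A M)"
    using mod_hom_compose[OF M f] by simp
qed (auto simp: compose_def mod_hom_closed[OF f] intro!: restrict_ext)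

text \<open>
  \<open>Ext\<close> is defined through one resolution; by the comparison theorem its vanishing can be tested on
  any other.  Cocycles and coboundaries are the kernel and the image of maps between the duals of the
  terms, so the cohomology is a quotient of abelian groups, trivial exactly when every cocycle is a coboundary.
\<close>

lemma semi_gorenstein_projective_iff:
  fixes P :: "nat \<Rightarrow> ('a, nat \<Rightarrow> 'a) module" and A :: "('a, 'x) ring_scheme"
  assumes M: "left_module A M" and res: "projective_resolution A M P d e"
  shows "semi_gorenstein_projective A M \<longleftrightarrow> dual_acyclic A P d"
proof -
  let ?r = "regular_module A"
  \<comment> \<open>The resolution chosen in the definition of \<open>Ext\<close>; the choice is not empty because of \<open>P\<close>.\<close>
  define Pd where "Pd = (SOME (P, d). \<exists>e. projective_resolution A M (P :: nat \<Rightarrow> ('a, nat \<Rightarrow> 'a) module) d e)"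
  obtain Q \<delta> where Q: "Pd = (Q, \<delta>)" by (cases Pd)
  have "case Pd of (P, d) \<Rightarrow> \<exists>e. projective_resolution A M (P :: nat \<Rightarrow> ('a, nat \<Rightarrow> 'a) module) d e"
    unfolding Pd_def by (rule someI[of _ "(P, d)"]) (use res in auto)
  then obtain \<epsilon> where res': "projective_resolution A M Q \<delta> \<epsilon>" using Q by auto
  note q = projective_resolutionD[OF res']
  have Ext: "Ext A M ?r n = (hom_group A (Q n) ?r)\<lparr> carrier := cocycles A Q \<delta> ?r n \<rparr> A_Mod coboundaries A Q \<delta> ?r n" for n
    unfolding Ext_def Pd_def[symmetric] Q by simp
  have triv: "trivial_group (Ext A M ?r (Suc n)) \<longleftrightarrow>
      cocycles A Q \<delta> ?r (Suc n) \<subseteq> coboundaries A Q \<delta> ?r (Suc n)" for n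
  proof -
    let ?D = "dual A (Q (Suc n))" and ?Z = "cocycles A Q \<delta> ?r (Suc n)" and ?B = "coboundaries A Q \<delta> ?r (Suc n)"
    let ?u = "\<lambda>k. \<lambda>g\<in>carrier (dual A (Q k)). compose (carrier (Q (Suc k))) g (\<delta> k)"
    have D: "left_module (op_ring A) (dual A (Q k))" for k by (rule right_module_dual[OF q(2)])
    have u: "?u k \<in> mod_hom (op_ring A) (dual A (Q k)) (dual A (Q (Suc k)))" for k
      by (rule dual_map_hom[OF q(2) q(2) q(3)])
    interpret D: left_module "op_ring A" ?D by (rule D)
    have Z_eq: "?Z = hom_kernel ?D (dual A (Q (Suc (Suc n)))) (?u (Suc n))"
      by (auto simp: cocycles_def hom_kernel_def compose_def fun_eq_iff restrict_def
          mod_hom_closed[OF q(3)])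
    have Z: "submodule ?Z (op_ring A) ?D" unfolding Z_eq by (rule submodule_kernel[OF D D u])
    interpret Z: left_module "op_ring A" "?D\<lparr>carrier := ?Z\<rparr>" by (rule D.left_module_submodule[OF Z])
    have "?B = ?u n ` carrier (dual A (Q n))" unfolding coboundaries_def by auto
    then have B: "submodule ?B (op_ring A) ?D"
      using submodule_image[OF D D u submodule_carrier[OF D]] by simp
    have BZ: "?B \<subseteq> ?Z"
    proof
      fix f assume "f \<in> ?B"
      then obtain g where g: "g \<in> mod_hom A (Q n) ?r" "f = compose (carrier (Q (Suc n))) g (\<delta> n)"
        unfolding coboundaries_def by auto
      have "f (\<delta> (Suc n) x) = \<zero>\<^bsub>A\<^esub>" if x: "x \<in> carrier (Q (Suc (Suc n)))" for x
      proof -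
        have "f (\<delta> (Suc n) x) = g \<zero>\<^bsub>Q n\<^esub>"
          using mod_hom_closed[OF q(3) x] q(9)[OF x] by (simp add: g(2) compose_def)
        also have "\<dots> = \<zero>\<^bsub>A\<^esub>"
          using mod_hom_zero[OF q(2) left_module_regular g(1)] M by (simp add: left_module_def)
        finally show ?thesis .
      qed
      moreover have "f \<in> mod_hom A (Q (Suc n)) ?r"
        unfolding g(2) by (rule mod_hom_compose[OF q(2) q(3) g(1)])
      ultimately show "f \<in> ?Z" by (simp add: cocycles_def)
    qed
    have "submodule ?B (op_ring A) (?D\<lparr>carrier := ?Z\<rparr>)"
      using B BZ unfolding D.submodule_iff Z.submodule_iff by simp
    then have sub: "subgroup ?B (add_monoid (?D\<lparr>carrier := ?Z\<rparr>))" by (rule submodule.axioms(1))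
    have "Ext A M ?r (Suc n) = add_monoid (?D\<lparr>carrier := ?Z\<rparr>) Mod ?B"
      unfolding Ext A_FactGroup_def
      by (simp add: hom_group_def dual_def FactGroup_def RCOSETS_def r_coset_def set_mult_def fun_eq_iff)
    then show ?thesis
      using trivial_factor_group[OF Z.M.a_comm_group sub] by simp
  qed
  have "semi_gorenstein_projective A M \<longleftrightarrow> (\<forall>n. trivial_group (Ext A M ?r (Suc n)))"
    unfolding semi_gorenstein_projective_def by (metis Suc_le_D One_nat_def le_add1 plus_1_eq_Suc)
  also have "\<dots> \<longleftrightarrow> dual_acyclic A Q \<delta>"
  proof -
    have "cocycles A Q \<delta> ?r (Suc n) \<subseteq> coboundaries A Q \<delta> ?r (Suc n) \<longleftrightarrow>
      (\<forall>f\<in>mod_hom A (Q (Suc n)) ?r. (\<forall>x\<in>carrier (Q (Suc (Suc n))). f (\<delta> (Suc n) x) = \<zero>\<^bsub>A\<^esub>) \<longrightarrow>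
      (\<exists>g\<in>mod_hom A (Q n) ?r. \<forall>x\<in>carrier (Q (Suc n)). g (\<delta> n x) = f x))" for n
    proof -
      have "f = compose (carrier (Q (Suc n))) g (\<delta> n) \<longleftrightarrow> (\<forall>x\<in>carrier (Q (Suc n)). g (\<delta> n x) = f x)"
        if "f \<in> mod_hom A (Q (Suc n)) ?r" "g \<in> mod_hom A (Q n) ?r" for f g
        using mod_hom_ext[OF that(1) mod_hom_compose[OF q(2) q(3) that(2)]] by (auto simp: compose_def)
      then show ?thesis by (fastforce simp: cocycles_def coboundaries_def image_iff subset_iff)
    qed
    then show ?thesis unfolding triv dual_acyclic_def by simp
  qed
  also have "\<dots> \<longleftrightarrow> dual_acyclic A P d"
    using dual_acyclic_independent[OF M res res'] dual_acyclic_independent[OF M res' res] by blast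
  finally show ?thesis .
qed

section \<open>Dimension shifting\<close>

text \<open>
  Splicing a resolution of \<open>K\<close> with \<open>P \<rightarrow> M\<close> resolves \<open>M\<close>.  In the lowest degree the vanishing of
  cohomology of this resolution says that functionals on \<open>K\<close> extend to \<open>P\<close>, that is, \<open>Ext\<^sup>1(M, A) = 0\<close>;
  in the higher degrees it is the vanishing for \<open>K\<close>.
\<close>

lemma semi_gorenstein_projective_syzygy:
  fixes A :: "('a, 'x) ring_scheme" and P :: "('a, 'p, 'z) module_scheme"
  assumes A: "left_noetherian A"
    and M: "left_module A M" and P: "fg_projective A P"
    and p: "p \<in> mod_hom A P M" "p ` carrier P = carrier M"
    and K_def: "K = P\<lparr>carrier := hom_kernel P M p\<rparr>"
  shows "semi_gorenstein_projective A M \<longleftrightarrow>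
    (\<forall>f\<in>functionals A K. \<exists>g\<in>functionals A P. \<forall>x\<in>carrier K. g x = f x) \<and>
    semi_gorenstein_projective A K"
proof -
  let ?r = "regular_module A"
  have PM: "left_module A P" by (rule fg_projective_module[OF P])
  interpret P: left_module A P by fact
  have sub: "submodule (hom_kernel P M p) A P" by (rule submodule_kernel[OF PM M p(1)])
  have K: "left_module A K" unfolding K_def by (rule P.left_module_submodule[OF sub])
  have KP: "x \<in> carrier P" "p x = \<zero>\<^bsub>M\<^esub>" if "x \<in> carrier K" for x
    using that by (auto simp: K_def hom_kernel_def)
  have "fin_gen A K"
    unfolding K_def using P.noetherian_of_fin_gen[OF A fin_gen_projective[OF P]] sub
    by (rule P.fin_gen_submodule)
  then obtain R :: "nat \<Rightarrow> ('a, nat \<Rightarrow> 'a) module" and \<delta> \<epsilon>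
    where R: "projective_resolution A K R \<delta> \<epsilon>"
    by (rule projective_resolution_exists[OF A K])
  note r = projective_resolutionD[OF R]
  obtain P' :: "('a, nat \<Rightarrow> 'a) module" and i j
    where P': "fg_projective A P'" and i: "i \<in> mod_hom A P P'" and j: "j \<in> mod_hom A P' P"
    and ji: "\<And>x. x \<in> carrier P \<Longrightarrow> j (i x) = x" and ij: "\<And>y. y \<in> carrier P' \<Longrightarrow> i (j y) = y"
    by (rule fg_projective_transport[OF P]) blast
  have PM': "left_module A P'" by (rule fg_projective_module[OF P'])
  have reg: "left_module A ?r" by (rule left_module_regular[OF P.R.ring_axioms])
  have \<epsilon>c: "\<epsilon> x \<in> carrier K" "\<epsilon> x \<in> carrier P" if "x \<in> carrier (R 0)" for x
    using mod_hom_closed[OF r(4) that] KP(1) by auto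
  have \<epsilon>P: "\<epsilon> \<in> mod_hom A (R 0) P"
    using r(4) unfolding K_def by (rule mod_hom_codomain_mono) (auto simp: hom_kernel_def)
  have i0: "i x = \<zero>\<^bsub>P'\<^esub> \<longleftrightarrow> x = \<zero>\<^bsub>P\<^esub>" if "x \<in> carrier P" for x
    using ji[OF that] ji[OF P.M.zero_closed] mod_hom_zero[OF PM PM' i] by auto
  \<comment> \<open>The spliced resolution; \<open>P'\<close> is a copy of \<open>P\<close> on the type of the terms of \<open>R\<close>.\<close>
  define Q where "Q n = (case n of 0 \<Rightarrow> P' | Suc m \<Rightarrow> R m)" for n
  define D where "D n = (case n of 0 \<Rightarrow> compose (carrier (R 0)) i \<epsilon> | Suc m \<Rightarrow> \<delta> m)" for n
  have QD: "Q 0 = P'" "Q (Suc m) = R m" "D 0 = compose (carrier (R 0)) i \<epsilon>" "D (Suc m) = \<delta> m" for m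
    by (simp_all add: Q_def D_def)
  let ?e = "compose (carrier P') p j"
  have "projective_resolution A M Q D ?e"
    unfolding projective_resolution_def
  proof (intro conjI allI)
    fix n
    show "fg_projective A (Q n)" by (cases n) (simp_all add: QD P' r(1))
    show "D n \<in> mod_hom A (Q (Suc n)) (Q n)"
      by (cases n) (simp_all add: QD r(3) mod_hom_compose[OF r(2) \<epsilon>P i])
    show "?e \<in> mod_hom A (Q 0) M" unfolding QD by (rule mod_hom_compose[OF PM' j p(1)])
    have "?e ` carrier P' = p ` carrier P"
    proof (intro subset_antisym subsetI)
      fix y assume "y \<in> p ` carrier P"
      then obtain x where x: "x \<in> carrier P" "y = p x" by blast
      then show "y \<in> ?e ` carrier P'"
        using mod_hom_closed[OF i x(1)] by (intro rev_image_eqI[of "i x"]) (auto simp: compose_def ji)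
    qed (auto simp: compose_def mod_hom_closed[OF j])
    then show "?e ` carrier (Q 0) = carrier M" using p(2) by (simp add: QD)
    have "D 0 ` carrier (Q 1) = i ` carrier K"
      unfolding One_nat_def QD r(5)[symmetric] image_image by (auto simp: compose_def)
    also have "\<dots> = hom_kernel P' M ?e"
    proof (intro subset_antisym subsetI)
      fix y assume "y \<in> i ` carrier K"
      then show "y \<in> hom_kernel P' M ?e"
        using mod_hom_closed[OF i] by (auto simp: hom_kernel_def compose_def KP ji)
    next
      fix y assume "y \<in> hom_kernel P' M ?e"
      then have "y \<in> carrier P'" "j y \<in> carrier K"
        using mod_hom_closed[OF j] by (auto simp: hom_kernel_def compose_def K_def)
      then show "y \<in> i ` carrier K" using ij by (intro rev_image_eqI[of "j y"]) auto
    qed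
    finally show "D 0 ` carrier (Q 1) = hom_kernel (Q 0) M ?e" by (simp add: QD)
    show "D (Suc n) ` carrier (Q (Suc (Suc n))) = hom_kernel (Q (Suc n)) (Q n) (D n)"
    proof (cases n)
      case 0
      have "hom_kernel (R 0) K \<epsilon> = hom_kernel (R 0) P' (compose (carrier (R 0)) i \<epsilon>)"
        using \<epsilon>c i0 by (auto simp: hom_kernel_def compose_def K_def)
      then show ?thesis using 0 r(6) by (simp add: QD)
    qed (simp add: QD r(7))
  qed
  then have "semi_gorenstein_projective A M \<longleftrightarrow> dual_acyclic A Q D"
    by (rule semi_gorenstein_projective_iff[OF M])
  also have "\<dots> \<longleftrightarrow>
    (\<forall>f\<in>mod_hom A (R 0) ?r. (\<forall>x\<in>carrier (R (Suc 0)). f (\<delta> 0 x) = \<zero>\<^bsub>A\<^esub>) \<longrightarrow>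
      (\<exists>g\<in>mod_hom A P' ?r. \<forall>x\<in>carrier (R 0). g (compose (carrier (R 0)) i \<epsilon> x) = f x)) \<and> dual_acyclic A R \<delta>"
    (is "_ \<longleftrightarrow> ?low \<and> _")
  proof -
    have "(\<forall>n. X n) \<longleftrightarrow> X 0 \<and> (\<forall>n. X (Suc n))" for X :: "nat \<Rightarrow> bool"
      by (metis not0_implies_Suc)
    from this[of "\<lambda>n. \<forall>f\<in>mod_hom A (Q (Suc n)) ?r.
        (\<forall>x\<in>carrier (Q (Suc (Suc n))). f (D (Suc n) x) = \<zero>\<^bsub>A\<^esub>) \<longrightarrow>
        (\<exists>g\<in>mod_hom A (Q n) ?r. \<forall>x\<in>carrier (Q (Suc n)). g (D n x) = f x)"]
    show ?thesis unfolding dual_acyclic_def QD .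
  qed
  also have "dual_acyclic A R \<delta> \<longleftrightarrow> semi_gorenstein_projective A K"
    by (rule semi_gorenstein_projective_iff[OF K R, symmetric])
  also have "?low \<longleftrightarrow> (\<forall>f\<in>mod_hom A K ?r. \<exists>g\<in>mod_hom A P ?r. \<forall>x\<in>carrier K. g x = f x)"
  proof (intro iffI ballI impI)
    fix f assume low: ?low and f: "f \<in> mod_hom A K ?r"
    let ?f = "compose (carrier (R 0)) f \<epsilon>"
    have f': "?f \<in> mod_hom A (R 0) ?r" by (rule mod_hom_compose[OF r(2) r(4) f])
    have "?f (\<delta> 0 x) = \<zero>\<^bsub>A\<^esub>" if "x \<in> carrier (R (Suc 0))" for x
      using r(8)[OF that] mod_hom_closed[OF r(3) that] mod_hom_zero[OF K reg f] by (simp add: compose_def)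
    then obtain g where g: "g \<in> mod_hom A P' ?r" "\<forall>x\<in>carrier (R 0). g (compose (carrier (R 0)) i \<epsilon> x) = ?f x"
      using low f' by blast
    have "compose (carrier P) g i x = f x" if x: "x \<in> carrier K" for x
    proof -
      obtain y where y: "y \<in> carrier (R 0)" "x = \<epsilon> y" using x r(5) by blast
      then show ?thesis using g(2)[rule_format, OF y(1)] KP(1)[OF x] by (simp add: compose_def)
    qed
    then show "\<exists>g\<in>mod_hom A P ?r. \<forall>x\<in>carrier K. g x = f x"
      using mod_hom_compose[OF PM i g(1)] by blast
  next
    fix f assume ext: "\<forall>f\<in>mod_hom A K ?r. \<exists>g\<in>mod_hom A P ?r. \<forall>x\<in>carrier K. g x = f x"
      and f: "f \<in> mod_hom A (R 0) ?r" and f0: "\<forall>x\<in>carrier (R (Suc 0)). f (\<delta> 0 x) = \<zero>\<^bsub>A\<^esub>"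
    have ker: "f x = \<zero>\<^bsub>?r\<^esub>" if "x \<in> carrier (R 0)" "\<epsilon> x = \<zero>\<^bsub>K\<^esub>" for x
    proof -
      have "x \<in> \<delta> 0 ` carrier (R (Suc 0))" unfolding r(6) hom_kernel_def using that by simp
      then show ?thesis using f0 by auto
    qed
    obtain h where h: "h \<in> mod_hom A K ?r" "\<And>x. x \<in> carrier (R 0) \<Longrightarrow> h (\<epsilon> x) = f x"
      by (rule mod_hom_factor[OF r(2) K reg r(4) r(5) f ker])
        (assumption, assumption, rule that, assumption, simp)
    obtain g where g: "g \<in> mod_hom A P ?r" "\<forall>x\<in>carrier K. g x = h x" using ext h(1) by blast
    have "compose (carrier P') g j (compose (carrier (R 0)) i \<epsilon> x) = f x" if "x \<in> carrier (R 0)" for x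
      using that \<epsilon>c[OF that] mod_hom_closed[OF i] by (simp add: compose_def ji g(2) h(2))
    then show "\<exists>g\<in>mod_hom A P' ?r. \<forall>x\<in>carrier (R 0). g (compose (carrier (R 0)) i \<epsilon> x) = f x"
      using mod_hom_compose[OF PM' j g(1)] by blast
  qed
  finally show ?thesis .
qed

text \<open>
  The same complex of projectives resolves both modules.
\<close>

lemma semi_gorenstein_projective_iso:
  fixes A :: "('a, 'x) ring_scheme"
  assumes A: "left_noetherian A"
    and M: "left_module A M" "fin_gen A M" and N: "left_module A N"
    and f: "f \<in> mod_hom A M N" "bij_betw f (carrier M) (carrier N)"
  shows "semi_gorenstein_projective A M \<longleftrightarrow> semi_gorenstein_projective A N"
proof -
  obtain P :: "nat \<Rightarrow> ('a, nat \<Rightarrow> 'a) module" and d e where P: "projective_resolution A M P d e"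
    by (rule projective_resolution_exists[OF A M])
  note p = projective_resolutionD[OF P]
  let ?e = "compose (carrier (P 0)) f e"
  interpret M: left_module A M by fact
  have z: "f x = \<zero>\<^bsub>N\<^esub> \<longleftrightarrow> x = \<zero>\<^bsub>M\<^esub>" if "x \<in> carrier M" for x
    using f(2) that mod_hom_zero[OF M(1) N f(1)] unfolding bij_betw_def
    by (metis M.M.zero_closed inj_onD)
  have "?e ` carrier (P 0) = f ` (e ` carrier (P 0))" by (auto simp: compose_def)
  then have "?e ` carrier (P 0) = carrier N" using f(2) p(5) by (simp add: bij_betw_def)
  moreover have "hom_kernel (P 0) M e = hom_kernel (P 0) N ?e"
    using mod_hom_closed[OF p(4)] z by (auto simp: hom_kernel_def compose_def)
  ultimately have "projective_resolution A N P d ?e"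
    unfolding projective_resolution_def using p(1,3,6,7) mod_hom_compose[OF p(2) p(4) f(1)] by simp
  then show ?thesis
    using semi_gorenstein_projective_iff[OF M(1) P] semi_gorenstein_projective_iff[OF N] by blast
qed

section \<open>Duals of syzygies\<close>

lemma reflexive_eval:
  assumes "reflexive A M" "left_module A M"
    and "\<xi> \<in> functionals (op_ring A) (dual A M)"
  obtains x where "x \<in> carrier M" "\<And>f. f \<in> functionals A M \<Longrightarrow> \<xi> f = f x"
  using assms(1,3) unfolding reflexive_iff[OF assms(2)] by metis

text \<open>
  A free cover \<open>A\<^sup>n \<rightarrow> M\<close> embeds \<open>M\<^sup>*\<close> into the dual of \<open>A\<^sup>n\<close>, which is noetherian.
\<close>

lemma fin_gen_dual:
  assumes A: "left_noetherian (op_ring A)"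
    and M: "left_module A M" "fin_gen A M"
  shows "fin_gen (op_ring A) (dual A M)"
proof -
  interpret M: left_module A M by fact
  note ring = M.R.ring_axioms
  obtain n h where h: "h \<in> mod_hom A (free_module A n) M" "h ` carrier (free_module A n) = carrier M"
    by (rule free_cover[OF M])
  let ?F = "free_module A n"
  have F: "left_module A ?F" by (rule left_module_free[OF ring])
  have FD: "fg_projective (op_ring A) (dual A ?F)" by (intro fg_projective_dual fg_projective_free ring)
  let ?u = "\<lambda>g\<in>carrier (dual A M). compose (carrier ?F) g h"
  have D: "left_module (op_ring A) (dual A M)" "left_module (op_ring A) (dual A ?F)"
    by (intro right_module_dual M F)+
  have u: "?u \<in> mod_hom (op_ring A) (dual A M) (dual A ?F)" by (rule dual_map_hom[OF F M(1) h(1)])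
  have "inj_on ?u (carrier (dual A M))"
  proof (rule inj_onI)
    fix f g assume fg: "f \<in> carrier (dual A M)" "g \<in> carrier (dual A M)" "?u f = ?u g"
    then have eq: "compose (carrier ?F) f h = compose (carrier ?F) g h" by simp
    have "f (h u) = g (h u)" if "u \<in> carrier ?F" for u
      using fun_cong[OF eq, of u] that by (simp add: compose_def)
    then have "f x = g x" if "x \<in> carrier M" for x using that h(2) by (metis imageE)
    then show "f = g" using fg by (intro mod_hom_ext[of f A M "regular_module A" g "regular_module A"]) auto
  qed
  then show ?thesis
    by (intro fin_gen_inj[OF D u] left_module.noetherian_of_fin_gen[OF D(2) A] fin_gen_projective FD)
qed

lemma restriction_hom:
  assumes P: "left_module A P" and H: "submodule H A P"
  shows "(\<lambda>g\<in>carrier (dual A P). restrict g H) \<in> mod_hom (op_ring A) (dual A P) (dual A (P\<lparr>carrier := H\<rparr>))"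
proof (rule mod_hom_restrictI[OF right_module_dual[OF P]])
  interpret P: left_module A P by fact
  have HP: "x \<in> carrier P" if "x \<in> H" for x using H that by (auto simp: P.submodule_iff)
  show "restrict g H \<in> carrier (dual A (P\<lparr>carrier := H\<rparr>))" if "g \<in> carrier (dual A P)" for g
    using that mod_hom_restrict[OF P _ H] by simp
  show "restrict (f \<oplus>\<^bsub>dual A P\<^esub> g) H = restrict f H \<oplus>\<^bsub>dual A (P\<lparr>carrier := H\<rparr>)\<^esub> restrict g H" for f g
    by (auto simp: HP fun_eq_iff)
  show "restrict (a \<odot>\<^bsub>dual A P\<^esub> f) H = a \<odot>\<^bsub>dual A (P\<lparr>carrier := H\<rparr>)\<^esub> restrict f H" for a f
    by (auto simp: HP fun_eq_iff)
qed

text \<open>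
  An element \<open>\<xi>\<close> of \<open>L\<^sup>*\<^sup>*\<close> composed with restriction \<open>P\<^sup>* \<rightarrow> L\<^sup>*\<close> is evaluation at some \<open>y\<close> of \<open>P\<close>, since
  \<open>P\<close> is reflexive.  It annihilates the functionals \<open>h q\<close>, because these restrict to zero on \<open>L\<close>; so all
  functionals vanish at \<open>q y\<close>, whence \<open>q y = 0\<close> and \<open>y\<close> lies in \<open>L\<close>.  Since functionals on \<open>L\<close> extend
  to \<open>P\<close>, \<open>\<xi>\<close> is evaluation at \<open>y\<close>.
\<close>

lemma reflexive_kernel:
  assumes P: "fg_projective A P" and N: "left_module A N" and q: "q \<in> mod_hom A P N"
    and torsionless: "\<And>y. y \<in> carrier N \<Longrightarrow> (\<And>f. f \<in> functionals A N \<Longrightarrow> f y = \<zero>\<^bsub>A\<^esub>) \<Longrightarrow> y = \<zero>\<^bsub>N\<^esub>"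
    and L_def: "L = P\<lparr>carrier := hom_kernel P N q\<rparr>"
    and ext: "\<And>f. f \<in> functionals A L \<Longrightarrow>
      \<exists>g\<in>functionals A P. \<forall>x\<in>carrier L. g x = f x"
  shows "reflexive A L"
proof -
  let ?r = "regular_module A" and ?ro = "regular_module (op_ring A)"
  have PM: "left_module A P" by (rule fg_projective_module[OF P])
  interpret P: left_module A P by fact
  have sub: "submodule (hom_kernel P N q) A P" by (rule submodule_kernel[OF PM N q])
  have L: "left_module A L" unfolding L_def by (rule P.left_module_submodule[OF sub])
  have LP: "x \<in> carrier P" "q x = \<zero>\<^bsub>N\<^esub>" if "x \<in> carrier L" for x
    using that by (auto simp: L_def hom_kernel_def)
  have carL: "carrier L = hom_kernel P N q" by (simp add: L_def)
  define \<rho> where "\<rho> = (\<lambda>g\<in>carrier (dual A P). restrict g (carrier L))"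
  have \<rho>: "\<rho> \<in> mod_hom (op_ring A) (dual A P) (dual A L)"
    unfolding \<rho>_def carL unfolding L_def by (rule restriction_hom[OF PM sub])
  have \<rho>_app: "\<rho> g x = g x" if "g \<in> mod_hom A P ?r" "x \<in> carrier L" for g x
    using that by (simp add: \<rho>_def)
  have D: "left_module (op_ring A) (dual A P)" "left_module (op_ring A) (dual A L)"
    by (intro right_module_dual PM L)+
  show ?thesis unfolding reflexive_iff[OF L]
  proof (intro conjI ballI impI)
    fix x assume x: "x \<in> carrier L" and z: "\<forall>f\<in>mod_hom A L ?r. f x = \<zero>\<^bsub>A\<^esub>"
    have "g x = \<zero>\<^bsub>A\<^esub>" if "g \<in> mod_hom A P ?r" for g
      using z mod_hom_closed[OF \<rho>, of g] \<rho>_app[OF that x] that by auto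
    then have "x = \<zero>\<^bsub>P\<^esub>" by (rule projective_separated[OF P LP(1)[OF x]])
    then show "x = \<zero>\<^bsub>L\<^esub>" by (simp add: L_def)
  next
    fix \<xi> assume \<xi>: "\<xi> \<in> mod_hom (op_ring A) (dual A L) ?ro"
    have "compose (carrier (dual A P)) \<xi> \<rho> \<in> mod_hom (op_ring A) (dual A P) ?ro"
      by (rule mod_hom_compose[OF D(1) \<rho> \<xi>])
    then obtain y where y: "y \<in> carrier P"
      "\<And>g. g \<in> mod_hom A P ?r \<Longrightarrow> compose (carrier (dual A P)) \<xi> \<rho> g = g y"
      using projective_reflexive[OF P] unfolding reflexive_iff[OF PM] by blast
    then have y2: "\<xi> (\<rho> g) = g y" if "g \<in> mod_hom A P ?r" for g
      using y(2)[OF that] that by (simp add: compose_def)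
    have "h (q y) = \<zero>\<^bsub>A\<^esub>" if h: "h \<in> mod_hom A N ?r" for h
    proof -
      let ?h = "compose (carrier P) h q"
      have h': "?h \<in> mod_hom A P ?r" by (rule mod_hom_compose[OF PM q h])
      have "\<rho> ?h = \<zero>\<^bsub>dual A L\<^esub>"
      proof (rule mod_hom_ext[of _ A L ?r _ ?r])
        show "\<rho> ?h \<in> mod_hom A L ?r" using mod_hom_closed[OF \<rho>] h' by simp
        show "\<zero>\<^bsub>dual A L\<^esub> \<in> mod_hom A L ?r"
          using zero_functional[OF L] by simp
        fix x assume x: "x \<in> carrier L"
        show "\<rho> ?h x = \<zero>\<^bsub>dual A L\<^esub> x"
          using \<rho>_app[OF h' x] LP[OF x] x mod_hom_zero[OF N left_module_regular[OF P.R.ring_axioms] h]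
          by (simp add: compose_def)
      qed
      then have "\<xi> (\<rho> ?h) = \<zero>\<^bsub>A\<^esub>"
        using mod_hom_zero[OF D(2) left_module_regular \<xi>] ring_op_ring[OF P.R.ring_axioms] by simp
      then show ?thesis using y2[OF h'] y(1) by (simp add: compose_def)
    qed
    then have "q y = \<zero>\<^bsub>N\<^esub>" by (rule torsionless[OF mod_hom_closed[OF q y(1)]])
    then have yL: "y \<in> carrier L" using y(1) by (simp add: L_def hom_kernel_def)
    have "\<xi> f = f y" if f: "f \<in> mod_hom A L ?r" for f
    proof -
      obtain g where g: "g \<in> mod_hom A P ?r" "\<forall>x\<in>carrier L. g x = f x" using ext[OF f] by blast
      have "\<rho> g = f"
        using g by (simp add: \<rho>_def mod_hom_restrict_eq[OF f])
      then show ?thesis using y2[OF g(1)] g(2) yL by simp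
    qed
    then show "\<exists>x\<in>carrier L. \<forall>f\<in>mod_hom A L ?r. \<xi> f = f x" using yL by blast
  qed
qed

text \<open>
  Because functionals extend from \<open>K\<close> to \<open>P\<close>, dualising gives a short exact sequence
  \<open>0 \<rightarrow> M\<^sup>* \<rightarrow> P\<^sup>* \<rightarrow> K\<^sup>* \<rightarrow> 0\<close>.  Dimension shifting along it shows that \<open>M\<^sup>*\<close> is semi-Gorenstein-projective
  and that functionals extend from \<open>M\<^sup>*\<close> to \<open>P\<^sup>*\<close>.  So a second dualisation is exact as well, and the five
  lemma for \<open>0 \<rightarrow> K \<rightarrow> P \<rightarrow> M \<rightarrow> 0\<close> and its bidual turns the reflexivity of \<open>K\<close> and \<open>P\<close> into that of \<open>M\<close>.
\<close>

lemma reflexive_cokernel: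
  assumes A: "left_noetherian (op_ring A)"
    and M: "left_module A M" "fin_gen A M" and P: "fg_projective A P"
    and p: "p \<in> mod_hom A P M" "p ` carrier P = carrier M"
    and K_def: "K = P\<lparr>carrier := hom_kernel P M p\<rparr>"
    and ext: "\<And>f. f \<in> functionals A K \<Longrightarrow>
      \<exists>g\<in>functionals A P. \<forall>x\<in>carrier K. g x = f x"
    and K_refl: "reflexive A K"
    and K_dual: "semi_gorenstein_projective (op_ring A) (dual A K)"
  shows "reflexive A M" "semi_gorenstein_projective (op_ring A) (dual A M)"
proof -
  let ?r = "regular_module A" and ?ro = "regular_module (op_ring A)"
  have PM: "left_module A P" by (rule fg_projective_module[OF P])
  interpret P: left_module A P by fact
  have sub: "submodule (hom_kernel P M p) A P" by (rule submodule_kernel[OF PM M(1) p(1)])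
  have K: "left_module A K" unfolding K_def by (rule P.left_module_submodule[OF sub])
  have KP: "x \<in> carrier P" "p x = \<zero>\<^bsub>M\<^esub>" if "x \<in> carrier K" for x
    using that by (auto simp: K_def hom_kernel_def)
  have carK: "carrier K = hom_kernel P M p" by (simp add: K_def)
  have reg: "left_module A ?r" by (rule left_module_regular[OF P.R.ring_axioms])
  have rego: "left_module (op_ring A) ?ro"
    by (rule left_module_regular[OF ring_op_ring[OF P.R.ring_axioms]])
  define \<rho> where "\<rho> = (\<lambda>g\<in>carrier (dual A P). restrict g (carrier K))"
  have \<rho>: "\<rho> \<in> mod_hom (op_ring A) (dual A P) (dual A K)"
    unfolding \<rho>_def carK unfolding K_def by (rule restriction_hom[OF PM sub])
  have \<rho>_app: "\<rho> g x = g x" if "g \<in> mod_hom A P ?r" "x \<in> carrier K" for g x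
    using that by (simp add: \<rho>_def)
  have DP: "left_module (op_ring A) (dual A P)" and DK: "left_module (op_ring A) (dual A K)"
    and DM: "left_module (op_ring A) (dual A M)"
    by (intro right_module_dual PM K M)+
  have \<rho>_surj: "\<rho> ` carrier (dual A P) = carrier (dual A K)"
  proof (intro subset_antisym subsetI)
    fix f assume "f \<in> carrier (dual A K)"
    then have f: "f \<in> mod_hom A K ?r" by simp
    obtain g where g: "g \<in> mod_hom A P ?r" "\<forall>x\<in>carrier K. g x = f x" using ext[OF f] by blast
    have "\<rho> g = f"
      using g by (simp add: \<rho>_def mod_hom_restrict_eq[OF f])
    then show "f \<in> \<rho> ` carrier (dual A P)" using g(1) by auto
  qed (use mod_hom_closed[OF \<rho>] in blast)
  have \<rho>_zero: "\<rho> g = \<zero>\<^bsub>dual A K\<^esub> \<longleftrightarrow> (\<forall>x\<in>carrier K. g x = \<zero>\<^bsub>A\<^esub>)" if "g \<in> mod_hom A P ?r" for g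
    using that by (auto simp: \<rho>_def fun_eq_iff restrict_def)
  let ?N = "(dual A P)\<lparr>carrier := hom_kernel (dual A P) (dual A K) \<rho>\<rparr>"
  \<comment> \<open>\<open>\<pi>\<close> is the dual of \<open>p\<close>; it identifies \<open>M\<^sup>*\<close> with the kernel of restriction to \<open>K\<close>.\<close>
  define \<pi> where "\<pi> = (\<lambda>f\<in>carrier (dual A M). compose (carrier P) f p)"
  have \<pi>_app: "\<pi> f x = f (p x)" if "f \<in> mod_hom A M ?r" "x \<in> carrier P" for f x
    using that by (simp add: \<pi>_def compose_def)
  have \<pi>P: "\<pi> \<in> mod_hom (op_ring A) (dual A M) (dual A P)"
    unfolding \<pi>_def by (rule dual_map_hom[OF PM M(1) p(1)])
  have \<pi>c: "\<pi> f \<in> mod_hom A P ?r" if "f \<in> mod_hom A M ?r" for f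
    using mod_hom_closed[OF \<pi>P, of f] that by simp
  have \<pi>_ker: "\<pi> f \<in> carrier ?N" if f: "f \<in> mod_hom A M ?r" for f
  proof -
    have "\<pi> f x = \<zero>\<^bsub>A\<^esub>" if "x \<in> carrier K" for x
      using \<pi>_app[OF f KP(1)[OF that]] KP(2)[OF that] mod_hom_zero[OF M(1) reg f] by simp
    then show ?thesis using \<rho>_zero[OF \<pi>c[OF f]] \<pi>c[OF f] by (simp add: hom_kernel_def)
  qed
  have \<pi>: "\<pi> \<in> mod_hom (op_ring A) (dual A M) ?N"
    using \<pi>P by (rule mod_hom_codomain) (use \<pi>_ker in auto)
  have \<pi>_im: "\<exists>f\<in>mod_hom A M ?r. \<pi> f = g" if g: "g \<in> carrier ?N" for g
  proof -
    have gP: "g \<in> mod_hom A P ?r" and "\<rho> g = \<zero>\<^bsub>dual A K\<^esub>" using g by (auto simp: hom_kernel_def)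
    then have gK: "g x = \<zero>\<^bsub>A\<^esub>" if "x \<in> carrier K" for x using that \<rho>_zero[OF gP] by blast
    obtain f where f: "f \<in> mod_hom A M ?r" "\<And>x. x \<in> carrier P \<Longrightarrow> f (p x) = g x"
    proof (rule mod_hom_factor[OF PM M(1) reg p gP])
      show "g x = \<zero>\<^bsub>?r\<^esub>" if "x \<in> carrier P" "p x = \<zero>\<^bsub>M\<^esub>" for x
        using gK[of x] that by (simp add: K_def hom_kernel_def)
    qed blast
    have "\<pi> f = g"
      using \<pi>c[OF f(1)] gP \<pi>_app[OF f(1)] f(2) by (intro mod_hom_ext[of _ A P ?r _ ?r]) auto
    with f(1) show ?thesis by blast
  qed
  have \<pi>_inj: "inj_on \<pi> (carrier (dual A M))"
  proof (rule inj_onI)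
    fix f g assume fg: "f \<in> carrier (dual A M)" "g \<in> carrier (dual A M)" "\<pi> f = \<pi> g"
    have "f (p x) = g (p x)" if "x \<in> carrier P" for x
      using fg \<pi>_app[of f x] \<pi>_app[of g x] that by simp
    then have "f x = g x" if "x \<in> carrier M" for x using that p(2) by (metis imageE)
    then show "f = g" using fg by (intro mod_hom_ext[of f A M ?r g ?r]) auto
  qed
  have \<pi>_bij: "bij_betw \<pi> (carrier (dual A M)) (carrier ?N)"
    unfolding bij_betw_def using \<pi>_inj \<pi>_ker \<pi>_im by (auto simp del: partial_object.simps simp: image_iff)
  have N: "left_module (op_ring A) ?N"
    by (rule left_module.left_module_submodule[OF DP submodule_kernel[OF DP DK \<rho>]])
  have shift: "semi_gorenstein_projective (op_ring A) (dual A K) \<longleftrightarrow>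
    (\<forall>f\<in>mod_hom (op_ring A) ?N ?ro. \<exists>g\<in>mod_hom (op_ring A) (dual A P) ?ro. \<forall>x\<in>carrier ?N. g x = f x) \<and>
    semi_gorenstein_projective (op_ring A) ?N"
    by (rule semi_gorenstein_projective_syzygy[OF A DK fg_projective_dual[OF P] \<rho> \<rho>_surj refl])
  then show "semi_gorenstein_projective (op_ring A) (dual A M)"
    using K_dual semi_gorenstein_projective_iso[OF A DM fin_gen_dual[OF A M] N \<pi> \<pi>_bij] by blast
  show "reflexive A M" unfolding reflexive_iff[OF M(1)]
  proof (intro conjI ballI impI)
    fix m assume m: "m \<in> carrier M" and z: "\<forall>f\<in>mod_hom A M ?r. f m = \<zero>\<^bsub>A\<^esub>"
    obtain x where x: "x \<in> carrier P" "m = p x" using m p(2) by blast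
    \<comment> \<open>Evaluation at \<open>x\<close> factors through \<open>K\<^sup>*\<close>, so it is evaluation at some \<open>k\<close> in \<open>K\<close>, and \<open>x = k\<close>.\<close>
    have ker: "eval_map A P x g = \<zero>\<^bsub>?ro\<^esub>" if "g \<in> carrier (dual A P)" "\<rho> g = \<zero>\<^bsub>dual A K\<^esub>" for g
    proof -
      have "g \<in> carrier ?N" using that by (simp add: hom_kernel_def)
      then obtain f where f: "f \<in> mod_hom A M ?r" "\<pi> f = g" using \<pi>_im by blast
      have "g x = f m" using \<pi>_app[OF f(1) x(1)] f(2) x(2) by simp
      then show ?thesis using z f(1) x(1) that(1) by simp
    qed
    obtain \<zeta> where \<zeta>: "\<zeta> \<in> mod_hom (op_ring A) (dual A K) ?ro"
      "\<And>g. g \<in> carrier (dual A P) \<Longrightarrow> \<zeta> (\<rho> g) = eval_map A P x g"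
      by (rule mod_hom_factor[OF DP DK rego \<rho> \<rho>_surj eval_map_closed[OF PM x(1)] ker])
        (assumption, assumption, rule that, assumption, simp)
    obtain k where k: "k \<in> carrier K" "\<And>f. f \<in> mod_hom A K ?r \<Longrightarrow> \<zeta> f = f k"
      by (rule reflexive_eval[OF K_refl K \<zeta>(1)]) (rule that, assumption, simp)
    note kP = KP[OF k(1)]
    have "g (x \<ominus>\<^bsub>P\<^esub> k) = \<zero>\<^bsub>A\<^esub>" if g: "g \<in> mod_hom A P ?r" for g
    proof -
      have "\<rho> g \<in> mod_hom A K ?r" using mod_hom_closed[OF \<rho>] g by simp
      then have "g x = g k" using \<zeta>(2)[of g] k(2) \<rho>_app[OF g k(1)] g x(1) by simp
      then show ?thesis
        using mod_hom_diff[OF PM reg g x(1) kP(1)] mod_hom_closed[OF g kP(1)]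
        by (simp add: P.R.diff_eq_zero_iff)
    qed
    then have "x \<ominus>\<^bsub>P\<^esub> k = \<zero>\<^bsub>P\<^esub>" using x(1) kP(1) by (intro projective_separated[OF P]) auto
    then show "m = \<zero>\<^bsub>M\<^esub>" using x kP by (simp add: P.M.diff_eq_zero_iff)
  next
    fix \<xi> assume \<xi>: "\<xi> \<in> mod_hom (op_ring A) (dual A M) ?ro"
    obtain \<sigma> where \<sigma>: "\<sigma> \<in> mod_hom (op_ring A) (?N\<lparr>carrier := \<pi> ` carrier (dual A M)\<rparr>) (dual A M)"
      "\<And>f. f \<in> carrier (dual A M) \<Longrightarrow> \<sigma> (\<pi> f) = f"
      by (rule mod_hom_inverse[OF DM N \<pi> \<pi>_inj]) blast
    have "\<pi> ` carrier (dual A M) = hom_kernel (dual A P) (dual A K) \<rho>"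
      using \<pi>_bij by (simp add: bij_betw_def)
    then have \<sigma>N: "\<sigma> \<in> mod_hom (op_ring A) ?N (dual A M)" using \<sigma>(1) by simp
    obtain \<Xi> where \<Xi>: "\<Xi> \<in> mod_hom (op_ring A) (dual A P) ?ro"
      "\<forall>g\<in>carrier ?N. \<Xi> g = compose (carrier ?N) \<xi> \<sigma> g"
      using shift K_dual mod_hom_compose[OF N \<sigma>N \<xi>] by blast
    obtain x where x: "x \<in> carrier P" "\<And>g. g \<in> mod_hom A P ?r \<Longrightarrow> \<Xi> g = g x"
      by (rule reflexive_eval[OF projective_reflexive[OF P] PM \<Xi>(1)]) (rule that, assumption, simp)
    have "\<xi> f = f (p x)" if f: "f \<in> mod_hom A M ?r" for f
    proof -
      have "\<Xi> (\<pi> f) = \<xi> (\<sigma> (\<pi> f))"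
        using \<Xi>(2)[rule_format, OF \<pi>_ker[OF f]] \<pi>_ker[OF f] by (simp add: compose_def)
      then have "\<xi> f = \<Xi> (\<pi> f)" using \<sigma>(2) f by simp
      also have "\<dots> = f (p x)" using x(2)[OF \<pi>c[OF f]] \<pi>_app[OF f x(1)] by simp
      finally show ?thesis .
    qed
    then show "\<exists>x\<in>carrier M. \<forall>f\<in>mod_hom A M ?r. \<xi> f = f x"
      using mod_hom_closed[OF p(1) x(1)] by blast
  qed
qed

section \<open>A criterion for Gorenstein-projectivity\<close>

text \<open>
  Let \<open>P\<close> resolve \<open>M\<close> and \<open>S\<close> resolve \<open>M\<^sup>*\<close>.  As \<open>M\<^sup>*\<close> is semi-Gorenstein-projective, the dual of \<open>S\<close> is
  a coresolution of \<open>M\<^sup>*\<^sup>*\<close>, which is \<open>M\<close> by reflexivity.  Splicing it to \<open>P\<close> along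
  \<open>P\<^sub>0 \<rightarrow> M \<rightarrow> S\<^sub>0\<^sup>*\<close> gives a doubly infinite exact sequence of projectives in which \<open>M\<close> is an image.
  Its dual is exact on the left half because \<open>M\<close> is semi-Gorenstein-projective, and on the right half
  because there it is \<open>S\<close> again, projectives being reflexive.
\<close>

lemma gorenstein_projective_criterion:
  fixes A :: "('a, 'x) ring_scheme"
  assumes A: "left_noetherian A"
    and Ao: "left_noetherian (op_ring A)"
    and M: "left_module A M" "fin_gen A M"
    and G1: "semi_gorenstein_projective A M"
    and G2: "semi_gorenstein_projective (op_ring A) (dual A M)"
    and G3: "reflexive A M"
  shows "gorenstein_projective A M"
proof -
  let ?r = "regular_module A" and ?ro = "regular_module (op_ring A)"
  interpret M: left_module A M by fact
  have reg: "left_module A ?r" by (rule left_module_regular[OF M.R.ring_axioms])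
  have rego: "left_module (op_ring A) ?ro"
    by (rule left_module_regular[OF ring_op_ring[OF M.R.ring_axioms]])
  have DM: "left_module (op_ring A) (dual A M)" by (rule right_module_dual[OF M(1)])
  obtain P :: "nat \<Rightarrow> ('a, nat \<Rightarrow> 'a) module" and d e where P: "projective_resolution A M P d e"
    by (rule projective_resolution_exists[OF A M])
  obtain S :: "nat \<Rightarrow> ('a, nat \<Rightarrow> 'a) module" and \<delta> \<epsilon>
    where S: "projective_resolution (op_ring A) (dual A M) S \<delta> \<epsilon>"
    by (rule projective_resolution_exists[OF Ao DM fin_gen_dual[OF Ao M]])
  note p = projective_resolutionD[OF P] and s = projective_resolutionD[OF S]
  have Pac: "dual_acyclic A P d" using semi_gorenstein_projective_iff[OF M(1) P] G1 by blast
  have Sac: "dual_acyclic (op_ring A) S \<delta>" using semi_gorenstein_projective_iff[OF DM S] G2 by blast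
  have \<epsilon>c: "\<epsilon> x \<in> mod_hom A M ?r" if "x \<in> carrier (S 0)" for x
    using mod_hom_closed[OF s(4) that] by simp
  have \<delta>c: "\<delta> n x \<in> carrier (S n)" if "x \<in> carrier (S (Suc n))" for n x
    by (rule mod_hom_closed[OF s(3) that])
  let ?V = "\<lambda>n. dual (op_ring A) (S n)"
  have V: "left_module A (?V n)" for n by (rule left_module_dual_op[OF s(2)])
  have Vproj: "fg_projective A (?V n)" for n
    using fg_projective_dual[OF s(1)[of n]] by simp
  have "\<forall>n. \<exists>T :: ('a, nat \<Rightarrow> 'a) module. \<exists>i j. fg_projective A T \<and> i \<in> mod_hom A (?V n) T \<and>
      j \<in> mod_hom A T (?V n) \<and> (\<forall>u\<in>carrier (?V n). j (i u) = u) \<and> (\<forall>y\<in>carrier T. i (j y) = y)"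
    by (rule allI, rule fg_projective_transport[OF Vproj]) blast
  then obtain T :: "nat \<Rightarrow> ('a, nat \<Rightarrow> 'a) module" and i j where
    T: "\<And>n. fg_projective A (T n)" and i: "\<And>n. i n \<in> mod_hom A (?V n) (T n)"
    and j: "\<And>n. j n \<in> mod_hom A (T n) (?V n)"
    and ji': "\<And>n. \<forall>u\<in>carrier (?V n). j n (i n u) = u" and ij': "\<And>n. \<forall>y\<in>carrier (T n). i n (j n y) = y"
    by metis
  have ji: "j n (i n u) = u" if "u \<in> carrier (?V n)" for n u using ji' that by blast
  have ij: "i n (j n y) = y" if "y \<in> carrier (T n)" for n y using ij' that by blast
  have TM: "left_module A (T n)" for n by (rule fg_projective_module[OF T])
  have ic: "i n u \<in> carrier (T n)" if "u \<in> carrier (?V n)" for n u by (rule mod_hom_closed[OF i that])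
  have jc: "j n y \<in> carrier (?V n)" if "y \<in> carrier (T n)" for n y by (rule mod_hom_closed[OF j that])
  have i0: "i n u = \<zero>\<^bsub>T n\<^esub> \<longleftrightarrow> (\<forall>x\<in>carrier (S n). u x = \<zero>\<^bsub>A\<^esub>)" if u: "u \<in> carrier (?V n)" for n u
  proof -
    have zc: "\<zero>\<^bsub>?V n\<^esub> \<in> carrier (?V n)"
      using zero_functional[OF s(2)[of n]] by simp
    have "i n u = \<zero>\<^bsub>T n\<^esub> \<longleftrightarrow> u = \<zero>\<^bsub>?V n\<^esub>"
      using ji[OF u] ji[OF zc] mod_hom_zero[OF V TM i] by metis
    also have "\<dots> \<longleftrightarrow> (\<forall>x\<in>carrier (S n). u x = \<zero>\<^bsub>A\<^esub>)"
      using mod_hom_ext[of u "op_ring A" "S n" ?ro "\<zero>\<^bsub>?V n\<^esub>" ?ro] u zc by auto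
    finally show ?thesis .
  qed

  \<comment> \<open>\<open>D\<close> is the dual \<open>\<delta>'\<close> of \<open>\<delta>\<close> carried to the copies \<open>T n\<close> of the duals of the terms of \<open>S\<close>.\<close>
  define \<delta>' where "\<delta>' n = (\<lambda>g\<in>carrier (?V n). compose (carrier (S (Suc n))) g (\<delta> n))" for n
  have \<delta>': "\<delta>' n \<in> mod_hom A (?V n) (?V (Suc n))" for n
    using dual_map_hom[OF s(2) s(2) s(3)] by (simp add: \<delta>'_def)
  have \<delta>'c: "\<delta>' n g \<in> carrier (?V (Suc n))" if "g \<in> carrier (?V n)" for n g
    by (rule mod_hom_closed[OF \<delta>' that])
  have \<delta>'_app: "\<delta>' n g x = g (\<delta> n x)" if "g \<in> carrier (?V n)" "x \<in> carrier (S (Suc n))" for n g x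
    using that by (simp add: \<delta>'_def compose_def)
  define D where "D n = compose (carrier (T n)) (compose (carrier (?V n)) (i (Suc n)) (\<delta>' n)) (j n)" for n
  have D: "D n \<in> mod_hom A (T n) (T (Suc n))" for n
    unfolding D_def by (intro mod_hom_compose[OF TM j] mod_hom_compose[OF V \<delta>' i])
  have D_app: "D n y = i (Suc n) (\<delta>' n (j n y))" if "y \<in> carrier (T n)" for n y
    using that jc[OF that] by (simp add: D_def compose_def)

  \<comment> \<open>\<open>\<beta>\<close> is the evaluation map of \<open>M\<close> followed by the dual of \<open>\<epsilon>\<close>, and \<open>b\<close> is the splicing map.\<close>
  define \<epsilon>' where "\<epsilon>' = (\<lambda>\<xi>\<in>carrier (dual (op_ring A) (dual A M)). compose (carrier (S 0)) \<xi> \<epsilon>)"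
  have \<epsilon>': "\<epsilon>' \<in> mod_hom A (dual (op_ring A) (dual A M)) (?V 0)"
    using dual_map_hom[OF s(2) DM s(4)] by (simp add: \<epsilon>'_def)
  define \<beta> where "\<beta> = compose (carrier M) \<epsilon>' (eval_map A M)"
  have \<beta>: "\<beta> \<in> mod_hom A M (?V 0)"
    unfolding \<beta>_def by (rule mod_hom_compose[OF M(1) eval_map_hom[OF M(1)] \<epsilon>'])
  have \<beta>c: "\<beta> m \<in> carrier (?V 0)" if "m \<in> carrier M" for m by (rule mod_hom_closed[OF \<beta> that])
  have \<beta>_app: "\<beta> m x = \<epsilon> x m" if "m \<in> carrier M" "x \<in> carrier (S 0)" for m x
    using that mod_hom_closed[OF eval_map_hom[OF M(1)] that(1)] \<epsilon>c[OF that(2)]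
    by (simp add: \<beta>_def \<epsilon>'_def compose_def)
  define c where "c = compose (carrier M) (i 0) \<beta>"
  have c: "c \<in> mod_hom A M (T 0)" unfolding c_def by (rule mod_hom_compose[OF M(1) \<beta> i])
  have c_app: "c m = i 0 (\<beta> m)" if "m \<in> carrier M" for m using that by (simp add: c_def compose_def)
  have c0: "c m = \<zero>\<^bsub>T 0\<^esub> \<longleftrightarrow> m = \<zero>\<^bsub>M\<^esub>" if m: "m \<in> carrier M" for m
  proof
    assume "c m = \<zero>\<^bsub>T 0\<^esub>"
    then have z: "\<epsilon> x m = \<zero>\<^bsub>A\<^esub>" if "x \<in> carrier (S 0)" for x
      using c_app[OF m] i0[OF \<beta>c[OF m]] \<beta>_app[OF m that] that by simp
    have "f m = \<zero>\<^bsub>A\<^esub>" if "f \<in> mod_hom A M ?r" for f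
    proof -
      have "f \<in> \<epsilon> ` carrier (S 0)" using s(5) that by simp
      then show ?thesis using z by blast
    qed
    then show "m = \<zero>\<^bsub>M\<^esub>" using G3 m unfolding reflexive_iff[OF M(1)] by blast
  qed (use mod_hom_zero[OF M(1) TM c] in simp)
  define b where "b = compose (carrier (P 0)) c e"
  have b: "b \<in> mod_hom A (P 0) (T 0)" unfolding b_def by (rule mod_hom_compose[OF p(2) p(4) c])
  have b_app: "b x = c (e x)" if "x \<in> carrier (P 0)" for x using that by (simp add: b_def compose_def)
  have ec: "e x \<in> carrier M" if "x \<in> carrier (P 0)" for x by (rule mod_hom_closed[OF p(4) that])
  have b_im: "b ` carrier (P 0) = c ` carrier M"
    unfolding p(5)[symmetric] image_image by (rule image_cong) (auto simp: b_app)

  \<comment> \<open>The terms in degrees at most \<open>0\<close> come from \<open>P\<close>, those in degrees from \<open>1\<close> on from \<open>S\<close>.\<close>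
  define Q where "Q k = (if k \<le> 0 then P (nat (- k)) else T (nat (k - 1)))" for k :: int
  define bd where "bd k = (if k < 0 then d (nat (- k - 1)) else if k = 0 then b else D (nat (k - 1)))" for k :: int
  have Q_neg: "Q (- int n - 1) = P (Suc n)" "Q (- int n) = P n" "Q (- int n - 1 - 1) = P (Suc (Suc n))"
    "Q (- int n - 1 + 1) = P n" for n
    by (simp_all add: Q_def nat_add_distrib nat_diff_distrib Suc_nat_eq_nat_zadd1)
  have Q_0: "Q 0 = P 0" "Q 1 = T 0" "Q (- 1) = P (Suc 0)" by (simp_all add: Q_def)
  have Q_pos: "Q (int n + 1) = T n" "Q (int n + 1 + 1) = T (Suc n)" for n
    by (simp_all add: Q_def nat_add_distrib)
  have bd_neg: "bd (- int n - 1) = d n" "bd (- int n - 1 - 1) = d (Suc n)" for n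
    by (simp_all add: bd_def nat_add_distrib Suc_nat_eq_nat_zadd1)
  have bd_0: "bd 0 = b" "bd (- 1) = d 0" by (simp_all add: bd_def)
  have bd_pos: "bd (int n + 1) = D n" for n by (simp add: bd_def)
  have cases_int: "(\<And>n. k = - int n - 1 \<Longrightarrow> X) \<Longrightarrow> (k = 0 \<Longrightarrow> X) \<Longrightarrow>
      (k = 1 \<Longrightarrow> X) \<Longrightarrow> (\<And>n. k = int (Suc n) + 1 \<Longrightarrow> X) \<Longrightarrow> X" for k :: int and X
  proof -
    assume 1: "\<And>n. k = - int n - 1 \<Longrightarrow> X" and 2: "k = 0 \<Longrightarrow> X" and 3: "k = 1 \<Longrightarrow> X"
      and 4: "\<And>n. k = int (Suc n) + 1 \<Longrightarrow> X"
    consider "k < 0" | "k = 0" | "k = 1" | "k > 1" by linarith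
    then show X
    proof cases
      case 1 then show X using \<open>\<And>n. k = - int n - 1 \<Longrightarrow> X\<close>[of "nat (- k - 1)"] by simp
    next
      case 4 then show X using \<open>\<And>n. k = int (Suc n) + 1 \<Longrightarrow> X\<close>[of "nat (k - 2)"] by simp
    qed (use 2 3 in auto)
  qed
  have Q: "fg_projective A (Q k)" for k by (simp add: Q_def p(1) T)
  have QM: "left_module A (Q k)" for k by (rule fg_projective_module[OF Q])
  have bd: "bd k \<in> mod_hom A (Q k) (Q (k + 1))" for k
  proof (rule cases_int[of k])
    fix n assume "k = - int n - 1"
    then show ?thesis using p(3)[of n] by (simp add: Q_neg bd_neg del: One_nat_def)
  next
    fix n assume "k = int (Suc n) + 1"
    then show ?thesis using D[of "Suc n"] by (simp only: Q_pos bd_pos)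
  next
    assume "k = 0" then show ?thesis using b by (simp add: Q_0 bd_0)
  next
    assume "k = 1" then show ?thesis using D[of 0] Q_pos[of 0] bd_pos[of 0] by simp
  qed

  have ex_P0: "d 0 ` carrier (P (Suc 0)) = hom_kernel (P 0) (T 0) b"
    unfolding p(6) using c0[OF ec] c0[OF M.M.zero_closed] b_app by (auto simp: hom_kernel_def)
  have ex_T0: "b ` carrier (P 0) = hom_kernel (T 0) (T (Suc 0)) (D 0)"
  proof (intro subset_antisym subsetI)
    fix y assume "y \<in> b ` carrier (P 0)"
    then obtain m where m: "m \<in> carrier M" "y = i 0 (\<beta> m)" unfolding b_im using c_app by auto
    have "\<delta>' 0 (\<beta> m) x = \<zero>\<^bsub>A\<^esub>" if "x \<in> carrier (S (Suc 0))" for x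
      using that m(1) by (simp add: \<delta>'_app[OF \<beta>c] \<beta>_app \<delta>c s(8))
    then have "i (Suc 0) (\<delta>' 0 (\<beta> m)) = \<zero>\<^bsub>T (Suc 0)\<^esub>" using i0[OF \<delta>'c[OF \<beta>c[OF m(1)]]] by blast
    then show "y \<in> hom_kernel (T 0) (T (Suc 0)) (D 0)"
      using m ic[OF \<beta>c[OF m(1)]] by (simp add: hom_kernel_def D_app ji[OF \<beta>c])
  next
    fix y assume "y \<in> hom_kernel (T 0) (T (Suc 0)) (D 0)"
    then have y: "y \<in> carrier (T 0)" "i (Suc 0) (\<delta>' 0 (j 0 y)) = \<zero>\<^bsub>T (Suc 0)\<^esub>"
      using D_app by (auto simp: hom_kernel_def)
    let ?u = "j 0 y"
    have u: "?u \<in> mod_hom (op_ring A) (S 0) ?ro" using jc[OF y(1)] by simp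
    have uz: "?u (\<delta> 0 x) = \<zero>\<^bsub>A\<^esub>" if "x \<in> carrier (S (Suc 0))" for x
      using y(2) i0[OF \<delta>'c[OF jc[OF y(1)]]] \<delta>'_app[OF jc[OF y(1)] that] that by simp
    have ker: "?u x = \<zero>\<^bsub>?ro\<^esub>" if "x \<in> carrier (S 0)" "\<epsilon> x = \<zero>\<^bsub>dual A M\<^esub>" for x
    proof -
      have "x \<in> \<delta> 0 ` carrier (S (Suc 0))" unfolding s(6) hom_kernel_def using that by simp
      then show ?thesis using uz by auto
    qed
    obtain \<xi> where \<xi>: "\<xi> \<in> mod_hom (op_ring A) (dual A M) ?ro"
      "\<And>x. x \<in> carrier (S 0) \<Longrightarrow> \<xi> (\<epsilon> x) = ?u x"
      by (rule mod_hom_factor[OF s(2) DM rego s(4) s(5) u ker])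
        (assumption, assumption, rule that, assumption, simp)
    obtain m where m: "m \<in> carrier M" "\<And>f. f \<in> mod_hom A M ?r \<Longrightarrow> \<xi> f = f m"
      by (rule reflexive_eval[OF G3 M(1) \<xi>(1)]) (rule that, assumption, simp)
    have "\<beta> m = ?u"
      using \<beta>c[OF m(1)] u \<beta>_app[OF m(1)] \<xi>(2) m(2)[OF \<epsilon>c]
      by (intro mod_hom_ext[of "\<beta> m" "op_ring A" "S 0" ?ro ?u ?ro]) auto
    then have "c m = y" using c_app[OF m(1)] ij[OF y(1)] by simp
    then show "y \<in> b ` carrier (P 0)" unfolding b_im using m(1) by blast
  qed
  have ex_T: "D n ` carrier (T n) = hom_kernel (T (Suc n)) (T (Suc (Suc n))) (D (Suc n))" for n
  proof (intro subset_antisym subsetI)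
    fix y assume "y \<in> D n ` carrier (T n)"
    then obtain z where z: "z \<in> carrier (T n)" "y = i (Suc n) (\<delta>' n (j n z))" using D_app by auto
    note v = jc[OF z(1)]
    have "\<delta>' (Suc n) (\<delta>' n (j n z)) x = \<zero>\<^bsub>A\<^esub>" if x: "x \<in> carrier (S (Suc (Suc n)))" for x
    proof -
      have "\<delta>' (Suc n) (\<delta>' n (j n z)) x = j n z \<zero>\<^bsub>S n\<^esub>"
        using \<delta>'_app[OF \<delta>'c[OF v] x] \<delta>'_app[OF v \<delta>c[OF x]] s(9)[OF x] by simp
      also have "\<dots> = \<zero>\<^bsub>A\<^esub>" using mod_hom_zero[OF s(2) rego] v by simp
      finally show ?thesis .
    qed
    then show "y \<in> hom_kernel (T (Suc n)) (T (Suc (Suc n))) (D (Suc n))"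
      using z(2) ic[OF \<delta>'c[OF v]] i0[OF \<delta>'c[OF \<delta>'c[OF v]]]
      by (simp add: hom_kernel_def D_app ji[OF \<delta>'c[OF v]])
  next
    fix y assume "y \<in> hom_kernel (T (Suc n)) (T (Suc (Suc n))) (D (Suc n))"
    then have y: "y \<in> carrier (T (Suc n))" "i (Suc (Suc n)) (\<delta>' (Suc n) (j (Suc n) y)) = \<zero>\<^bsub>T (Suc (Suc n))\<^esub>"
      using D_app by (auto simp: hom_kernel_def)
    let ?u = "j (Suc n) y"
    note v = jc[OF y(1)]
    have u: "?u \<in> mod_hom (op_ring A) (S (Suc n)) ?ro" using v by simp
    have uz: "?u (\<delta> (Suc n) x) = \<zero>\<^bsub>op_ring A\<^esub>" if "x \<in> carrier (S (Suc (Suc n)))" for x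
      using y(2) i0[OF \<delta>'c[OF v]] \<delta>'_app[OF v that] that by simp
    obtain g where g: "g \<in> mod_hom (op_ring A) (S n) ?ro"
      "\<And>x. x \<in> carrier (S (Suc n)) \<Longrightarrow> g (\<delta> n x) = ?u x"
      by (rule dual_acyclicD[OF Sac u, OF uz]) (assumption, rule that, assumption, simp)
    have gV: "g \<in> carrier (?V n)" using g(1) by simp
    have "\<delta>' n g = ?u"
      using \<delta>'c[OF gV] u \<delta>'_app[OF gV] g(2)
      by (intro mod_hom_ext[of "\<delta>' n g" "op_ring A" "S (Suc n)" ?ro ?u ?ro]) auto
    then have "D n (i n g) = y" using D_app[OF ic[OF gV]] ji[OF gV] ij[OF y(1)] by simp
    then show "y \<in> D n ` carrier (T n)" using ic[OF gV] by blast
  qed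
  have exact: "bd (k - 1) ` carrier (Q (k - 1)) = hom_kernel (Q k) (Q (k + 1)) (bd k)" for k
  proof (rule cases_int[of k])
    fix n assume "k = - int n - 1"
    then show ?thesis using p(7)[of n] by (simp only: Q_neg bd_neg)
  next
    fix n assume k: "k = int (Suc n) + 1"
    then have "k - 1 = int n + 1" by simp
    then show ?thesis unfolding k using ex_T[of n] by (simp only: Q_pos bd_pos)
  next
    assume "k = 0" then show ?thesis using ex_P0 by (simp add: Q_0 bd_0)
  next
    assume "k = 1" then show ?thesis using ex_T0 Q_pos[of 1] bd_pos[of 0] by (simp add: Q_0 bd_0 Q_pos(2)[of 0, simplified])
  qed
  have bd_bd: "bd k (bd (k - 1) x) = \<zero>\<^bsub>Q (k + 1)\<^esub>" if "x \<in> carrier (Q (k - 1))" for k x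
  proof -
    have "bd (k - 1) x \<in> hom_kernel (Q k) (Q (k + 1)) (bd k)"
      unfolding exact[symmetric] using that by (rule imageI)
    then show ?thesis by (simp add: hom_kernel_def)
  qed

  \<comment> \<open>Functionals on \<open>T n\<close> are evaluations at elements of \<open>S n\<close>; those at elements \<open>\<delta> x\<close> extend.\<close>
  have eval_ext: "\<exists>g\<in>mod_hom A (T (Suc n)) ?r. \<forall>y\<in>carrier (T n). g (D n y) = f y"
    if f: "f \<in> mod_hom A (T n) ?r" and x: "x \<in> carrier (S (Suc n))"
      and fx: "\<And>u. u \<in> carrier (?V n) \<Longrightarrow> f (i n u) = u (\<delta> n x)" for n f x
  proof -
    have ev: "eval_map (op_ring A) (S (Suc n)) x \<in> mod_hom A (?V (Suc n)) ?r"
      using eval_map_closed[OF s(2) x] by simp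
    let ?g = "compose (carrier (T (Suc n))) (eval_map (op_ring A) (S (Suc n)) x) (j (Suc n))"
    have "?g (D n y) = f y" if y: "y \<in> carrier (T n)" for y
    proof -
      note v = jc[OF y] and w = \<delta>'c[OF jc[OF y]]
      have "?g (D n y) = eval_map (op_ring A) (S (Suc n)) x (\<delta>' n (j n y))"
        using ic[OF w] by (simp add: compose_def D_app[OF y] ji[OF w])
      also have "\<dots> = j n y (\<delta> n x)" using x w \<delta>'_app[OF v x] by simp
      also have "\<dots> = f y" using fx[OF v] ij[OF y] by simp
      finally show ?thesis .
    qed
    then show ?thesis using mod_hom_compose[OF TM j ev] by blast
  qed
  have eval_T: "\<exists>x\<in>carrier (S n). \<forall>u\<in>carrier (?V n). f (i n u) = u x"
    if f: "f \<in> mod_hom A (T n) ?r" for n f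
  proof -
    have "compose (carrier (?V n)) f (i n) \<in> functionals (op_ring (op_ring A)) (?V n)"
      using mod_hom_compose[OF V i f] by simp
    then obtain x where x: "x \<in> carrier (S n)"
      "\<And>u. u \<in> mod_hom (op_ring A) (S n) ?ro \<Longrightarrow> compose (carrier (?V n)) f (i n) u = u x"
      using reflexive_eval[OF projective_reflexive[OF s(1)] s(2)] by blast
    then have "f (i n u) = u x" if "u \<in> carrier (?V n)" for u
      using that x(2)[of u] by (simp add: compose_def)
    with x(1) show ?thesis by blast
  qed
  have dual_exact: "\<exists>g\<in>mod_hom A (Q (k + 1)) ?r. \<forall>x\<in>carrier (Q k). g (bd k x) = f x"
    if f: "f \<in> mod_hom A (Q k) ?r" and f0: "\<forall>x\<in>carrier (Q (k - 1)). f (bd (k - 1) x) = \<zero>\<^bsub>A\<^esub>" for k f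
  proof (rule cases_int[of k])
    fix n assume k: "k = - int n - 1"
    show ?thesis
      using Pac f f0 unfolding k Q_neg bd_neg dual_acyclic_def by blast
  next
    assume k: "k = 0"
    have fP: "f \<in> mod_hom A (P 0) ?r" using f by (simp add: k Q_0)
    have fz: "f (d 0 x) = \<zero>\<^bsub>A\<^esub>" if "x \<in> carrier (P (Suc 0))" for x
      using f0 that by (simp add: k Q_0 bd_0)
    have ker: "f x = \<zero>\<^bsub>?r\<^esub>" if "x \<in> carrier (P 0)" "e x = \<zero>\<^bsub>M\<^esub>" for x
    proof -
      have "x \<in> d 0 ` carrier (P (Suc 0))" unfolding p(6) hom_kernel_def using that by simp
      then show ?thesis using fz by auto
    qed
    obtain h where h: "h \<in> mod_hom A M ?r" "\<And>x. x \<in> carrier (P 0) \<Longrightarrow> h (e x) = f x"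
      by (rule mod_hom_factor[OF p(2) M(1) reg p(4) p(5) fP ker])
        (assumption, assumption, rule that, assumption, simp)
    have "h \<in> \<epsilon> ` carrier (S 0)" using s(5) h(1) by simp
    then obtain x where x: "x \<in> carrier (S 0)" "h = \<epsilon> x" by blast
    have ev: "eval_map (op_ring A) (S 0) x \<in> mod_hom A (?V 0) ?r"
      using eval_map_closed[OF s(2) x(1)] by simp
    let ?g = "compose (carrier (T 0)) (eval_map (op_ring A) (S 0) x) (j 0)"
    have "?g (b y) = f y" if y: "y \<in> carrier (P 0)" for y
    proof -
      note w = \<beta>c[OF ec[OF y]]
      have "?g (b y) = eval_map (op_ring A) (S 0) x (\<beta> (e y))"
        using ic[OF w] by (simp add: compose_def b_app[OF y] c_app[OF ec[OF y]] ji[OF w])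
      also have "\<dots> = f y" using x w \<beta>_app[OF ec[OF y] x(1)] h(2)[OF y] by simp
      finally show ?thesis .
    qed
    moreover have "?g \<in> mod_hom A (T 0) ?r" by (rule mod_hom_compose[OF TM j ev])
    ultimately show ?thesis unfolding k by (intro bexI[of _ ?g]) (simp_all add: Q_0 bd_0)
  next
    assume k: "k = 1"
    have fT: "f \<in> mod_hom A (T 0) ?r" using f by (simp add: k Q_0)
    have fz: "f (b x) = \<zero>\<^bsub>A\<^esub>" if "x \<in> carrier (P 0)" for x
      using f0 that by (simp add: k Q_0 bd_0)
    obtain x where x: "x \<in> carrier (S 0)" "\<forall>u\<in>carrier (?V 0). f (i 0 u) = u x"
      using eval_T[OF fT] by blast
    have "\<epsilon> x m = \<zero>\<^bsub>A\<^esub>" if m: "m \<in> carrier M" for m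
    proof -
      have "c m \<in> b ` carrier (P 0)" unfolding b_im using m by (rule imageI)
      then have "f (c m) = \<zero>\<^bsub>A\<^esub>" using fz by auto
      then show ?thesis using x(2)[rule_format, OF \<beta>c[OF m]] \<beta>_app[OF m x(1)] c_app[OF m] by simp
    qed
    then have "\<epsilon> x = \<zero>\<^bsub>dual A M\<^esub>"
      using \<epsilon>c[OF x(1)] mod_hom_ext[of "\<epsilon> x" A M ?r "\<zero>\<^bsub>dual A M\<^esub>" ?r]
        zero_functional[OF M(1)] by simp
    then have "x \<in> \<delta> 0 ` carrier (S (Suc 0))" unfolding s(6) hom_kernel_def using x(1) by simp
    then obtain t where t: "t \<in> carrier (S (Suc 0))" "x = \<delta> 0 t" by blast
    show ?thesis
      using eval_ext[OF fT t(1)] x(2) t(2) Q_pos(2)[of 0] bd_pos[of 0] by (simp add: k Q_0)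
  next
    fix n assume k: "k = int (Suc n) + 1"
    have k1: "k - 1 = int n + 1" using k by simp
    have fT: "f \<in> mod_hom A (T (Suc n)) ?r" using f unfolding k Q_pos .
    have fz: "f (D n y) = \<zero>\<^bsub>A\<^esub>" if "y \<in> carrier (T n)" for y
      using f0 that unfolding k1 Q_pos bd_pos by blast
    obtain x where x: "x \<in> carrier (S (Suc n))" "\<forall>u\<in>carrier (?V (Suc n)). f (i (Suc n) u) = u x"
      using eval_T[OF fT] by blast
    have "u (\<delta> n x) = \<zero>\<^bsub>op_ring A\<^esub>" if "u \<in> mod_hom (op_ring A) (S n) ?ro" for u
    proof -
      have u: "u \<in> carrier (?V n)" using that by simp
      have "f (D n (i n u)) = u (\<delta> n x)"
        using x(2)[rule_format, OF \<delta>'c[OF u]] \<delta>'_app[OF u x(1)] D_app[OF ic[OF u]] ji[OF u] by simp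
      then show ?thesis using fz[OF ic[OF u]] by simp
    qed
    then have "\<delta> n x = \<zero>\<^bsub>S n\<^esub>" by (rule projective_separated[OF s(1) \<delta>c[OF x(1)]])
    then have "x \<in> \<delta> (Suc n) ` carrier (S (Suc (Suc n)))" unfolding s(7) hom_kernel_def using x(1) by simp
    then obtain t where t: "t \<in> carrier (S (Suc (Suc n)))" "x = \<delta> (Suc n) t" by blast
    show ?thesis
      unfolding k Q_pos bd_pos using eval_ext[OF fT t(1)] x(2) t(2) by blast
  qed
  have "complete_resolution A Q bd"
    unfolding complete_resolution_def
  proof (intro conjI allI Q bd exact)
    fix k
    show "(\<lambda>g. compose (carrier (Q k)) g (bd k)) ` mod_hom A (Q (k + 1)) ?r =
      {f \<in> mod_hom A (Q k) ?r. \<forall>x \<in> carrier (Q (k - 1)). f (bd (k - 1) x) = \<zero>\<^bsub>A\<^esub>}"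
    proof (intro subset_antisym subsetI)
      fix f assume "f \<in> (\<lambda>g. compose (carrier (Q k)) g (bd k)) ` mod_hom A (Q (k + 1)) ?r"
      then obtain g where g: "g \<in> mod_hom A (Q (k + 1)) ?r" "f = compose (carrier (Q k)) g (bd k)" by blast
      have "f (bd (k - 1) x) = \<zero>\<^bsub>A\<^esub>" if x: "x \<in> carrier (Q (k - 1))" for x
      proof -
        have "bd (k - 1) x \<in> carrier (Q k)" using mod_hom_closed[OF bd x] by simp
        then show ?thesis using bd_bd[OF x] mod_hom_zero[OF QM reg g(1)] by (simp add: g(2) compose_def)
      qed
      moreover have "f \<in> mod_hom A (Q k) ?r" unfolding g(2) by (rule mod_hom_compose[OF QM bd g(1)])
      ultimately show "f \<in> {f \<in> mod_hom A (Q k) ?r. \<forall>x \<in> carrier (Q (k - 1)). f (bd (k - 1) x) = \<zero>\<^bsub>A\<^esub>}"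
        by simp
    next
      fix f assume "f \<in> {f \<in> mod_hom A (Q k) ?r. \<forall>x \<in> carrier (Q (k - 1)). f (bd (k - 1) x) = \<zero>\<^bsub>A\<^esub>}"
      then have f: "f \<in> mod_hom A (Q k) ?r" "\<forall>x \<in> carrier (Q (k - 1)). f (bd (k - 1) x) = \<zero>\<^bsub>A\<^esub>" by auto
      obtain g where g: "g \<in> mod_hom A (Q (k + 1)) ?r" "\<forall>x\<in>carrier (Q k). g (bd k x) = f x"
        using dual_exact[OF f] by blast
      have "f = compose (carrier (Q k)) g (bd k)"
        using g(2) by (intro mod_hom_ext[OF f(1) mod_hom_compose[OF QM bd g(1)]]) (simp add: compose_def)
      then show "f \<in> (\<lambda>g. compose (carrier (Q k)) g (bd k)) ` mod_hom A (Q (k + 1)) ?r" using g(1) by blast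
    qed
  qed
  moreover have "mod_iso A M ((Q 1)\<lparr>carrier := bd 0 ` carrier (Q 0)\<rparr>)"
    unfolding mod_iso_def Q_0 bd_0 b_im
  proof (intro bexI)
    show "c \<in> mod_hom A M ((T 0)\<lparr>carrier := c ` carrier M\<rparr>)" using c by (rule mod_hom_codomain) simp
    have "inj_on c (carrier M)" by (rule inj_on_mod_homI[OF M(1) TM c]) (simp add: c0)
    then show "bij_betw c (carrier M) (carrier ((T 0)\<lparr>carrier := c ` carrier M\<rparr>))"
      by (simp add: bij_betw_def)
  qed
  ultimately show ?thesis unfolding gorenstein_projective_def by blast
qed

section \<open>Modules with two of the three properties\<close>

text \<open>
  Dimension shifting moves (G1) down to \<open>K\<close> and \<open>L\<close> and provides the extension of functionals that
  makes \<open>L\<close> reflexive.  If \<open>L\<^sup>*\<close> were semi-Gorenstein-projective, (G2) and (G3) would climb back from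
  \<open>L\<close> over \<open>K\<close> to \<open>M\<close>, and \<open>M\<close> would be Gorenstein-projective.
\<close>

lemma second_syzygy_properties:
  fixes A :: "('a, 'x) ring_scheme" and K :: "('a, 'p) module" and L :: "('a, 'q) module"
  assumes A: "left_noetherian A"
    and Ao: "left_noetherian (op_ring A)"
    and M: "left_module A M" "fin_gen A M"
    and G1: "semi_gorenstein_projective A M" and not_gp: "\<not> gorenstein_projective A M"
    and K: "is_syzygy A M K" and L: "is_syzygy A K L"
  shows "semi_gorenstein_projective A L" "reflexive A L"
    "\<not> semi_gorenstein_projective (op_ring A) (dual A L)"
proof -
  let ?r = "regular_module A"
  obtain P p where P: "fg_projective A P" and p: "p \<in> mod_hom A P M" "p ` carrier P = carrier M"
    and K_def: "K = P\<lparr>carrier := hom_kernel P M p\<rparr>"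
    using K by (auto simp: is_syzygy_def projective_cover_def)
  obtain Q q where Q: "fg_projective A Q" and q: "q \<in> mod_hom A Q K" "q ` carrier Q = carrier K"
    and L_def: "L = Q\<lparr>carrier := hom_kernel Q K q\<rparr>"
    using L by (auto simp: is_syzygy_def projective_cover_def)
  have PM: "left_module A P" by (rule fg_projective_module[OF P])
  interpret P: left_module A P by fact
  have sub: "submodule (hom_kernel P M p) A P" by (rule submodule_kernel[OF PM M(1) p(1)])
  have KM: "left_module A K" unfolding K_def by (rule P.left_module_submodule[OF sub])
  have Kfg: "fin_gen A K"
    unfolding K_def using P.noetherian_of_fin_gen[OF A fin_gen_projective[OF P]] sub
    by (rule P.fin_gen_submodule)
  note shift_M = iffD1[OF semi_gorenstein_projective_syzygy[OF A M(1) P p K_def] G1]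
  note shift_K = iffD1[OF semi_gorenstein_projective_syzygy[OF A KM Q q L_def] shift_M[THEN conjunct2]]
  note L1 = shift_K[THEN conjunct2]
  have extK: "\<exists>g\<in>mod_hom A P ?r. \<forall>x\<in>carrier K. g x = f x" if "f \<in> mod_hom A K ?r" for f
    using shift_M that by blast
  have extL: "\<exists>g\<in>mod_hom A Q ?r. \<forall>x\<in>carrier L. g x = f x" if "f \<in> mod_hom A L ?r" for f
    using shift_K that by blast
  show "semi_gorenstein_projective A L" by (rule L1)
  have torsionless: "y = \<zero>\<^bsub>K\<^esub>" if y: "y \<in> carrier K" and z: "\<And>f. f \<in> mod_hom A K ?r \<Longrightarrow> f y = \<zero>\<^bsub>A\<^esub>" for y
  proof -
    have yP: "y \<in> hom_kernel P M p" "y \<in> carrier P" using y by (auto simp: K_def hom_kernel_def)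
    have "g y = \<zero>\<^bsub>A\<^esub>" if g: "g \<in> mod_hom A P ?r" for g
      using z[of "restrict g (hom_kernel P M p)"] mod_hom_restrict[OF PM g sub] yP
      by (simp add: K_def)
    then have "y = \<zero>\<^bsub>P\<^esub>" by (rule projective_separated[OF P yP(2)])
    then show ?thesis by (simp add: K_def)
  qed
  show L3: "reflexive A L" by (rule reflexive_kernel[OF Q KM q(1) torsionless L_def extL])
  show "\<not> semi_gorenstein_projective (op_ring A) (dual A L)"
  proof
    assume L2: "semi_gorenstein_projective (op_ring A) (dual A L)"
    note K23 = reflexive_cokernel[OF Ao KM Kfg Q q L_def extL L3 L2]
    note M23 = reflexive_cokernel[OF Ao M P p K_def extK K23]
    show False using gorenstein_projective_criterion[OF A Ao M G1 M23(2,1)] not_gp by contradiction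
  qed
qed

text \<open>
  The dual of the evaluation map of \<open>M\<close> is a left inverse of the evaluation map of \<open>M\<^sup>*\<close>; it is
  bijective when \<open>M\<close> is reflexive, so the evaluation map of \<open>M\<^sup>*\<close> is its inverse.
\<close>

lemma reflexive_dual:
  assumes M: "left_module A M" and refl: "reflexive A M"
  shows "reflexive (op_ring A) (dual A M)"
proof -
  let ?r = "regular_module A" and ?D = "dual A M"
  have D: "left_module (op_ring A) ?D" by (rule right_module_dual[OF M])
  show ?thesis unfolding reflexive_iff[OF D]
  proof (intro conjI ballI impI)
    fix f assume f: "f \<in> carrier ?D"
      and z: "\<forall>\<xi>\<in>functionals (op_ring A) ?D. \<xi> f = \<zero>\<^bsub>op_ring A\<^esub>"
    have "f x = \<zero>\<^bsub>A\<^esub>" if "x \<in> carrier M" for x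
      using z eval_map_closed[OF M that] eval_map_apply[OF that] f by (metis dual_simps(1) op_ring_simps(2))
    moreover have "\<zero>\<^bsub>?D\<^esub> \<in> carrier ?D"
      using zero_functional[OF M] by simp
    ultimately show "f = \<zero>\<^bsub>?D\<^esub>"
      using f by (intro mod_hom_ext[of f A M ?r "\<zero>\<^bsub>?D\<^esub>" ?r]) auto
  next
    fix \<Phi> assume "\<Phi> \<in> functionals (op_ring (op_ring A)) (dual (op_ring A) ?D)"
    then have \<Phi>: "\<Phi> \<in> mod_hom A (dual (op_ring A) ?D) ?r" by simp
    let ?f = "compose (carrier M) \<Phi> (eval_map A M)"
    have f: "?f \<in> carrier ?D" using mod_hom_compose[OF M eval_map_hom[OF M] \<Phi>] by simp
    have "\<Phi> \<xi> = \<xi> ?f" if \<xi>: "\<xi> \<in> functionals (op_ring A) ?D" for \<xi>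
    proof -
      have "\<xi> \<in> eval_map A M ` carrier M" using refl \<xi> by (simp add: reflexive_def bij_betw_def)
      then obtain x where "x \<in> carrier M" "\<xi> = eval_map A M x" by blast
      then show ?thesis using f by (simp add: compose_def)
    qed
    then show "\<exists>f\<in>carrier ?D. \<forall>\<xi>\<in>functionals (op_ring A) ?D. \<Phi> \<xi> = \<xi> f"
      using f by blast
  qed
qed

theorem proposition1p7:
  fixes k :: "'k ring" and A :: "('k, 'a) module"
    and M :: "('a, 'm) module" and M' :: "('a, 'n) module"
    and K :: "('a, 'p) module" and L :: "('a, 'q) module"
  assumes "artin_algebra k A"
  shows "(left_module A M \<and> fin_gen A M \<and>
          semi_gorenstein_projective A M \<and> \<not> gorenstein_projective A M \<and>
          is_syzygy A M K \<and> is_syzygy A K L \<longrightarrow>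
            semi_gorenstein_projective A L \<and> reflexive A L \<and>
            \<not> semi_gorenstein_projective (op_ring A) (dual A L))
       \<and> (left_module A M' \<and> fin_gen A M' \<and>
          semi_gorenstein_projective A M' \<and> reflexive A M' \<and>
          \<not> semi_gorenstein_projective (op_ring A) (dual A M') \<longrightarrow>
            right_module A (dual A M') \<and> fin_gen (op_ring A) (dual A M') \<and>
            semi_gorenstein_projective A (dual (op_ring A) (dual A M')) \<and>
            reflexive (op_ring A) (dual A M') \<and>
            \<not> semi_gorenstein_projective (op_ring A) (dual A M'))"
proof (rule conjI; intro impI; elim conjE)
  note noeth = artin_algebra_noetherian[OF assms]
  assume "left_module A M" "fin_gen A M" "semi_gorenstein_projective A M"
    "\<not> gorenstein_projective A M" "is_syzygy A M K" "is_syzygy A K L"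
  from second_syzygy_properties[OF noeth this]
  show "semi_gorenstein_projective A L \<and> reflexive A L \<and>
      \<not> semi_gorenstein_projective (op_ring A) (dual A L)" by blast
next
  note noeth = artin_algebra_noetherian[OF assms]
  assume M': "left_module A M'" "fin_gen A M'" and G1: "semi_gorenstein_projective A M'"
    and G3: "reflexive A M'" and not_G2: "\<not> semi_gorenstein_projective (op_ring A) (dual A M')"
  have D: "right_module A (dual A M')" by (rule right_module_dual[OF M'(1)])
  have "bij_betw (eval_map A M') (carrier M') (carrier (dual (op_ring A) (dual A M')))"
    using G3 by (simp add: reflexive_def)
  then have "semi_gorenstein_projective A (dual (op_ring A) (dual A M'))"
    using semi_gorenstein_projective_iso[OF noeth(1) M' left_module_dual_op[OF D] eval_map_hom[OF M'(1)]] G1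
    by blast
  then show "right_module A (dual A M') \<and> fin_gen (op_ring A) (dual A M') \<and>
      semi_gorenstein_projective A (dual (op_ring A) (dual A M')) \<and>
      reflexive (op_ring A) (dual A M') \<and>
      \<not> semi_gorenstein_projective (op_ring A) (dual A M')"
    using D fin_gen_dual[OF noeth(2) M'] reflexive_dual[OF M'(1) G3] not_G2 by blast
qed

end
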